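(* Let $a(u,v)$, $\alpha(u,v)$ be smooth real functions in a neighbourhood $D$ of a point $(u_0,v_0)\in\mathbb R^2$, with $\alpha>0$ in $D$. Define $f=\frac12\left(\log\sqrt{1+a^2}-\log\alpha\right)$. Let $(\Phi,\Psi)$ be the solution of the PDE system $$ \Phi_v=f_v\Phi+af_u\Psi,\qquad \Psi_u=-af_v\Phi+f_u\Psi $$ with initial conditions $$ \Phi(u,v_0)=\exp\left(\int_{u_0}^u(-af_v+f_u)(t,v_0)\,dt+f(u_0,v_0)\right),\qquad \Psi(u_0,v)=\exp\left(\int_{v_0}^v(f_v+af_u)(u_0,s)\,ds+f(u_0,v_0)\right). $$ If the equation $$ \frac1{\Phi\Psi}\left(\frac{a_{uv}}{1+a^2}-\frac{a\,a_ua_v}{(1+a^2)^2}-2af_uf_v\right)+\frac{a\,a_uf_u}{(1+a^2)\Phi^2}-\frac{a\,a_vf_v}{(1+a^2)\Psi^2}+\frac{(f_u)^2}{\Phi^2}-\frac{(f_v)^2}{\Psi^2}+\frac1\Phi\left(\frac{f_u}{\Phi}\right)_u-\frac1\Psi\left(\frac{f_v}{\Psi}\right)_v+\frac{\alpha^2}{1+a^2}=0 $$ is satisfied, then there exists a unique (up to a motion) time-like surface $z=z(u,v)$ in $\mathbb R^3_1$, defined in a neighbourhood of $(u_0,v_0)$, for which $(u,v)$ are canonical asymptotic parameters (about $(u_0,v_0)$) and whose basic asymptotic invariants $a$ and $\alpha$ are the given functions.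
   Context: $\mathbb R^3_1$ is $\mathbb R^3$ with the scalar product $\langle x,y\rangle=x_1y_1+x_2y_2-x_3y_3$; write $x^2=\langle x,x\rangle$. A (smooth, regular, parametrized) surface $z=z(u,v)$ in $\mathbb R^3_1$ is time-like if its normal vector is space-like ($\langle\cdot,\cdot\rangle>0$) at every point. Let $E=z_u^2$, $F=\langle z_u,z_v\rangle$, $G=z_v^2$; let $n$ be the unit normal ($n^2=1$) such that $\{z_u,z_v,n\}$ is positively oriented; let $L=\langle n,z_{uu}\rangle$, $M=\langle n,z_{uv}\rangle$, $N=\langle n,z_{vv}\rangle$. The Gauss and mean curvatures are $K=\frac{LN-M^2}{EG-F^2}$ and $H=\frac{EN-2FM+GL}{2(EG-F^2)}$. The parameters $(u,v)$ are asymptotic if $L=N=0$. The surfaces considered are time-like with $K-H^2>0$, and asymptotic parameters are always taken so that $E>0$, $G<0$. In such parameters the basic asymptotic invariants $a$ and $\alpha$ of the surface are $$ a=\frac{F}{\sqrt E\sqrt{-G}},\qquad \alpha=\frac{M}{\sqrt E\sqrt{-G}}, $$ and one puts $f=\frac12\left(\log\sqrt{1+a^2}-\log|\alpha|\right)$. The asymptotic parameters $(u,v)$ (on an open rectangle containing $(u_0,v_0)$) are called canonical asymptotic parameters about $(u_0,v_0)$ if $$ \sqrt E=\exp\left(\int_{v_0}^v\left(f_v+af_u\frac{\sqrt{-G}}{\sqrt E}\right)(u,s)\,ds+\int_{u_0}^u\left(-af_v\frac{\sqrt E}{\sqrt{-G}}+f_u\right)(t,v_0)\,dt+f(u_0,v_0)\right),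 $$ $$ \sqrt{-G}=\exp\left(\int_{u_0}^u\left(-af_v\frac{\sqrt E}{\sqrt{-G}}+f_u\right)(t,v)\,dt+\int_{v_0}^v\left(f_v+af_u\frac{\sqrt{-G}}{\sqrt E}\right)(u_0,s)\,ds+f(u_0,v_0)\right). $$ The statement is local: $D$ may be replaced by a smaller neighbourhood of $(u_0,v_0)$, e.g. an open rectangle on which $\Phi,\Psi>0$, and the surface is defined on a possibly smaller neighbourhood; uniqueness is among time-like surfaces in $\mathbb R^3_1$ with $K-H^2>0$, $E>0$, $G<0$, parametrized by $(u,v)$ as canonical asymptotic parameters (on a common connected neighbourhood). A motion is a map $p\mapsto Ap+b$ where $A$ is a linear isometry of $\mathbb R^3_1$ with $\det A=1$. *)

theory Defs
  imports "HOL-Analysis.Analysis"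
begin

section \<open>Calculus in the parameter plane\<close>

definition partial_u :: "(real \<times> real \<Rightarrow> 'a::real_normed_vector) \<Rightarrow> real \<times> real \<Rightarrow> 'a"
  (\<open>\<partial>\<^sub>u\<close>) where
  "\<partial>\<^sub>u g p = vector_derivative (\<lambda>t. g (t, snd p)) (at (fst p))"

definition partial_v :: "(real \<times> real \<Rightarrow> 'a::real_normed_vector) \<Rightarrow> real \<times> real \<Rightarrow> 'a"
  (\<open>\<partial>\<^sub>v\<close>) where
  "\<partial>\<^sub>v g p = vector_derivative (\<lambda>s. g (fst p, s)) (at (snd p))"

text \<open>Only meant for open \<open>U\<close>. Requiring total differentiability guarantees that the partial
  derivatives, which are total functions here, have their intended meaning on \<open>U\<close>.\<close>

primrec Ck_on :: "nat \<Rightarrow> (real \<times> real) set \<Rightarrow> (real \<times> real \<Rightarrow> 'a::real_normed_vector) \<Rightarrow> bool" where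
  "Ck_on 0 U g \<longleftrightarrow> continuous_on U g"
| "Ck_on (Suc k) U g \<longleftrightarrow> g differentiable_on U \<and> Ck_on k U (\<partial>\<^sub>u g) \<and> Ck_on k U (\<partial>\<^sub>v g)"

definition smooth_on :: "(real \<times> real) set \<Rightarrow> (real \<times> real \<Rightarrow> 'a::real_normed_vector) \<Rightarrow> bool" where
  "smooth_on U g \<longleftrightarrow> (\<forall>k. Ck_on k U g)"

definition open_rectangle :: "(real \<times> real) set \<Rightarrow> bool" where
  "open_rectangle U \<longleftrightarrow> (\<exists>u1 u2 v1 v2. U = {u1<..<u2} \<times> {v1<..<v2})"


section \<open>Minkowski space and its motions\<close>

definition lorentz :: "real ^ 3 \<Rightarrow> real ^ 3 \<Rightarrow> real" where
  "lorentz x y = x $ 1 * y $ 1 + x $ 2 * y $ 2 - x $ 3 * y $ 3"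

definition motion :: "(real ^ 3 \<Rightarrow> real ^ 3) \<Rightarrow> bool" where
  "motion T \<longleftrightarrow> (\<exists>A b. linear A \<and> (\<forall>x y. lorentz (A x) (A y) = lorentz x y) \<and>
     det (matrix A) = 1 \<and> T = (\<lambda>p. A p + b))"


section \<open>Parametrized surfaces\<close>

definition regular_surface :: "(real \<times> real) set \<Rightarrow> (real \<times> real \<Rightarrow> real ^ 3) \<Rightarrow> bool" where
  "regular_surface U z \<longleftrightarrow> open U \<and> smooth_on U z \<and>
     (\<forall>p\<in>U. \<forall>r s. r *\<^sub>R \<partial>\<^sub>u z p + s *\<^sub>R \<partial>\<^sub>v z p = 0 \<longrightarrow> r = 0 \<and> s = 0)"

definition normal_vector :: "(real \<times> real \<Rightarrow> real ^ 3) \<Rightarrow> real \<times> real \<Rightarrow> real ^ 3 \<Rightarrow> bool" where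
  "normal_vector z p n \<longleftrightarrow> n \<noteq> 0 \<and> lorentz n (\<partial>\<^sub>u z p) = 0 \<and> lorentz n (\<partial>\<^sub>v z p) = 0"

definition timelike_surface :: "(real \<times> real) set \<Rightarrow> (real \<times> real \<Rightarrow> real ^ 3) \<Rightarrow> bool" where
  "timelike_surface U z \<longleftrightarrow> regular_surface U z \<and>
     (\<forall>p\<in>U. \<forall>n. normal_vector z p n \<longrightarrow> lorentz n n > 0)"

text \<open>On a time-like surface exactly one of the two unit normals satisfies the orientation
  condition, so the definite description is proper there.\<close>

definition unit_normal :: "(real \<times> real \<Rightarrow> real ^ 3) \<Rightarrow> real \<times> real \<Rightarrow> real ^ 3" where
  "unit_normal z p = (THE n. normal_vector z p n \<and> lorentz n n = 1 \<and>
     det (vector [\<partial>\<^sub>u z p, \<partial>\<^sub>v z p, n] :: real ^ 3 ^ 3) > 0)"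

definition coeff_E :: "(real \<times> real \<Rightarrow> real ^ 3) \<Rightarrow> real \<times> real \<Rightarrow> real" where
  "coeff_E z p = lorentz (\<partial>\<^sub>u z p) (\<partial>\<^sub>u z p)"

definition coeff_F :: "(real \<times> real \<Rightarrow> real ^ 3) \<Rightarrow> real \<times> real \<Rightarrow> real" where
  "coeff_F z p = lorentz (\<partial>\<^sub>u z p) (\<partial>\<^sub>v z p)"

definition coeff_G :: "(real \<times> real \<Rightarrow> real ^ 3) \<Rightarrow> real \<times> real \<Rightarrow> real" where
  "coeff_G z p = lorentz (\<partial>\<^sub>v z p) (\<partial>\<^sub>v z p)"

definition coeff_L :: "(real \<times> real \<Rightarrow> real ^ 3) \<Rightarrow> real \<times> real \<Rightarrow> real" where
  "coeff_L z p = lorentz (unit_normal z p) (\<partial>\<^sub>u (\<partial>\<^sub>u z) p)"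

definition coeff_M :: "(real \<times> real \<Rightarrow> real ^ 3) \<Rightarrow> real \<times> real \<Rightarrow> real" where
  "coeff_M z p = lorentz (unit_normal z p) (\<partial>\<^sub>v (\<partial>\<^sub>u z) p)"

definition coeff_N :: "(real \<times> real \<Rightarrow> real ^ 3) \<Rightarrow> real \<times> real \<Rightarrow> real" where
  "coeff_N z p = lorentz (unit_normal z p) (\<partial>\<^sub>v (\<partial>\<^sub>v z) p)"

definition gauss_curvature :: "(real \<times> real \<Rightarrow> real ^ 3) \<Rightarrow> real \<times> real \<Rightarrow> real" where
  "gauss_curvature z p = (coeff_L z p * coeff_N z p - (coeff_M z p)\<^sup>2) /
     (coeff_E z p * coeff_G z p - (coeff_F z p)\<^sup>2)"

definition mean_curvature :: "(real \<times> real \<Rightarrow> real ^ 3) \<Rightarrow> real \<times> real \<Rightarrow> real" where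
  "mean_curvature z p =
     (coeff_E z p * coeff_N z p - 2 * coeff_F z p * coeff_M z p + coeff_G z p * coeff_L z p) /
     (2 * (coeff_E z p * coeff_G z p - (coeff_F z p)\<^sup>2))"


section \<open>Asymptotic and canonical asymptotic parameters\<close>

definition asymptotic_parameters :: "(real \<times> real) set \<Rightarrow> (real \<times> real \<Rightarrow> real ^ 3) \<Rightarrow> bool" where
  "asymptotic_parameters U z \<longleftrightarrow>
     (\<forall>p\<in>U. coeff_L z p = 0 \<and> coeff_N z p = 0 \<and> coeff_E z p > 0 \<and> coeff_G z p < 0)"

definition inv_a :: "(real \<times> real \<Rightarrow> real ^ 3) \<Rightarrow> real \<times> real \<Rightarrow> real" where
  "inv_a z p = coeff_F z p / (sqrt (coeff_E z p) * sqrt (- coeff_G z p))"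

definition inv_alpha :: "(real \<times> real \<Rightarrow> real ^ 3) \<Rightarrow> real \<times> real \<Rightarrow> real" where
  "inv_alpha z p = coeff_M z p / (sqrt (coeff_E z p) * sqrt (- coeff_G z p))"

definition inv_f :: "(real \<times> real \<Rightarrow> real ^ 3) \<Rightarrow> real \<times> real \<Rightarrow> real" where
  "inv_f z p = (ln (sqrt (1 + (inv_a z p)\<^sup>2)) - ln \<bar>inv_alpha z p\<bar>) / 2"

text \<open>The two integrands occurring in the definition of canonical parameters. The interval
  integral \<open>LBINT t=x..y\<close> is oriented, so \<open>y < x\<close> is allowed.\<close>

definition integrand_v :: "(real \<times> real \<Rightarrow> real ^ 3) \<Rightarrow> real \<times> real \<Rightarrow> real" where
  "integrand_v z p = \<partial>\<^sub>v (inv_f z) p +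
     inv_a z p * \<partial>\<^sub>u (inv_f z) p * (sqrt (- coeff_G z p) / sqrt (coeff_E z p))"

definition integrand_u :: "(real \<times> real \<Rightarrow> real ^ 3) \<Rightarrow> real \<times> real \<Rightarrow> real" where
  "integrand_u z p = - inv_a z p * \<partial>\<^sub>v (inv_f z) p *
     (sqrt (coeff_E z p) / sqrt (- coeff_G z p)) + \<partial>\<^sub>u (inv_f z) p"

definition canonical_asymptotic_parameters ::
  "real \<Rightarrow> real \<Rightarrow> (real \<times> real) set \<Rightarrow> (real \<times> real \<Rightarrow> real ^ 3) \<Rightarrow> bool" where
  "canonical_asymptotic_parameters u0 v0 U z \<longleftrightarrow>
     open_rectangle U \<and> (u0, v0) \<in> U \<and> asymptotic_parameters U z \<and>
     (\<forall>u v. (u, v) \<in> U \<longrightarrow>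
        sqrt (coeff_E z (u, v)) =
          exp ((LBINT s=v0..v. integrand_v z (u, s)) + (LBINT t=u0..u. integrand_u z (t, v0))
               + inv_f z (u0, v0)) \<and>
        sqrt (- coeff_G z (u, v)) =
          exp ((LBINT t=u0..u. integrand_u z (t, v)) + (LBINT s=v0..v. integrand_v z (u0, s))
               + inv_f z (u0, v0)))"

definition canonical_surface_with_invariants ::
  "real \<Rightarrow> real \<Rightarrow> (real \<times> real \<Rightarrow> real) \<Rightarrow> (real \<times> real \<Rightarrow> real) \<Rightarrow>
   (real \<times> real) set \<Rightarrow> (real \<times> real \<Rightarrow> real ^ 3) \<Rightarrow> bool" where
  "canonical_surface_with_invariants u0 v0 a \<alpha> U z \<longleftrightarrow>
     timelike_surface U z \<and> (\<forall>p\<in>U. gauss_curvature z p - (mean_curvature z p)\<^sup>2 > 0) \<and>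
     canonical_asymptotic_parameters u0 v0 U z \<and>
     (\<forall>p\<in>U. inv_a z p = a p \<and> inv_alpha z p = \<alpha> p)"

end

(*
A time-like surface is described by the moving frame (z, e1, e2, n), where z_u = Phi e1, n is the
unit normal and (e1, e2, n) is orthonormal of signature (1, -1, 1).  All coefficients of the linear
system satisfied by the frame are determined by a, alpha, Phi, Psi; its integrability conditions are
the system for (Phi, Psi), the formula defining f, and the displayed equation (the Gauss equation).

Existence: the linear system is solved near (u0, v0) by a contraction argument for an integral
equation along v = v0 and then along vertical segments.  The limit is only known to be continuous;
integrating in the opposite order gives a second function, and integrability together with Fubini
yields a Volterra equation for the difference, which therefore vanishes.  No differentiability with
respect to parameters is needed.

Uniqueness: sqrt E and sqrt (-G) solve a linear Goursat problem determined by a and alpha, so both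
surfaces have the same metric and frame system, and the linear map carrying one frame to the other
is constant.
*)

theory Submission
  imports Defs
begin

section \<open>Calculus in the parameter plane\<close>

text \<open>The initial conditions prescribe \<Phi> on one axis and \<Psi> on the other, without the
  ratio that occurs in the definition of canonical parameters. The gap closes because the system
  forces \<Phi> = \<Psi> on both axes; conversely, the two canonical formulas coincide on each axis.
  Off the axes, division of the system by \<Phi> and \<Psi> turns the canonical integrands into
  derivatives of logarithms.

  The frame is fixed by z_v = a \<Psi> e1 + \<sigma> \<Psi> e2, where \<sigma>^2 = 1 + a^2 is what
  makes the square of z_v equal to - \<Psi>^2.

  Orthonormality has to be propagated from one point. The scalar products of the frame vectors
  satisfy only a coupled linear system, whereas the signed sum of their tensor squares has
  derivative zero identically; hence the frame relations are also used in this dual form. Constancy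
  from vanishing partials likewise gives orientation and congruence. Smoothness is recovered
  afterwards, because each derivative of the frame is a combination of the frame with smooth
  coefficients.\<close>

text \<open>The operators \<open>\<partial>\<^sub>u\<close> and \<open>\<partial>\<^sub>v\<close>
  are total functions, so an equation about their values does not give differentiability. This
  predicate carries both pieces of information and is stable under the calculus rules; values are
  read off from it by \<open>partial_u_eq\<close> and \<open>partial_v_eq\<close>.\<close>

definition has_partials :: "(real \<times> real \<Rightarrow> 'a::real_normed_vector) \<Rightarrow> 'a \<Rightarrow> 'a \<Rightarrow> real \<times> real \<Rightarrow> bool" where
  "has_partials g gu gv p \<longleftrightarrow> (g has_derivative (\<lambda>h. fst h *\<^sub>R gu + snd h *\<^sub>R gv)) (at p)"

lemma has_partials_u:
  assumes "has_partials g gu gv p"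
  shows "((\<lambda>t. g (t, snd p)) has_vector_derivative gu) (at (fst p))"
proof -
  have g: "(g has_derivative (\<lambda>h. fst h *\<^sub>R gu + snd h *\<^sub>R gv)) (at (fst p, snd p))"
    using assms by (simp add: has_partials_def)
  have l: "((\<lambda>t. (t, snd p)) has_derivative (\<lambda>h. (h, 0))) (at (fst p))"
    by (auto intro!: derivative_eq_intros)
  show ?thesis using has_derivative_compose[OF l g] by (simp add: has_vector_derivative_def)
qed

lemma has_partials_v:
  assumes "has_partials g gu gv p"
  shows "((\<lambda>s. g (fst p, s)) has_vector_derivative gv) (at (snd p))"
proof -
  have g: "(g has_derivative (\<lambda>h. fst h *\<^sub>R gu + snd h *\<^sub>R gv)) (at (fst p, snd p))"
    using assms by (simp add: has_partials_def)
  have l: "((\<lambda>t. (fst p, t)) has_derivative (\<lambda>h. (0, h))) (at (snd p))"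
    by (auto intro!: derivative_eq_intros)
  show ?thesis using has_derivative_compose[OF l g] by (simp add: has_vector_derivative_def)
qed

lemma partial_u_eq: "has_partials g gu gv p \<Longrightarrow> \<partial>\<^sub>u g p = gu"
  unfolding partial_u_def by (rule vector_derivative_at) (rule has_partials_u)

lemma partial_v_eq: "has_partials g gu gv p \<Longrightarrow> \<partial>\<^sub>v g p = gv"
  unfolding partial_v_def by (rule vector_derivative_at) (rule has_partials_v)

lemma has_partials_differentiable: "has_partials g gu gv p \<Longrightarrow> g differentiable (at p)"
  unfolding has_partials_def by (rule differentiableI)

lemma differentiable_has_partials:
  assumes "g differentiable (at p)"
  shows "has_partials g (\<partial>\<^sub>u g p) (\<partial>\<^sub>v g p) p"
proof -
  obtain g' where g': "(g has_derivative g') (at p)"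
    using assms unfolding differentiable_def by blast
  interpret bounded_linear g' using g' by (rule has_derivative_bounded_linear)
  have "g' h = fst h *\<^sub>R g' (1, 0) + snd h *\<^sub>R g' (0, 1)" for h
  proof -
    have "h = fst h *\<^sub>R (1, 0) + snd h *\<^sub>R (0, 1)" by (simp add: prod_eq_iff)
    then show ?thesis by (metis add scaleR)
  qed
  then have "g' = (\<lambda>h. fst h *\<^sub>R g' (1, 0) + snd h *\<^sub>R g' (0, 1))" by blast
  then have "has_partials g (g' (1, 0)) (g' (0, 1)) p"
    using g' unfolding has_partials_def by simp
  then show ?thesis using partial_u_eq partial_v_eq by metis
qed

lemma differentiable_on_has_partials:
  "open U \<Longrightarrow> g differentiable_on U \<Longrightarrow> p \<in> U \<Longrightarrow> has_partials g (\<partial>\<^sub>u g p) (\<partial>\<^sub>v g p) p"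
  by (metis differentiable_has_partials differentiable_on_eq_differentiable_at)

lemma has_partials_transform:
  assumes "has_partials g gu gv p" "open U" "p \<in> U" "\<And>q. q \<in> U \<Longrightarrow> g q = h q"
  shows "has_partials h gu gv p"
  unfolding has_partials_def
  by (rule has_derivative_transform_within_open[OF assms(1)[unfolded has_partials_def] assms(2-4)])

text \<open>Both operators only look along a coordinate line near \<open>p\<close>. A product
  neighbourhood inside \<open>U\<close> contains a piece of each line, and so no differentiability
  has to be known.\<close>

lemma partial_cong:
  assumes "open U" "p \<in> U" "\<And>q. q \<in> U \<Longrightarrow> g q = h q"
  shows "\<partial>\<^sub>u g p = \<partial>\<^sub>u h p" "\<partial>\<^sub>v g p = \<partial>\<^sub>v h p"
proof -
  obtain A B where AB: "open A" "open B" "p \<in> A \<times> B" "A \<times> B \<subseteq> U"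
    using open_prod_elim[OF assms(1,2)] by metis
  have ev: "eventually (\<lambda>t. t \<in> A) (nhds (fst p))" "eventually (\<lambda>s. s \<in> B) (nhds (snd p))"
    using AB by (auto intro: eventually_nhds_in_open)
  moreover have eq1: "t \<in> UNIV \<longrightarrow> g (t, snd p) = h (t, snd p)" if "t \<in> A" for t
  proof -
    have "(t, snd p) \<in> U" using AB(3,4) that by auto
    then show ?thesis by (simp add: assms(3))
  qed
  moreover have eq2: "s \<in> UNIV \<longrightarrow> g (fst p, s) = h (fst p, s)" if "s \<in> B" for s
  proof -
    have "(fst p, s) \<in> U" using AB(3,4) that by auto
    then show ?thesis by (simp add: assms(3))
  qed
  ultimately have "eventually (\<lambda>t. t \<in> UNIV \<longrightarrow> g (t, snd p) = h (t, snd p)) (nhds (fst p))"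
     "eventually (\<lambda>s. s \<in> UNIV \<longrightarrow> g (fst p, s) = h (fst p, s)) (nhds (snd p))"
    using eventually_mono[OF ev(1) eq1] eventually_mono[OF ev(2) eq2] by simp_all
  from vector_derivative_cong_eq[OF this(1) refl refl] vector_derivative_cong_eq[OF this(2) refl refl]
  show "\<partial>\<^sub>u g p = \<partial>\<^sub>u h p" "\<partial>\<^sub>v g p = \<partial>\<^sub>v h p"
    unfolding partial_u_def partial_v_def by simp_all
qed

lemma has_partials_const: "has_partials (\<lambda>_. c) 0 0 p"
  unfolding has_partials_def by simp

lemma has_partials_add:
  "has_partials g gu gv p \<Longrightarrow> has_partials h hu hv p \<Longrightarrow>
    has_partials (\<lambda>p. g p + h p) (gu + hu) (gv + hv) p"
  unfolding has_partials_def
  by (drule (1) has_derivative_add) (simp add: scaleR_add_right add.commute add.left_commute add.assoc)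

lemma (in bounded_linear) has_partials:
  "has_partials g gu gv p \<Longrightarrow> has_partials (\<lambda>p. f (g p)) (f gu) (f gv) p"
  unfolding has_partials_def by (drule has_derivative) (simp add: add scaleR)

lemma has_partials_minus: "has_partials g gu gv p \<Longrightarrow> has_partials (\<lambda>p. - g p) (- gu) (- gv) p"
  by (rule bounded_linear.has_partials[OF bounded_linear_minus[OF bounded_linear_ident]])

lemma has_partials_diff:
  "has_partials g gu gv p \<Longrightarrow> has_partials h hu hv p \<Longrightarrow>
    has_partials (\<lambda>p. g p - h p) (gu - hu) (gv - hv) p"
  using has_partials_add[OF _ has_partials_minus, of g gu gv p h hu hv] by simp

lemma (in bounded_bilinear) has_partials:
  assumes "has_partials g gu gv p" "has_partials h hu hv p"
  shows "has_partials (\<lambda>p. prod (g p) (h p)) (prod gu (h p) + prod (g p) hu) (prod gv (h p) + prod (g p) hv) p"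
  using FDERIV[OF assms[unfolded has_partials_def]]
  unfolding has_partials_def
  by (simp add: add_left add_right scaleR_left scaleR_right scaleR_add_right add.commute add.left_commute add.assoc)

lemmas has_partials_mult = bounded_bilinear.has_partials[OF bounded_bilinear_mult]
lemmas has_partials_scaleR = bounded_bilinear.has_partials[OF bounded_bilinear_scaleR]

lemma has_partials_compose_real:
  assumes "has_partials g gu gv p" "(\<phi> has_real_derivative d) (at (g p))"
  shows "has_partials (\<lambda>p. \<phi> (g p)) (d * gu) (d * gv) p"
proof -
  have "(\<phi> has_derivative (*) d) (at (g p))"
    using assms(2) by (simp add: has_field_derivative_def)
  from has_derivative_compose[OF assms(1)[unfolded has_partials_def] this]
  show ?thesis unfolding has_partials_def by (simp add: algebra_simps)
qed

lemma has_partials_inverse: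
  fixes g :: "real \<times> real \<Rightarrow> real"
  assumes "has_partials g gu gv p" "g p \<noteq> 0"
  shows "has_partials (\<lambda>p. inverse (g p)) (- (inverse (g p))\<^sup>2 * gu) (- (inverse (g p))\<^sup>2 * gv) p"
  by (rule has_partials_compose_real[OF assms(1)])
     (use assms(2) in \<open>auto intro!: derivative_eq_intros simp: power2_eq_square\<close>)

lemma has_partials_divide:
  fixes g :: "real \<times> real \<Rightarrow> real"
  assumes "has_partials g gu gv p" "has_partials h hu hv p" "h p \<noteq> 0"
  shows "has_partials (\<lambda>p. g p / h p) ((gu * h p - g p * hu) / (h p)\<^sup>2) ((gv * h p - g p * hv) / (h p)\<^sup>2) p"
  using has_partials_mult[OF assms(1) has_partials_inverse[OF assms(2,3)]] assms(3)
  by (simp add: field_simps power2_eq_square)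

lemma has_partials_sqrt:
  assumes "has_partials g gu gv p" "g p > 0"
  shows "has_partials (\<lambda>p. sqrt (g p)) (gu / (2 * sqrt (g p))) (gv / (2 * sqrt (g p))) p"
  using has_partials_compose_real[OF assms(1) DERIV_real_sqrt[OF assms(2)]]
  by (simp add: field_simps)

lemma has_partials_ln:
  fixes g :: "real \<times> real \<Rightarrow> real"
  assumes "has_partials g gu gv p" "g p > 0"
  shows "has_partials (\<lambda>p. ln (g p)) (gu / g p) (gv / g p) p"
  using has_partials_compose_real[OF assms(1) DERIV_ln_divide[OF assms(2)]]
  by simp

text \<open>The increment is split into a u-step at the fixed ordinate and a v-step at a nearby
  abscissa; continuity of the v-partial controls the second. This is how a solution that is only
  known to be differentiable along coordinate lines becomes totally differentiable.\<close>

lemma has_partials_of_continuous: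
  fixes g :: "real \<times> real \<Rightarrow> 'a::real_normed_vector"
  assumes "open U" "p \<in> U"
    and u: "\<And>u v. (u, v) \<in> U \<Longrightarrow> ((\<lambda>t. g (t, v)) has_vector_derivative gu (u, v)) (at u)"
    and v: "\<And>u v. (u, v) \<in> U \<Longrightarrow> ((\<lambda>s. g (u, s)) has_vector_derivative gv (u, v)) (at v)"
    and cont: "continuous_on U gv"
  shows "has_partials g (gu p) (gv p) p"
proof -
  obtain u v where p: "p = (u, v)" by (cases p)
  obtain A B where AB: "open A" "open B" "(u, v) \<in> A \<times> B" "A \<times> B \<subseteq> U"
    using open_prod_elim[OF assms(1)] assms(2) p by metis
  obtain e where e: "e > 0" "ball v e \<subseteq> B"
    using AB(2,3) by (metis mem_Sigma_iff openE)
  \<comment> \<open>The mean value estimate for the v-step runs along vertical segments, which calls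
    for a convex second factor.\<close>
  let ?Y = "ball v e"
  have sub: "A \<times> ?Y \<subseteq> U" using AB(4) e(2) by blast
  have mem: "(u, v) \<in> A \<times> ?Y" using AB(3) e by simp
  have "((\<lambda>(x, y). g (x, y)) has_derivative
      (\<lambda>(tx, ty). tx *\<^sub>R gu (u, v) + blinfun_scaleR_left (gv (u, v)) ty)) (at (u, v) within A \<times> ?Y)"
  proof (rule has_derivative_partialsI)
    show "((\<lambda>x. g (x, v)) has_derivative (\<lambda>t. t *\<^sub>R gu (u, v))) (at u within A)"
    proof -
      have "(u, v) \<in> U" using mem sub by blast
      then show ?thesis
        using u[of u v] by (auto simp: has_vector_derivative_def intro: has_derivative_at_withinI)
    qed
    show "((\<lambda>y. g (x, y)) has_derivative blinfun_scaleR_left (gv (x, y))) (at y within ball v e)"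
      if "x \<in> A" "y \<in> ball v e" for x y
    proof -
      have "(x, y) \<in> U" using that sub by blast
      then show ?thesis
        using v[of x y] by (auto simp: has_vector_derivative_def intro: has_derivative_at_withinI)
    qed
    have "continuous_on (A \<times> ?Y) (\<lambda>(x, y). blinfun_scaleR_left (gv (x, y)))"
      using continuous_on_subset[OF cont sub]
      by (auto simp: split_beta' intro!: bounded_linear.continuous_on[OF bounded_linear_blinfun_scaleR_left])
    then show "continuous (at (u, v) within A \<times> ?Y) (\<lambda>(x, y). blinfun_scaleR_left (gv (x, y)))"
      unfolding continuous_on_eq_continuous_within using mem by blast
  qed (use e in auto)
  moreover have "open (A \<times> ?Y)" using AB(1) by (intro open_Times) auto
  ultimately show ?thesis
    unfolding has_partials_def p using mem by (simp add: at_within_open[OF mem] split_beta')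
qed

text \<open>The conservation principle used for the frame relations, the orientation of the frame,
  the congruence of two frames, and the final translation.\<close>

lemma partials_zero_imp_constant:
  fixes g :: "real \<times> real \<Rightarrow> 'a::real_normed_vector"
  assumes "convex U" "\<And>p. p \<in> U \<Longrightarrow> has_partials g 0 0 p" "p \<in> U" "q \<in> U"
  shows "g p = g q"
proof -
  have "\<exists>c. \<forall>x\<in>U. g x = c"
    using assms(2) unfolding has_partials_def
    by (intro has_derivative_zero_constant[OF assms(1)]) (auto intro: has_derivative_at_withinI)
  then show ?thesis using assms(3,4) by auto
qed

section \<open>Rules for C^k and smooth functions\<close>

text \<open>The recursion in \<open>Ck_on\<close> passes to the functions
  \<open>\<partial>\<^sub>u g\<close> and \<open>\<partial>\<^sub>v g\<close>, for which formulas
  are available on \<open>U\<close> only. Openness of \<open>U\<close> makes the partials of two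
  functions agree wherever the functions do, and the induction runs over all pairs of
  functions.\<close>

lemma Ck_on_cong_imp:
  assumes "open U"
  shows "(\<And>p. p \<in> U \<Longrightarrow> g p = h p) \<Longrightarrow> Ck_on k U g \<Longrightarrow> Ck_on k U h"
proof (induction k arbitrary: g h)
  case 0
  then show ?case by (simp cong: continuous_on_cong)
next
  case (Suc k)
  have "h differentiable (at p)" if "p \<in> U" for p
  proof (rule has_partials_differentiable)
    show "has_partials h (\<partial>\<^sub>u g p) (\<partial>\<^sub>v g p) p"
      by (rule has_partials_transform[OF _ assms that Suc.prems(1)])
         (use Suc.prems(2) assms that in \<open>simp_all add: differentiable_on_has_partials\<close>)
  qed
  then have "h differentiable_on U"
    using differentiable_on_eq_differentiable_at[OF assms] by blast
  moreover have "Ck_on k U (\<partial>\<^sub>u h)"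
    by (rule Suc.IH[of "\<partial>\<^sub>u g"]) (use Suc.prems partial_cong(1)[OF assms _ Suc.prems(1)] in simp_all)
  moreover have "Ck_on k U (\<partial>\<^sub>v h)"
    by (rule Suc.IH[of "\<partial>\<^sub>v g"]) (use Suc.prems partial_cong(2)[OF assms _ Suc.prems(1)] in simp_all)
  ultimately show ?case by simp
qed

text \<open>The bootstrapping step of all regularity arguments: \<open>gu\<close> and
  \<open>gv\<close> are explicit expressions for the partials, which may contain \<open>g\<close>
  itself at the lower order \<open>k\<close>.\<close>

lemma Ck_on_SucI:
  assumes "open U" and g: "\<And>p. p \<in> U \<Longrightarrow> has_partials g (gu p) (gv p) p"
    and "Ck_on k U gu" "Ck_on k U gv"
  shows "Ck_on (Suc k) U g"
proof -
  have "g differentiable_on U"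
    unfolding differentiable_on_eq_differentiable_at[OF assms(1)]
    using has_partials_differentiable[OF g] by blast
  moreover have "Ck_on k U (\<partial>\<^sub>u g)"
    by (rule Ck_on_cong_imp[OF assms(1) _ assms(3)]) (simp add: partial_u_eq[OF g])
  moreover have "Ck_on k U (\<partial>\<^sub>v g)"
    by (rule Ck_on_cong_imp[OF assms(1) _ assms(4)]) (simp add: partial_v_eq[OF g])
  ultimately show ?thesis by simp
qed

lemma Ck_on_has_partials:
  "open U \<Longrightarrow> Ck_on (Suc k) U g \<Longrightarrow> p \<in> U \<Longrightarrow> has_partials g (\<partial>\<^sub>u g p) (\<partial>\<^sub>v g p) p"
  by (simp add: differentiable_on_has_partials)

lemma Ck_on_Suc_imp: "Ck_on (Suc k) U g \<Longrightarrow> Ck_on k U g"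
proof (induction k arbitrary: g)
  case (Suc k)
  from Suc.prems have "g differentiable_on U" "Ck_on (Suc k) U (\<partial>\<^sub>u g)" "Ck_on (Suc k) U (\<partial>\<^sub>v g)"
    by simp_all
  with Suc.IH[of "\<partial>\<^sub>u g"] Suc.IH[of "\<partial>\<^sub>v g"] show ?case by (metis Ck_on.simps(2))
qed (simp add: differentiable_imp_continuous_on)

lemma Ck_on_subset:
  assumes "V \<subseteq> U"
  shows "Ck_on k U g \<Longrightarrow> Ck_on k V g"
proof (induction k arbitrary: g)
  case 0
  then show ?case using continuous_on_subset[OF _ assms] by simp
next
  case (Suc k)
  from Suc.prems have "g differentiable_on U" "Ck_on k U (\<partial>\<^sub>u g)" "Ck_on k U (\<partial>\<^sub>v g)"
    by simp_all
  from this(1) differentiable_on_subset[OF _ assms] Suc.IH[OF this(2)] Suc.IH[OF this(3)]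
  show ?case by simp
qed

lemma Ck_on_const: "Ck_on k U (\<lambda>_. c)"
proof (induction k arbitrary: c)
  case (Suc k)
  have "\<partial>\<^sub>u (\<lambda>_. c) = (\<lambda>_. 0)" "\<partial>\<^sub>v (\<lambda>_. c) = (\<lambda>_. 0)"
    using has_partials_const partial_u_eq partial_v_eq by blast+
  then show ?case using Suc by simp
qed simp

lemma Ck_on_add:
  assumes "open U"
  shows "Ck_on k U g \<Longrightarrow> Ck_on k U h \<Longrightarrow> Ck_on k U (\<lambda>p. g p + h p)"
proof (induction k arbitrary: g h)
  case (Suc k)
  show ?case
    by (rule Ck_on_SucI[OF assms has_partials_add[OF Ck_on_has_partials Ck_on_has_partials]])
       (use Suc assms in auto)
qed (auto intro: continuous_intros)

text \<open>By the product rule each partial is a sum of two products in which one factor has been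
  differentiated; hence both factors vary in the induction. One proof covers multiplication,
  scaling, the Lorentz product and the cross product.\<close>

lemma (in bounded_bilinear) Ck_on:
  assumes "open U"
  shows "Ck_on k U g \<Longrightarrow> Ck_on k U h \<Longrightarrow> Ck_on k U (\<lambda>p. prod (g p) (h p))"
proof (induction k arbitrary: g h)
  case (Suc k)
  note [simp del] = Ck_on.simps(2)
  have "Ck_on k U (\<partial>\<^sub>u g)" "Ck_on k U (\<partial>\<^sub>v g)" "Ck_on k U (\<partial>\<^sub>u h)" "Ck_on k U (\<partial>\<^sub>v h)"
    using Suc.prems by (simp_all add: Ck_on.simps(2))
  with Suc.prems[THEN Ck_on_Suc_imp] show ?case
    by (intro Ck_on_SucI[OF assms has_partials[OF Ck_on_has_partials[OF assms Suc.prems(1)]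
            Ck_on_has_partials[OF assms Suc.prems(2)]]] Ck_on_add Suc.IH assms)
qed (auto intro: continuous_on)

lemmas Ck_on_mult = bounded_bilinear.Ck_on[OF bounded_bilinear_mult]
lemmas Ck_on_scaleR = bounded_bilinear.Ck_on[OF bounded_bilinear_scaleR]

lemma Ck_on_minus: "open U \<Longrightarrow> Ck_on k U g \<Longrightarrow> Ck_on k U (\<lambda>p. - g p)"
  using Ck_on_scaleR[OF _ Ck_on_const[where c="-1"], of U k g] by simp

text \<open>The inverse reappears in its own derivative, and so the induction hypothesis is applied
  to the same function rather than to its partials. The square root is treated in the same
  manner.\<close>

lemma Ck_on_inverse:
  fixes g :: "real \<times> real \<Rightarrow> real"
  assumes "open U" "\<And>p. p \<in> U \<Longrightarrow> g p \<noteq> 0"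
  shows "Ck_on k U g \<Longrightarrow> Ck_on k U (\<lambda>p. inverse (g p))"
proof (induction k)
  case (Suc k)
  have "Ck_on k U (\<lambda>p. inverse (g p))" using Suc.prems[THEN Ck_on_Suc_imp] by (rule Suc.IH)
  moreover have "Ck_on k U (\<partial>\<^sub>u g)" "Ck_on k U (\<partial>\<^sub>v g)" using Suc by simp_all
  ultimately show ?case
    unfolding power2_eq_square
    by (intro Ck_on_SucI[OF assms(1) has_partials_inverse[OF Ck_on_has_partials[OF assms(1) Suc.prems] assms(2), unfolded power2_eq_square]]
         Ck_on_mult Ck_on_minus assms(1))
qed (auto intro: continuous_intros simp: assms)

lemma Ck_on_divide:
  fixes g :: "real \<times> real \<Rightarrow> real"
  shows "open U \<Longrightarrow> (\<And>p. p \<in> U \<Longrightarrow> h p \<noteq> 0) \<Longrightarrow> Ck_on k U g \<Longrightarrow> Ck_on k U h \<Longrightarrow> Ck_on k U (\<lambda>p. g p / h p)"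
  unfolding divide_inverse by (intro Ck_on_mult Ck_on_inverse)

lemma Ck_on_sqrt:
  assumes "open U" "\<And>p. p \<in> U \<Longrightarrow> g p > 0"
  shows "Ck_on k U g \<Longrightarrow> Ck_on k U (\<lambda>p. sqrt (g p))"
proof (induction k)
  case (Suc k)
  have *: "Ck_on k U (\<lambda>p. sqrt (g p))" using Suc.prems[THEN Ck_on_Suc_imp] by (rule Suc.IH)
  have "Ck_on k U (\<partial>\<^sub>u g)" "Ck_on k U (\<partial>\<^sub>v g)" using Suc by simp_all
  then show ?case
    by (intro Ck_on_SucI[OF assms(1) has_partials_sqrt[OF Ck_on_has_partials[OF assms(1) Suc.prems] assms(2)]]
         Ck_on_divide Ck_on_mult Ck_on_const assms(1) *) (use assms(2) in force)+
qed (auto intro: continuous_intros)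

lemma Ck_on_ln:
  fixes g :: "real \<times> real \<Rightarrow> real"
  assumes "open U" "\<And>p. p \<in> U \<Longrightarrow> g p > 0"
  shows "Ck_on k U g \<Longrightarrow> Ck_on k U (\<lambda>p. ln (g p))"
proof (induction k)
  case (Suc k)
  have *: "Ck_on k U g" using Suc.prems[THEN Ck_on_Suc_imp] .
  have "Ck_on k U (\<partial>\<^sub>u g)" "Ck_on k U (\<partial>\<^sub>v g)" using Suc by simp_all
  then show ?case
    by (intro Ck_on_SucI[OF assms(1) has_partials_ln[OF Ck_on_has_partials[OF assms(1) Suc.prems] assms(2)]]
         Ck_on_divide assms(1) *) (use assms(2) in force)+
next
  case 0
  then show ?case using assms(2) by (auto intro!: continuous_intros) force
qed

lemma smooth_on_subset: "smooth_on U g \<Longrightarrow> V \<subseteq> U \<Longrightarrow> smooth_on V g"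
  unfolding smooth_on_def using Ck_on_subset[of V U] by blast

lemma smooth_on_partial_u: "smooth_on U g \<Longrightarrow> smooth_on U (\<partial>\<^sub>u g)"
  and smooth_on_partial_v: "smooth_on U g \<Longrightarrow> smooth_on U (\<partial>\<^sub>v g)"
  by (auto simp: smooth_on_def dest: spec[of _ "Suc _"])

lemma smooth_on_has_partials:
  "open U \<Longrightarrow> smooth_on U g \<Longrightarrow> p \<in> U \<Longrightarrow> has_partials g (\<partial>\<^sub>u g p) (\<partial>\<^sub>v g p) p"
  unfolding smooth_on_def using Ck_on_has_partials by blast

lemma smooth_on_continuous: "smooth_on U g \<Longrightarrow> continuous_on U g"
  by (auto simp: smooth_on_def dest: spec[of _ 0])

lemma smooth_on_const: "smooth_on U (\<lambda>_. c)"
  by (simp add: smooth_on_def Ck_on_const)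

lemma smooth_on_add: "open U \<Longrightarrow> smooth_on U g \<Longrightarrow> smooth_on U h \<Longrightarrow> smooth_on U (\<lambda>p. g p + h p)"
  by (simp add: smooth_on_def Ck_on_add)

lemma smooth_on_minus: "open U \<Longrightarrow> smooth_on U g \<Longrightarrow> smooth_on U (\<lambda>p. - g p)"
  by (simp add: smooth_on_def Ck_on_minus)

lemma smooth_on_diff: "open U \<Longrightarrow> smooth_on U g \<Longrightarrow> smooth_on U h \<Longrightarrow> smooth_on U (\<lambda>p. g p - h p)"
  using smooth_on_add[OF _ _ smooth_on_minus, of U g h] by simp

lemma (in bounded_bilinear) smooth_on:
  "open U \<Longrightarrow> smooth_on U g \<Longrightarrow> smooth_on U h \<Longrightarrow> smooth_on U (\<lambda>p. prod (g p) (h p))"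
  by (simp add: smooth_on_def Ck_on)

lemmas smooth_on_mult = bounded_bilinear.smooth_on[OF bounded_bilinear_mult]
lemmas smooth_on_scaleR = bounded_bilinear.smooth_on[OF bounded_bilinear_scaleR]

lemma smooth_on_power:
  fixes g :: "real \<times> real \<Rightarrow> real"
  shows "open U \<Longrightarrow> smooth_on U g \<Longrightarrow> smooth_on U (\<lambda>p. (g p) ^ n)"
  by (induction n) (auto intro: smooth_on_const smooth_on_mult)

lemma smooth_on_divide:
  fixes g :: "real \<times> real \<Rightarrow> real"
  shows "open U \<Longrightarrow> (\<And>p. p \<in> U \<Longrightarrow> h p \<noteq> 0) \<Longrightarrow> smooth_on U g \<Longrightarrow> smooth_on U h \<Longrightarrow>
    smooth_on U (\<lambda>p. g p / h p)"
  by (simp add: smooth_on_def Ck_on_divide)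

lemma smooth_on_sqrt:
  "open U \<Longrightarrow> (\<And>p. p \<in> U \<Longrightarrow> g p > 0) \<Longrightarrow> smooth_on U g \<Longrightarrow> smooth_on U (\<lambda>p. sqrt (g p))"
  by (simp add: smooth_on_def Ck_on_sqrt)

lemma smooth_on_ln:
  fixes g :: "real \<times> real \<Rightarrow> real"
  shows "open U \<Longrightarrow> (\<And>p. p \<in> U \<Longrightarrow> g p > 0) \<Longrightarrow> smooth_on U g \<Longrightarrow> smooth_on U (\<lambda>p. ln (g p))"
  by (simp add: smooth_on_def Ck_on_ln)

text \<open>Integrating \<open>\<partial>\<^sub>v g\<close> along a vertical segment recovers
  \<open>g\<close>. Differentiation under the integral sign in u, followed by the fundamental
  theorem of calculus in v, produces the two orders of differentiation.\<close>

lemma mixed_partials_commute: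
  fixes g :: "real \<times> real \<Rightarrow> 'a::banach"
  assumes U: "open U" "p \<in> U" and g: "smooth_on U g"
  shows "\<partial>\<^sub>v (\<partial>\<^sub>u g) p = \<partial>\<^sub>u (\<partial>\<^sub>v g) p"
proof -
  obtain u v where p: "p = (u, v)" by (cases p)
  obtain A B where AB: "open A" "open B" "(u, v) \<in> A \<times> B" "A \<times> B \<subseteq> U"
    using open_prod_elim[OF U(1)] U(2) p by metis
  have "u \<in> A" "v \<in> B" using AB(3) by auto
  obtain e where e: "e > 0" "cball v e \<subseteq> B"
    using open_contains_cball_eq[OF AB(2)] \<open>v \<in> B\<close> by blast
  obtain d where d: "d > 0" "cball u d \<subseteq> A"
    using open_contains_cball_eq[OF AB(1)] \<open>u \<in> A\<close> by blast
  \<comment> \<open>The base point lies strictly below \<open>v\<close>, so that \<open>v\<close> is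
    interior to the interval of integration and the last derivative is two-sided. The ball
    \<open>X\<close> is a convex parameter set for differentiation under the integral.\<close>
  define c where "c = v - e"
  define X where "X = ball u d"
  have in_U: "(x, s) \<in> U" if "x \<in> X" "s \<in> {c..v + e}" for x s
  proof -
    have "x \<in> cball u d" using that(1) by (simp add: X_def)
    moreover have "s \<in> cball v e" using that(2) by (simp add: c_def dist_real_def abs_le_iff)
    ultimately show ?thesis using d(2) e(2) AB(4) by blast
  qed
  have cont_slice: "continuous_on {c..s} (\<lambda>s. h (x, s))"
    if h: "smooth_on U h" and x: "x \<in> X" and s: "s \<le> v + e" for h :: "real \<times> real \<Rightarrow> 'a" and x s
  proof (rule continuous_on_compose2[OF smooth_on_continuous[OF h]])
    show "(\<lambda>s. (x, s)) ` {c..s} \<subseteq> U" using in_U[OF x] s by fastforce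
  qed (intro continuous_intros)
  have FTC: "g (x, s) = g (x, c) + integral {c..s} (\<lambda>s. \<partial>\<^sub>v g (x, s))"
    if "x \<in> X" "s \<in> {c..v + e}" for x s
  proof -
    have "((\<lambda>s. \<partial>\<^sub>v g (x, s)) has_integral (g (x, s) - g (x, c))) {c..s}"
    proof (rule fundamental_theorem_of_calculus)
      show "((\<lambda>s. g (x, s)) has_vector_derivative \<partial>\<^sub>v g (x, r)) (at r within {c..s})" if "r \<in> {c..s}" for r
      proof -
        have "(x, r) \<in> U" using that \<open>x \<in> X\<close> \<open>s \<in> {c..v + e}\<close> by (intro in_U) auto
        from has_partials_v[OF smooth_on_has_partials[OF U(1) g this]] show ?thesis
          by (simp add: has_vector_derivative_at_within)
      qed
    qed (use that in simp)
    then show ?thesis by (simp add: integral_unique)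
  qed
  let ?h = "\<partial>\<^sub>u (\<partial>\<^sub>v g)"
  have u_X: "u \<in> X" using d by (simp add: X_def)
  have eq: "\<partial>\<^sub>u g (u, s) = \<partial>\<^sub>u g (u, c) + integral {c..s} (\<lambda>s. ?h (u, s))" if s: "s \<in> {c..v + e}" for s
  proof -
    have "((\<lambda>x. integral (cbox c s) (\<lambda>s. \<partial>\<^sub>v g (x, s))) has_vector_derivative
        integral (cbox c s) (\<lambda>s. ?h (u, s))) (at u within X)"
    proof (rule leibniz_rule_vector_derivative)
      show "((\<lambda>x. \<partial>\<^sub>v g (x, t)) has_vector_derivative ?h (x, t)) (at x within X)"
        if "x \<in> X" "t \<in> cbox c s" for x t
      proof -
        have "(x, t) \<in> U" using that s by (intro in_U) auto
        from has_partials_u[OF smooth_on_has_partials[OF U(1) smooth_on_partial_v[OF g] this]]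
        show ?thesis by (simp add: has_vector_derivative_at_within)
      qed
      show "(\<lambda>s. \<partial>\<^sub>v g (x, s)) integrable_on cbox c s" if "x \<in> X" for x
        using cont_slice[OF smooth_on_partial_v[OF g] that] s by (simp add: integrable_continuous_real)
      have "X \<times> cbox c s \<subseteq> U" using s in_U by fastforce
      from continuous_on_subset[OF smooth_on_continuous[OF smooth_on_partial_u[OF smooth_on_partial_v[OF g]]] this]
      show "continuous_on (X \<times> cbox c s) (\<lambda>(x, t). ?h (x, t))" by simp
    qed (use u_X in \<open>auto simp: X_def\<close>)
    then have I: "((\<lambda>x. integral {c..s} (\<lambda>s. \<partial>\<^sub>v g (x, s))) has_vector_derivative
        integral {c..s} (\<lambda>s. ?h (u, s))) (at u)"
      using at_within_open[OF u_X] by (simp add: X_def)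
    have g': "((\<lambda>x. g (x, c)) has_vector_derivative \<partial>\<^sub>u g (u, c)) (at u)"
      using has_partials_u[OF smooth_on_has_partials[OF U(1) g in_U[OF u_X, of c]]] e
      by (simp add: c_def)
    have "((\<lambda>x. g (x, s)) has_vector_derivative
        \<partial>\<^sub>u g (u, c) + integral {c..s} (\<lambda>s. ?h (u, s))) (at u)"
    proof (rule has_vector_derivative_transform_within_open[OF has_vector_derivative_add[OF g' I] _ u_X])
      show "g (x, c) + integral {c..s} (\<lambda>s. \<partial>\<^sub>v g (x, s)) = g (x, s)" if "x \<in> X" for x
        by (rule FTC[OF that s, symmetric])
    qed (simp add: X_def)
    then show ?thesis by (simp add: partial_u_def vector_derivative_at)
  qed
  have "continuous_on {c..v + e} (\<lambda>s. ?h (u, s))"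
    by (rule cont_slice[OF smooth_on_partial_u[OF smooth_on_partial_v[OF g]] u_X]) simp
  moreover have v: "v \<in> {c<..<v + e}" using e by (simp add: c_def)
  ultimately have "((\<lambda>s. integral {c..s} (\<lambda>s. ?h (u, s))) has_vector_derivative ?h (u, v)) (at v within {c..v + e})"
    by (intro integral_has_vector_derivative) auto
  then have "((\<lambda>s. integral {c..s} (\<lambda>s. ?h (u, s))) has_vector_derivative ?h (u, v)) (at v)"
    using v by (subst (asm) at_within_interior) (auto simp: interior_atLeastAtMost_real)
  from has_vector_derivative_add[OF has_vector_derivative_const[of "\<partial>\<^sub>u g (u, c)"] this]
  have "((\<lambda>s. \<partial>\<^sub>u g (u, c) + integral {c..s} (\<lambda>s. ?h (u, s))) has_vector_derivative ?h (u, v)) (at v)"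
    by simp
  then have "((\<lambda>s. \<partial>\<^sub>u g (u, s)) has_vector_derivative ?h (u, v)) (at v)"
    by (rule has_vector_derivative_transform_within_open[OF _ _ v])
       (use eq[symmetric] in \<open>simp_all add: less_imp_le\<close>)
  then show ?thesis by (simp add: p partial_v_def vector_derivative_at)
qed

section \<open>Completely integrable linear systems\<close>

text \<open>The integral from \<open>c\<close> to \<open>t\<close>, written over a fixed interval so that \<open>t < c\<close> is allowed and
  joint continuity in parameters and \<open>t\<close> is immediate.\<close>

definition primitive :: "real \<Rightarrow> (real \<Rightarrow> 'a::banach) \<Rightarrow> real \<Rightarrow> 'a" where
  "primitive c g t = (t - c) *\<^sub>R integral {0..1} (\<lambda>r. g (c + r * (t - c)))"

lemma primitive_same [simp]: "primitive c g c = 0"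
  by (simp add: primitive_def)

lemma segment_point_mem:
  fixes c t a b r :: real
  assumes "c \<in> {a..b}" "t \<in> {a..b}" "r \<in> {0..1}"
  shows "c + r * (t - c) \<in> {a..b}"
proof -
  have "(1 - r) *\<^sub>R c + r *\<^sub>R t \<in> {a..b}"
    using assms by (intro convexD[OF convex_real_interval(5)]) auto
  then show ?thesis by (simp add: algebra_simps)
qed

lemma continuous_on_along_segment:
  fixes g :: "real \<Rightarrow> 'a::topological_space"
  assumes "continuous_on {a..b} g" "c \<in> {a..b}" "t \<in> {a..b}"
  shows "continuous_on {0..1} (\<lambda>r. g (c + r * (t - c)))"
  by (rule continuous_on_compose2[OF assms(1)])
     (use segment_point_mem[OF assms(2,3)] in \<open>auto intro!: continuous_intros\<close>)

text \<open>The fundamental theorem is applied to \<open>F\<close> composed with the segment from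
  \<open>c\<close> to \<open>t\<close>; the chain rule supplies the factor \<open>t - c\<close>,
  with its sign, and so both orders of the end points are covered at once.\<close>

lemma primitive_eq_diff:
  fixes F :: "real \<Rightarrow> 'a::banach"
  assumes c: "c \<in> {a..b}" and t: "t \<in> {a..b}"
    and F: "\<And>x. x \<in> {a..b} \<Longrightarrow> (F has_vector_derivative g x) (at x within {a..b})"
  shows "primitive c g t = F t - F c"
proof -
  define l where "l r = c + r * (t - c)" for r :: real
  have l: "l r \<in> {a..b}" if "r \<in> {0..1}" for r
    unfolding l_def by (rule segment_point_mem[OF c t that])
  have "((\<lambda>r. (t - c) *\<^sub>R g (l r)) has_integral ((F \<circ> l) 1 - (F \<circ> l) 0)) {0..1}"
  proof (rule fundamental_theorem_of_calculus)
    fix r :: real assume r: "r \<in> {0..1}"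
    have "l ` {0..1} \<subseteq> {a..b}" using l by blast
    have 1: "(l has_vector_derivative (t - c)) (at r within {0..1})"
      unfolding l_def by (auto intro!: derivative_eq_intros simp: has_real_derivative_iff_has_vector_derivative[symmetric])
    have 2: "(F has_vector_derivative g (l r)) (at (l r) within l ` {0..1})"
      by (rule has_vector_derivative_within_subset[OF F[OF l[OF r]] \<open>l ` {0..1} \<subseteq> {a..b}\<close>])
    show "((F \<circ> l) has_vector_derivative (t - c) *\<^sub>R g (l r)) (at r within {0..1})"
      by (rule vector_diff_chain_within[OF 1 2])
  qed simp
  from integral_unique[OF this] show ?thesis by (simp add: primitive_def l_def)
qed

text \<open>On the interval, \<open>primitive c g\<close> differs from the integral with base point
  \<open>a\<close> by a constant, so the usual derivative of an indefinite integral applies.\<close>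

lemma has_vector_derivative_primitive:
  fixes g :: "real \<Rightarrow> 'a::banach"
  assumes g: "continuous_on {a..b} g" and c: "c \<in> {a..b}" and x: "x \<in> {a..b}"
  shows "(primitive c g has_vector_derivative g x) (at x within {a..b})"
proof -
  let ?I = "\<lambda>t. integral {a..t} g"
  have I: "(?I has_vector_derivative g x) (at x within {a..b})" if "x \<in> {a..b}" for x
    by (rule integral_has_vector_derivative[OF g that])
  have "((\<lambda>t. ?I t - ?I c) has_vector_derivative g x - 0) (at x within {a..b})"
    by (rule has_vector_derivative_diff[OF I[OF x] has_vector_derivative_const])
  then have "((\<lambda>t. ?I t - ?I c) has_vector_derivative g x) (at x within {a..b})" by simp
  then show ?thesis
    by (rule has_vector_derivative_transform[OF x, rotated])
       (rule primitive_eq_diff[OF c _ I])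
qed

lemma continuous_on_primitive:
  fixes g :: "'p::topological_space \<Rightarrow> real \<Rightarrow> 'a::banach"
  assumes g: "continuous_on (K \<times> {a..b}) (\<lambda>(p, s). g p s)" and c: "c \<in> {a..b}"
  shows "continuous_on (K \<times> {a..b}) (\<lambda>(p, t). primitive c (g p) t)"
proof -
  have "continuous_on ((K \<times> {a..b}) \<times> {0..1::real}) (\<lambda>q. g (fst (fst q)) (c + snd q * (snd (fst q) - c)))"
  proof (rule continuous_on_compose2[OF g, of _ "\<lambda>q. (fst (fst q), c + snd q * (snd (fst q) - c))", simplified])
    show "continuous_on ((K \<times> {a..b}) \<times> {0..1::real}) (\<lambda>q. (fst (fst q), c + snd q * (snd (fst q) - c)))"
      by (intro continuous_intros)
    show "(\<lambda>q. (fst (fst q), c + snd q * (snd (fst q) - c))) ` ((K \<times> {a..b}) \<times> {0..1::real}) \<subseteq> K \<times> {a..b}"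
    proof (rule image_subsetI)
      fix q :: "('p \<times> real) \<times> real" assume "q \<in> (K \<times> {a..b}) \<times> {0..1}"
      then have "fst (fst q) \<in> K" "snd (fst q) \<in> {a..b}" "snd q \<in> {0..1}" by auto
      then show "(fst (fst q), c + snd q * (snd (fst q) - c)) \<in> K \<times> {a..b}"
        using segment_point_mem[OF c] by blast
    qed
  qed
  then have "continuous_on ((K \<times> {a..b}) \<times> cbox 0 1)
      (\<lambda>(pt, r). g (fst pt) (c + r * (snd pt - c)))"
    by (simp add: split_beta')
  from integral_continuous_on_param[OF this]
  have "continuous_on (K \<times> {a..b}) (\<lambda>pt. integral {0..1} (\<lambda>r. g (fst pt) (c + r * (snd pt - c))))"
    by simp
  then have "continuous_on (K \<times> {a..b})
     (\<lambda>pt. (snd pt - c) *\<^sub>R integral {0..1} (\<lambda>r. g (fst pt) (c + r * (snd pt - c))))"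
    by (intro continuous_intros)
  then show ?thesis by (simp add: primitive_def split_beta')
qed

lemma norm_primitive_le:
  fixes g :: "real \<Rightarrow> 'a::banach"
  assumes g: "continuous_on {a..b} g" and c: "c \<in> {a..b}" and t: "t \<in> {a..b}"
    and M: "\<And>s. s \<in> {a..b} \<Longrightarrow> norm (g s) \<le> M"
  shows "norm (primitive c g t) \<le> \<bar>t - c\<bar> * M"
proof -
  have "norm (integral {0..1} (\<lambda>r. g (c + r * (t - c)))) \<le> M * (1 - 0)"
    by (rule integral_bound[OF _ continuous_on_along_segment[OF g c t]])
       (use M segment_point_mem[OF c t] in auto)
  then show ?thesis by (simp add: primitive_def mult_left_mono)
qed

lemma primitive_add:
  fixes g h :: "real \<Rightarrow> 'a::banach"
  assumes "continuous_on {a..b} g" "continuous_on {a..b} h" "c \<in> {a..b}" "t \<in> {a..b}"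
  shows "primitive c (\<lambda>s. g s + h s) t = primitive c g t + primitive c h t"
proof -
  note I = integrable_continuous_real[OF continuous_on_along_segment[OF assms(1,3,4)]]
    integrable_continuous_real[OF continuous_on_along_segment[OF assms(2,3,4)]]
  show ?thesis by (simp add: primitive_def integral_add[OF I] scaleR_add_right)
qed

lemma primitive_diff:
  fixes g h :: "real \<Rightarrow> 'a::banach"
  assumes "continuous_on {a..b} g" "continuous_on {a..b} h" "c \<in> {a..b}" "t \<in> {a..b}"
  shows "primitive c (\<lambda>s. g s - h s) t = primitive c g t - primitive c h t"
proof -
  note I = integrable_continuous_real[OF continuous_on_along_segment[OF assms(1,3,4)]]
    integrable_continuous_real[OF continuous_on_along_segment[OF assms(2,3,4)]]
  show ?thesis by (simp add: primitive_def integral_diff[OF I] scaleR_diff_right)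
qed

lemma primitive_cong:
  assumes "\<And>s. s \<in> {a..b} \<Longrightarrow> g s = h s" "c \<in> {a..b}" "t \<in> {a..b}"
  shows "primitive c g t = primitive c h t"
proof -
  have "integral {0..1} (\<lambda>r. g (c + r * (t - c))) = integral {0..1} (\<lambda>r. h (c + r * (t - c)))"
    by (rule integral_cong) (rule assms(1)[OF segment_point_mem[OF assms(2,3)]])
  then show ?thesis by (simp add: primitive_def)
qed

text \<open>After both segments are rescaled to the unit interval, this is Fubini on the unit
  square, and the factors \<open>u - u0\<close> and \<open>v - v0\<close> commute.\<close>

lemma primitive_swap:
  fixes h :: "real \<Rightarrow> real \<Rightarrow> 'a::banach"
  assumes h: "continuous_on ({a..b} \<times> {c..d}) (\<lambda>(t, s). h t s)"
    and m: "u0 \<in> {a..b}" "u \<in> {a..b}" "v0 \<in> {c..d}" "v \<in> {c..d}"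
  shows "primitive u0 (\<lambda>t. primitive v0 (h t) v) u = primitive v0 (\<lambda>s. primitive u0 (\<lambda>t. h t s) u) v"
proof -
  have "continuous_on (cbox (0, 0) (1, 1)) (\<lambda>q. h (u0 + fst q * (u - u0)) (v0 + snd q * (v - v0)))"
  proof (rule continuous_on_compose2[OF h, of _ "\<lambda>q. (u0 + fst q * (u - u0), v0 + snd q * (v - v0))", simplified])
    show "continuous_on (cbox (0, 0) (1, 1)) (\<lambda>q. (u0 + fst q * (u - u0), v0 + snd q * (v - v0)))"
      by (intro continuous_intros)
    show "(\<lambda>q. (u0 + fst q * (u - u0), v0 + snd q * (v - v0))) ` cbox (0, 0) (1, 1) \<subseteq> {a..b} \<times> {c..d}"
    proof (rule image_subsetI)
      fix q :: "real \<times> real" assume "q \<in> cbox (0, 0) (1, 1)"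
      then have "fst q \<in> {0..1}" "snd q \<in> {0..1}" by (cases q; simp add: cbox_Pair_iff)+
      then show "(u0 + fst q * (u - u0), v0 + snd q * (v - v0)) \<in> {a..b} \<times> {c..d}"
        using segment_point_mem[OF m(1,2)] segment_point_mem[OF m(3,4)] by blast
    qed
  qed
  then have "continuous_on (cbox (0, 0) (1, 1)) (\<lambda>(x, y). h (u0 + x * (u - u0)) (v0 + y * (v - v0)))"
    by (simp add: split_beta')
  from integral_swap_continuous[OF this] show ?thesis
    by (simp add: primitive_def mult.commute)
qed

text \<open>The system is X_u = A X, X_v = B X, with an arbitrary bounded bilinear action
  \<open>pr\<close> in place of matrices. The hypothesis \<open>compat\<close> is what equality of
  the mixed second derivatives of a solution would require, once it is demanded for every vector
  \<open>x\<close>.\<close>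

theorem integrable_linear_system_exists:
  fixes pr :: "'c::real_normed_vector \<Rightarrow> 'v::euclidean_space \<Rightarrow> 'v"
    and A B Av Bu :: "real \<times> real \<Rightarrow> 'c"
  assumes bil: "bounded_bilinear pr"
    and S: "open S" "(u0, v0) \<in> S"
    and cont: "continuous_on S A" "continuous_on S B" "continuous_on S Av" "continuous_on S Bu"
    and Av: "\<And>u v. (u, v) \<in> S \<Longrightarrow> ((\<lambda>s. A (u, s)) has_vector_derivative Av (u, v)) (at v)"
    and Bu: "\<And>u v. (u, v) \<in> S \<Longrightarrow> ((\<lambda>t. B (t, v)) has_vector_derivative Bu (u, v)) (at u)"
    and compat: "\<And>p x. p \<in> S \<Longrightarrow>
      pr (Av p) x + pr (A p) (pr (B p) x) = pr (Bu p) x + pr (B p) (pr (A p) x)"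
  obtains U X where "open_rectangle U" "(u0, v0) \<in> U" "U \<subseteq> S" "X (u0, v0) = x0"
    "\<And>p. p \<in> U \<Longrightarrow> has_partials X (pr (A p) (X p)) (pr (B p) (X p)) p"
proof -
  interpret bounded_bilinear pr by (rule bil)
  obtain K where K: "K > 0" "\<And>a x. norm (pr a x) \<le> norm a * norm x * K"
    using pos_bounded by blast
  obtain d1 where d1: "d1 > 0" "cball (u0, v0) d1 \<subseteq> S"
    using open_contains_cball_eq[OF S(1)] S(2) by blast
  have "compact ((\<lambda>p. (A p, B p, Bu p)) ` cball (u0, v0) d1)"
    by (intro compact_continuous_image continuous_on_Pair continuous_on_subset[OF _ d1(2)] cont compact_cball)
  then obtain M0 where M0: "\<And>p. p \<in> cball (u0, v0) d1 \<Longrightarrow> norm (A p, B p, Bu p) \<le> M0"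
    using compact_imp_bounded by (metis (no_types, lifting) bounded_iff imageI)
  define M where "M = max M0 1"
  have M: "norm (A p) \<le> M" "norm (B p) \<le> M" "norm (Bu p) \<le> M" if "p \<in> cball (u0, v0) d1" for p
  proof -
    have "norm (A p) \<le> norm (A p, B p, Bu p)" "norm (B p) \<le> norm (B p, Bu p)"
       "norm (Bu p) \<le> norm (B p, Bu p)" "norm (B p, Bu p) \<le> norm (A p, B p, Bu p)"
      by (rule norm_fst_le norm_snd_le)+
    then show "norm (A p) \<le> M" "norm (B p) \<le> M" "norm (Bu p) \<le> M"
      using M0[OF that] by (simp_all add: M_def)
  qed
  have Mpos: "M > 0" by (simp add: M_def)
  \<comment> \<open>The bound d1 / 2 keeps the square inside the ball on which \<open>M\<close>
    bounds the coefficients. With d K M at most 1/4, each of the two integrals contracts by 1/4. The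
    bound 1 serves the final estimate, where an inner integral over length at most \<open>d\<close>
    is replaced by the bound of its integrand.\<close>
  define d where "d = min (min (d1 / 2) 1) (1 / (4 * (K * M)))"
  have d: "d > 0" "d \<le> 1" "d \<le> d1 / 2"
    using d1 K(1) Mpos by (simp_all add: d_def)
  have dKM: "d * (K * M) \<le> 1 / 4"
  proof -
    have "d * (K * M) \<le> 1 / (4 * (K * M)) * (K * M)"
      using K(1) Mpos by (intro mult_right_mono) (simp_all add: d_def)
    then show ?thesis using K(1) Mpos by simp
  qed
  define I where "I = {u0 - d..u0 + d}"
  define J where "J = {v0 - d..v0 + d}"
  have u0: "u0 \<in> I" and v0: "v0 \<in> J" using d by (simp_all add: I_def J_def)
  have dI: "\<bar>u - u0\<bar> \<le> d" if "u \<in> I" for u using that by (auto simp: I_def)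
  have dJ: "\<bar>v - v0\<bar> \<le> d" if "v \<in> J" for v using that by (auto simp: J_def)
  have Q1: "I \<times> J \<subseteq> cball (u0, v0) d1"
  proof (rule subsetI)
    fix p assume "p \<in> I \<times> J"
    then have "\<bar>fst p - u0\<bar> \<le> d" "\<bar>snd p - v0\<bar> \<le> d" using dI dJ by auto
    then have "dist (u0, v0) p \<le> \<bar>fst p - u0\<bar> + \<bar>snd p - v0\<bar>"
      by (cases p) (simp add: dist_Pair_Pair dist_real_def abs_minus_commute sqrt_sum_squares_le_sum_abs)
    with \<open>\<bar>fst p - u0\<bar> \<le> d\<close> \<open>\<bar>snd p - v0\<bar> \<le> d\<close> d(3)
    show "p \<in> cball (u0, v0) d1" by simp
  qed
  then have QS: "I \<times> J \<subseteq> S" using d1(2) by blast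
  have KM: "norm (pr a x) \<le> (K * M) * N" if "norm a \<le> M" "norm x \<le> N" for a x N
  proof -
    have "norm (pr a x) \<le> norm a * norm x * K" by (rule K(2))
    also have "\<dots> \<le> M * N * K"
      using that K(1) Mpos by (intro mult_mono mult_nonneg_nonneg) (auto intro: order_trans[OF norm_ge_zero])
    finally show ?thesis by (simp add: mult.commute mult.left_commute)
  qed
  have cQ: "continuous_on (I \<times> J) A" "continuous_on (I \<times> J) B" "continuous_on (I \<times> J) Av" "continuous_on (I \<times> J) Bu"
    using cont by (auto intro: continuous_on_subset[OF _ QS])
  note contpr = bounded_bilinear.continuous_on[OF bil]
  have slice_u: "continuous_on I (\<lambda>t. h (t, v))" if "continuous_on (I \<times> J) h" "v \<in> J"
    for h :: "real \<times> real \<Rightarrow> 'v" and v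
    by (rule continuous_on_compose2[OF that(1)]) (use that(2) in \<open>auto intro!: continuous_intros\<close>)
  have slice_v: "continuous_on J (\<lambda>s. h (u, s))" if "continuous_on (I \<times> J) h" "u \<in> I"
    for h :: "real \<times> real \<Rightarrow> 'v" and u
    by (rule continuous_on_compose2[OF that(1)]) (use that(2) in \<open>auto intro!: continuous_intros\<close>)
  have prim_u: "continuous_on (I \<times> J) (\<lambda>p. primitive u0 (\<lambda>t. h (t, snd p)) (fst p))"
    if h: "continuous_on (I \<times> J) h" for h :: "real \<times> real \<Rightarrow> 'v"
  proof -
    have "continuous_on (J \<times> I) (\<lambda>(v, t). h (t, v))"
      unfolding split_beta'
      by (rule continuous_on_compose2[OF h]) (auto intro!: continuous_intros)
    then have "continuous_on (J \<times> I) (\<lambda>(v, u). primitive u0 (\<lambda>t. h (t, v)) u)"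
      using u0 unfolding I_def by (rule continuous_on_primitive)
    then have c: "continuous_on (J \<times> I) (\<lambda>q. primitive u0 (\<lambda>t. h (t, fst q)) (snd q))"
      by (simp add: split_beta')
    have "continuous_on (I \<times> J) (\<lambda>p. (snd p, fst p))" by (intro continuous_intros)
    from continuous_on_compose2[OF c this] show ?thesis by fastforce
  qed
  have prim_v: "continuous_on (I \<times> J) (\<lambda>p. primitive v0 (\<lambda>s. h (fst p, s)) (snd p))"
    if h: "continuous_on (I \<times> J) h" for h :: "real \<times> real \<Rightarrow> 'v"
  proof -
    have "continuous_on (I \<times> J) (\<lambda>(u, s). h (u, s))" using h by simp
    then have "continuous_on (I \<times> J) (\<lambda>(u, v). primitive v0 (\<lambda>s. h (u, s)) v)"
      using v0 unfolding J_def by (rule continuous_on_primitive)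
    then show ?thesis by (simp add: split_beta')
  qed
  have bound_u: "norm (primitive u0 g u) \<le> d * N"
    if "continuous_on I g" "u \<in> I" "\<And>t. t \<in> I \<Longrightarrow> norm (g t) \<le> N" for g :: "real \<Rightarrow> 'v" and u N
  proof -
    have "0 \<le> N" using that(3)[OF u0] norm_ge_zero order_trans by blast
    then show ?thesis
      using norm_primitive_le[OF that(1)[unfolded I_def] u0[unfolded I_def] that(2)[unfolded I_def], of N]
        that(3) mult_right_mono[OF dI[OF that(2)], of N] unfolding I_def by fastforce
  qed
  have bound_v: "norm (primitive v0 g v) \<le> d * N"
    if "continuous_on J g" "v \<in> J" "\<And>t. t \<in> J \<Longrightarrow> norm (g t) \<le> N" for g :: "real \<Rightarrow> 'v" and v N
  proof -
    have "0 \<le> N" using that(3)[OF v0] norm_ge_zero order_trans by blast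
    then show ?thesis
      using norm_primitive_le[OF that(1)[unfolded J_def] v0[unfolded J_def] that(2)[unfolded J_def], of N]
        that(3) mult_right_mono[OF dJ[OF that(2)], of N] unfolding J_def by fastforce
  qed

  define F where "F X p = x0 + primitive u0 (\<lambda>t. pr (A (t, v0)) (X (t, v0))) (fst p)
      + primitive v0 (\<lambda>s. pr (B (fst p, s)) (X (fst p, s))) (snd p)"
    for X :: "real \<times> real \<Rightarrow> 'v" and p
  have contAX: "continuous_on (I \<times> J) (\<lambda>q. pr (A q) (X q))"
    and contBX: "continuous_on (I \<times> J) (\<lambda>q. pr (B q) (X q))"
    if "continuous_on (I \<times> J) X" for X
    by (rule contpr[OF cQ(1) that], rule contpr[OF cQ(2) that])
  have contF: "continuous_on (I \<times> J) (F X)" if X: "continuous_on (I \<times> J) X" for X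
  proof -
    have "continuous_on (I \<times> J) (\<lambda>p. primitive u0 (\<lambda>t. pr (A (t, v0)) (X (t, v0))) (fst p))"
      by (rule continuous_on_compose2[OF prim_u[OF contAX[OF X]], of _ "\<lambda>p. (fst p, v0)", simplified fst_conv snd_conv])
         (use v0 in \<open>auto intro!: continuous_intros\<close>)
    from this prim_v[OF contBX[OF X]] show ?thesis
      unfolding F_def by (intro continuous_intros)
  qed
  let ?Q = "cbox (u0 - d, v0 - d) (u0 + d, v0 + d)"
  have Q: "?Q = I \<times> J" by (simp add: cbox_Pair_eq I_def J_def)
  \<comment> \<open>Bounded continuous functions on the whole plane form a complete metric type,
    while the integral equation lives on a square. Composition with the clamping map extends
    continuous functions from the square, so the contraction can act on that type.\<close>
  let ?c = "clamp (u0 - d, v0 - d) (u0 + d, v0 + d)"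
  have clamp: "?c p \<in> I \<times> J" for p
    unfolding Q[symmetric] using d(1) by (intro clamp_in_interval) (auto simp: Basis_prod_def)
  have "\<exists>g. \<forall>p. apply_bcontfun g p = F (apply_bcontfun X) (?c p)" for X
    using continuous_on_cbox_bcontfunE[of "(u0 - d, v0 - d)" "(u0 + d, v0 + d)" "F (apply_bcontfun X)"]
      contF[of "apply_bcontfun X"] unfolding Q by (metis continuous_on_apply_bcontfun)
  then obtain T where T: "\<And>X p. apply_bcontfun (T X) p = F (apply_bcontfun X) (?c p)" by metis
  have "dist (T X) (T Y) \<le> 1 / 2 * dist X Y" for X Y
  proof (rule dist_bound)
    fix p
    let ?X = "apply_bcontfun X" and ?Y = "apply_bcontfun Y"
    obtain u v where uv: "?c p = (u, v)" "u \<in> I" "v \<in> J" using clamp[of p] by blast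
    have le: "norm (?X q - ?Y q) \<le> dist X Y" for q
      using dist_bounded[of X q Y] by (simp add: dist_norm)
    have X: "continuous_on (I \<times> J) ?X" and Y: "continuous_on (I \<times> J) ?Y" by simp_all
    have c: "continuous_on I (\<lambda>t. pr (A (t, v0)) (?X (t, v0)))" "continuous_on I (\<lambda>t. pr (A (t, v0)) (?Y (t, v0)))"
      "continuous_on J (\<lambda>s. pr (B (u, s)) (?X (u, s)))" "continuous_on J (\<lambda>s. pr (B (u, s)) (?Y (u, s)))"
      using slice_u[OF contAX v0] slice_v[OF contBX uv(2)] X Y by blast+
    have eq: "F ?X (u, v) - F ?Y (u, v) = primitive u0 (\<lambda>t. pr (A (t, v0)) (?X (t, v0) - ?Y (t, v0))) u
        + primitive v0 (\<lambda>s. pr (B (u, s)) (?X (u, s) - ?Y (u, s))) v"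
      using primitive_diff[OF c(1,2)[unfolded I_def] u0[unfolded I_def] uv(2)[unfolded I_def]]
        primitive_diff[OF c(3,4)[unfolded J_def] v0[unfolded J_def] uv(3)[unfolded J_def]]
      by (simp add: F_def diff_right)
    have "norm (primitive u0 (\<lambda>t. pr (A (t, v0)) (?X (t, v0) - ?Y (t, v0))) u) \<le> d * (K * M * dist X Y)"
    proof (rule bound_u[OF _ uv(2)])
      show "continuous_on I (\<lambda>t. pr (A (t, v0)) (?X (t, v0) - ?Y (t, v0)))"
        using continuous_on_diff[OF c(1,2)] by (simp add: diff_right)
      show "norm (pr (A (t, v0)) (?X (t, v0) - ?Y (t, v0))) \<le> K * M * dist X Y" if "t \<in> I" for t
        using that v0 Q1 by (intro KM M le) auto
    qed
    moreover have "norm (primitive v0 (\<lambda>s. pr (B (u, s)) (?X (u, s) - ?Y (u, s))) v) \<le> d * (K * M * dist X Y)"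
    proof (rule bound_v[OF _ uv(3)])
      show "continuous_on J (\<lambda>s. pr (B (u, s)) (?X (u, s) - ?Y (u, s)))"
        using continuous_on_diff[OF c(3,4)] by (simp add: diff_right)
      show "norm (pr (B (u, s)) (?X (u, s) - ?Y (u, s))) \<le> K * M * dist X Y" if "s \<in> J" for s
        using that uv(2) Q1 by (intro KM M le) auto
    qed
    ultimately have "norm (F ?X (u, v) - F ?Y (u, v)) \<le> 2 * (d * (K * M)) * dist X Y"
      unfolding eq by (intro order_trans[OF norm_triangle_ineq]) (simp add: algebra_simps)
    also have "\<dots> \<le> 1 / 2 * dist X Y"
      using dKM by (intro mult_right_mono) auto
    finally show "dist (apply_bcontfun (T X) p) (apply_bcontfun (T Y) p) \<le> 1 / 2 * dist X Y"
      by (simp add: T uv(1) dist_norm)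
  qed
  then have "\<exists>!X. T X = X"
    by (intro banach_fix_type[of "1 / 2"]) auto
  then obtain X0 where X0: "T X0 = X0" by blast
  define X where "X = apply_bcontfun X0"
  have X: "continuous_on (I \<times> J) X" by (simp add: X_def)
  have fix_X: "X (u, v) = x0 + primitive u0 (\<lambda>t. pr (A (t, v0)) (X (t, v0))) u
      + primitive v0 (\<lambda>s. pr (B (u, s)) (X (u, s))) v" if "u \<in> I" "v \<in> J" for u v
  proof -
    have "(u, v) \<in> ?Q" using that by (simp add: Q)
    then have "?c (u, v) = (u, v)" by (rule clamp_cancel_cbox)
    then show ?thesis using T[of X0 "(u, v)"] by (simp add: X0 X_def F_def)
  qed
  \<comment> \<open>The equation in v follows from the integral equation alone. The equation in u is
    so far visible only on the line v = v0, and the rest of the proof is spent on extending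
    it.\<close>
  have X_v: "((\<lambda>s. X (u, s)) has_vector_derivative pr (B (u, v)) (X (u, v))) (at v within J)"
    if "u \<in> I" "v \<in> J" for u v
  proof -
    have "((\<lambda>s. x0 + primitive u0 (\<lambda>t. pr (A (t, v0)) (X (t, v0))) u
      + primitive v0 (\<lambda>s. pr (B (u, s)) (X (u, s))) s) has_vector_derivative 0 + pr (B (u, v)) (X (u, v)))
      (at v within J)"
      using has_vector_derivative_primitive[OF slice_v[OF contBX[OF X] that(1), unfolded J_def] v0[unfolded J_def] that(2)[unfolded J_def]]
      by (intro has_vector_derivative_add has_vector_derivative_const) (simp add: J_def)
    then have "((\<lambda>s. x0 + primitive u0 (\<lambda>t. pr (A (t, v0)) (X (t, v0))) u
      + primitive v0 (\<lambda>s. pr (B (u, s)) (X (u, s))) s) has_vector_derivative pr (B (u, v)) (X (u, v)))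
      (at v within J)" by simp
    then show ?thesis
      by (rule has_vector_derivative_transform[OF that(2), rotated]) (rule fix_X[OF that(1)])
  qed
  \<comment> \<open>The opposite order of integration, with the already constructed \<open>X\<close>
    in the integrands. By construction \<open>Y\<close> has u-derivative A X everywhere, so it
    suffices to show that \<open>Y\<close> equals \<open>X\<close>.\<close>
  define Y where "Y p = x0 + primitive v0 (\<lambda>s. pr (B (u0, s)) (X (u0, s))) (snd p)
      + primitive u0 (\<lambda>t. pr (A (t, snd p)) (X (t, snd p))) (fst p)" for p
  have Y: "continuous_on (I \<times> J) Y"
  proof -
    have "continuous_on (I \<times> J) (\<lambda>p. primitive v0 (\<lambda>s. pr (B (u0, s)) (X (u0, s))) (snd p))"
      by (rule continuous_on_compose2[OF prim_v[OF contBX[OF X]], of _ "\<lambda>p. (u0, snd p)", simplified fst_conv snd_conv])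
         (use u0 in \<open>auto intro!: continuous_intros\<close>)
    from this prim_u[OF contAX[OF X]] show ?thesis
      unfolding Y_def by (intro continuous_intros)
  qed
  have Y_u: "((\<lambda>t. Y (t, v)) has_vector_derivative pr (A (u, v)) (X (u, v))) (at u within I)"
    if "u \<in> I" "v \<in> J" for u v
  proof -
    have "((\<lambda>t. x0 + primitive v0 (\<lambda>s. pr (B (u0, s)) (X (u0, s))) v
      + primitive u0 (\<lambda>t. pr (A (t, v)) (X (t, v))) t) has_vector_derivative 0 + pr (A (u, v)) (X (u, v)))
      (at u within I)"
      using has_vector_derivative_primitive[OF slice_u[OF contAX[OF X] that(2), unfolded I_def] u0[unfolded I_def] that(1)[unfolded I_def]]
      by (intro has_vector_derivative_add has_vector_derivative_const) (simp add: I_def)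
    then show ?thesis by (simp add: Y_def)
  qed
  \<comment> \<open>This is the v-derivative of A X, rewritten by \<open>compat\<close> in terms of
    \<open>Bu\<close>.\<close>
  define H where "H p = pr (Bu p) (X p) + pr (B p) (pr (A p) (X p))" for p
  have contH: "continuous_on (I \<times> J) H"
    unfolding H_def by (intro continuous_on_add contpr cQ X)
  have AX: "pr (A (t, v)) (X (t, v)) = pr (A (t, v0)) (X (t, v0)) + primitive v0 (\<lambda>s. H (t, s)) v"
    if "t \<in> I" "v \<in> J" for t v
  proof -
    have "primitive v0 (\<lambda>s. H (t, s)) v = pr (A (t, v)) (X (t, v)) - pr (A (t, v0)) (X (t, v0))"
    proof (rule primitive_eq_diff[of _ "v0 - d" "v0 + d", folded J_def, OF v0 that(2)])
      fix s assume s: "s \<in> J"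
      then have ts: "(t, s) \<in> S" using QS that(1) by blast
      have "((\<lambda>s. pr (A (t, s)) (X (t, s))) has_vector_derivative
          pr (A (t, s)) (pr (B (t, s)) (X (t, s))) + pr (Av (t, s)) (X (t, s))) (at s within J)"
        by (rule has_vector_derivative[OF has_vector_derivative_at_within[OF Av[OF ts]] X_v[OF that(1) s]])
      then show "((\<lambda>s. pr (A (t, s)) (X (t, s))) has_vector_derivative H (t, s)) (at s within J)"
        using compat[OF ts] by (simp add: H_def add.commute)
    qed
    then show ?thesis by simp
  qed
  \<comment> \<open>The u-derivative of B Y, where Y_u = A X has been inserted. It shares the term B
    (A X) with \<open>H\<close>, and therefore \<open>G\<close> minus \<open>H\<close> is
    \<open>Bu\<close> applied to Y - X.\<close>
  define G where "G p = pr (Bu p) (Y p) + pr (B p) (pr (A p) (X p))" for p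
  have contG: "continuous_on (I \<times> J) G"
    unfolding G_def by (intro continuous_on_add contpr cQ X Y)
  have BY: "pr (B (u, s)) (Y (u, s)) = pr (B (u0, s)) (Y (u0, s)) + primitive u0 (\<lambda>t. G (t, s)) u"
    if "u \<in> I" "s \<in> J" for u s
  proof -
    have "primitive u0 (\<lambda>t. G (t, s)) u = pr (B (u, s)) (Y (u, s)) - pr (B (u0, s)) (Y (u0, s))"
    proof (rule primitive_eq_diff[of _ "u0 - d" "u0 + d", folded I_def, OF u0 that(1)])
      fix t assume t: "t \<in> I"
      then have ts: "(t, s) \<in> S" using QS that(2) by blast
      have "((\<lambda>t. pr (B (t, s)) (Y (t, s))) has_vector_derivative
          pr (B (t, s)) (pr (A (t, s)) (X (t, s))) + pr (Bu (t, s)) (Y (t, s))) (at t within I)"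
        by (rule has_vector_derivative[OF has_vector_derivative_at_within[OF Bu[OF ts]] Y_u[OF t that(2)]])
      then show "((\<lambda>t. pr (B (t, s)) (Y (t, s))) has_vector_derivative G (t, s)) (at t within I)"
        by (simp add: G_def add.commute)
    qed
    then show ?thesis by simp
  qed
  have Y_u0: "Y (u0, s) = X (u0, s)" if "s \<in> J" for s
    using fix_X[OF u0 that] by (simp add: Y_def)
  define Z where "Z p = Y p - X p" for p
  have contZ: "continuous_on (I \<times> J) Z" unfolding Z_def by (intro continuous_on_diff X Y)
  note prim_I = u0[unfolded I_def] and prim_J = v0[unfolded J_def]
  have Z_eq: "Z (u, v) = primitive v0 (\<lambda>s. pr (B (u, s)) (Z (u, s)) - primitive u0 (\<lambda>t. pr (Bu (t, s)) (Z (t, s))) u) v"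
    if uv: "u \<in> I" "v \<in> J" for u v
  proof -
    have cBX: "continuous_on J (\<lambda>s. pr (B (u', s)) (X (u', s)))" if "u' \<in> I" for u'
      by (rule slice_v[OF contBX[OF X] that])
    have cH: "continuous_on J (\<lambda>s. primitive u0 (\<lambda>t. H (t, s)) u)"
      using slice_v[OF prim_u[OF contH] uv(1)] by simp
    have "primitive u0 (\<lambda>t. pr (A (t, v)) (X (t, v))) u =
        primitive u0 (\<lambda>t. pr (A (t, v0)) (X (t, v0)) + primitive v0 (\<lambda>s. H (t, s)) v) u"
      by (rule primitive_cong[OF _ prim_I uv(1)[unfolded I_def]]) (rule AX[unfolded I_def, OF _ uv(2)])
    also have "\<dots> = primitive u0 (\<lambda>t. pr (A (t, v0)) (X (t, v0))) u + primitive u0 (\<lambda>t. primitive v0 (\<lambda>s. H (t, s)) v) u"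
    proof (rule primitive_add[OF _ _ prim_I uv(1)[unfolded I_def], folded I_def])
      show "continuous_on I (\<lambda>t. pr (A (t, v0)) (X (t, v0)))" by (rule slice_u[OF contAX[OF X] v0])
      show "continuous_on I (\<lambda>t. primitive v0 (\<lambda>s. H (t, s)) v)"
        using slice_u[OF prim_v[OF contH] uv(2)] by simp
    qed
    \<comment> \<open>After the exchange every term is an integral in s from v0 to v, so they can be
      combined under one integral sign.\<close>
    also have "primitive u0 (\<lambda>t. primitive v0 (\<lambda>s. H (t, s)) v) u = primitive v0 (\<lambda>s. primitive u0 (\<lambda>t. H (t, s)) u) v"
      by (rule primitive_swap[OF _ prim_I uv(1)[unfolded I_def] prim_J uv(2)[unfolded J_def], folded I_def J_def])
         (use contH in simp)
    finally have "Z (u, v) = primitive v0 (\<lambda>s. pr (B (u0, s)) (X (u0, s))) v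
        + primitive v0 (\<lambda>s. primitive u0 (\<lambda>t. H (t, s)) u) v - primitive v0 (\<lambda>s. pr (B (u, s)) (X (u, s))) v"
      unfolding Z_def using fix_X[OF uv] by (simp add: Y_def)
    also have "\<dots> = primitive v0 (\<lambda>s. pr (B (u0, s)) (X (u0, s)) + primitive u0 (\<lambda>t. H (t, s)) u - pr (B (u, s)) (X (u, s))) v"
      using primitive_add[OF cBX[OF u0, unfolded J_def] cH[unfolded J_def] prim_J uv(2)[unfolded J_def]]
        primitive_diff[OF continuous_on_add[OF cBX[OF u0] cH, unfolded J_def] cBX[OF uv(1), unfolded J_def] prim_J uv(2)[unfolded J_def]]
      by simp
    also have "\<dots> = primitive v0 (\<lambda>s. pr (B (u, s)) (Z (u, s)) - primitive u0 (\<lambda>t. pr (Bu (t, s)) (Z (t, s))) u) v"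
    proof (rule primitive_cong[OF _ prim_J uv(2)[unfolded J_def], folded J_def])
      fix s assume s: "s \<in> J"
      have "primitive u0 (\<lambda>t. G (t, s)) u - primitive u0 (\<lambda>t. H (t, s)) u = primitive u0 (\<lambda>t. G (t, s) - H (t, s)) u"
        using primitive_diff[OF slice_u[OF contG s, unfolded I_def] slice_u[OF contH s, unfolded I_def] prim_I uv(1)[unfolded I_def]]
        by simp
      also have "(\<lambda>t. G (t, s) - H (t, s)) = (\<lambda>t. pr (Bu (t, s)) (Z (t, s)))"
        by (simp add: G_def H_def Z_def diff_right)
      finally show "pr (B (u0, s)) (X (u0, s)) + primitive u0 (\<lambda>t. H (t, s)) u - pr (B (u, s)) (X (u, s)) =
        pr (B (u, s)) (Z (u, s)) - primitive u0 (\<lambda>t. pr (Bu (t, s)) (Z (t, s))) u"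
        using BY[OF uv(1) s] Y_u0[OF s] by (simp add: Z_def diff_right algebra_simps)
    qed
    finally show ?thesis .
  qed
  have "compact (I \<times> J)" "I \<times> J \<noteq> {}"
    using u0 v0 by (auto simp: I_def J_def intro: compact_Times)
  from continuous_attains_sup[OF this continuous_on_norm[OF contZ]]
  obtain q where q: "q \<in> I \<times> J" "\<And>p. p \<in> I \<times> J \<Longrightarrow> norm (Z p) \<le> norm (Z q)" by blast
  define N where "N = norm (Z q)"
  have N: "norm (Z (t, s)) \<le> N" if "t \<in> I" "s \<in> J" for t s
    using q(2)[of "(t, s)"] that by (simp add: N_def)
  \<comment> \<open>At a maximum point of the norm, the term with \<open>B\<close> and the inner
    integral with \<open>Bu\<close> are each at most K M N; the outer integral contributes
    \<open>d\<close>. Hence N is at most 2 d K M N, which is at most N / 2.\<close>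
  have "N = 0"
  proof -
    obtain u v where uv: "q = (u, v)" "u \<in> I" "v \<in> J" using q(1) by blast
    have inner: "norm (primitive u0 (\<lambda>t. pr (Bu (t, s)) (Z (t, s))) u) \<le> K * M * N" if s: "s \<in> J" for s
    proof -
      have "norm (primitive u0 (\<lambda>t. pr (Bu (t, s)) (Z (t, s))) u) \<le> d * (K * M * N)"
      proof (rule bound_u[OF _ uv(2)])
        show "continuous_on I (\<lambda>t. pr (Bu (t, s)) (Z (t, s)))"
          by (rule slice_u[OF contpr[OF cQ(4) contZ] s])
        show "norm (pr (Bu (t, s)) (Z (t, s))) \<le> K * M * N" if "t \<in> I" for t
          using that s Q1 by (intro KM M N) auto
      qed
      also have "\<dots> \<le> 1 * (K * M * N)"
        using d(2) K(1) Mpos by (intro mult_right_mono) (auto simp: N_def)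
      finally show ?thesis by simp
    qed
    have "norm (Z (u, v)) \<le> d * (2 * (K * M * N))"
      unfolding Z_eq[OF uv(2,3)]
    proof (rule bound_v[OF _ uv(3)])
      have "continuous_on J (\<lambda>s. primitive u0 (\<lambda>t. pr (Bu (t, s)) (Z (t, s))) u)"
        using slice_v[OF prim_u[OF contpr[OF cQ(4) contZ]] uv(2)] by simp
      then show "continuous_on J (\<lambda>s. pr (B (u, s)) (Z (u, s)) - primitive u0 (\<lambda>t. pr (Bu (t, s)) (Z (t, s))) u)"
        by (intro continuous_on_diff slice_v[OF contBX[OF contZ] uv(2)])
      show "norm (pr (B (u, s)) (Z (u, s)) - primitive u0 (\<lambda>t. pr (Bu (t, s)) (Z (t, s))) u) \<le> 2 * (K * M * N)"
        if s: "s \<in> J" for s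
      proof -
        have "norm (pr (B (u, s)) (Z (u, s))) \<le> K * M * N"
          using s uv(2) Q1 by (intro KM M N) auto
        with inner[OF s] show ?thesis
          by (intro order_trans[OF norm_triangle_ineq4]) simp
      qed
    qed
    also have "\<dots> = 2 * (d * (K * M)) * N" by (simp add: algebra_simps)
    also have "\<dots> \<le> 1 / 2 * N"
      using dKM by (intro mult_right_mono) (auto simp: N_def)
    finally have "N \<le> 1 / 2 * N" by (simp add: N_def uv(1))
    moreover have "N \<ge> 0" by (simp add: N_def)
    ultimately show ?thesis by linarith
  qed
  then have XY: "Y (u, v) = X (u, v)" if "u \<in> I" "v \<in> J" for u v
    using N[OF that] by (simp add: Z_def)
  \<comment> \<open>In the open square the derivatives relative to the closed intervals become
    ordinary two-sided derivatives.\<close>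
  define U where "U = {u0 - d<..<u0 + d} \<times> {v0 - d<..<v0 + d}"
  have U: "open_rectangle U" "(u0, v0) \<in> U" "open U" "U \<subseteq> I \<times> J"
    using d(1) by (auto simp: open_rectangle_def U_def I_def J_def open_Times)
  have at_I: "at u within I = at u" if "(u, v) \<in> U" for u v
    using that by (auto simp: U_def I_def intro!: at_within_interior)
  have at_J: "at v within J = at v" if "(u, v) \<in> U" for u v
    using that by (auto simp: U_def J_def intro!: at_within_interior)
  show thesis
  proof (rule that[OF U(1,2)])
    show "U \<subseteq> S" using U(4) QS by blast
    show "X (u0, v0) = x0" using fix_X[OF u0 v0] by simp
    fix p assume p: "p \<in> U"
    show "has_partials X (pr (A p) (X p)) (pr (B p) (X p)) p"
    proof (rule has_partials_of_continuous[OF U(3) p])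
      show "continuous_on U (\<lambda>p. pr (B p) (X p))"
        by (rule continuous_on_subset[OF contBX[OF X] U(4)])
      fix u v assume uv: "(u, v) \<in> U"
      then have m: "u \<in> I" "v \<in> J" using U(4) by auto
      show "((\<lambda>s. X (u, s)) has_vector_derivative pr (B (u, v)) (X (u, v))) (at v)"
        using X_v[OF m] by (simp add: at_J[OF uv])
      have "((\<lambda>t. X (t, v)) has_vector_derivative pr (A (u, v)) (X (u, v))) (at u within I)"
        by (rule has_vector_derivative_transform[OF m(1) _ Y_u[OF m]]) (rule XY[symmetric, OF _ m(2)])
      then show "((\<lambda>t. X (t, v)) has_vector_derivative pr (A (u, v)) (X (u, v))) (at u)"
        by (simp add: at_I[OF uv])
    qed
  qed
qed

section \<open>Frames in Minkowski space\<close>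

lemma bounded_bilinear_lorentz: "bounded_bilinear lorentz"
proof -
  have "bilinear lorentz"
    unfolding bilinear_def lorentz_def by (auto intro!: linearI simp: algebra_simps)
  then show ?thesis by (simp add: bilinear_conv_bounded_bilinear)
qed

text \<open>Provides the product rule and the smoothness rule for the scalar product.\<close>

interpretation lorentz: bounded_bilinear lorentz
  by (rule bounded_bilinear_lorentz)

lemma lorentz_commute: "lorentz x y = lorentz y x"
  by (simp add: lorentz_def)

lemmas lorentz_simps = lorentz.add_left lorentz.add_right lorentz.diff_left lorentz.diff_right
  lorentz.minus_left lorentz.minus_right lorentz.scaleR_left lorentz.scaleR_right
  lorentz.zero_left lorentz.zero_right

text \<open>The time-like vector stands second: e1 is meant along the space-like z_u, e2 completes
  the tangent plane, and n is the space-like normal.\<close>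

definition lorentz_frame :: "real ^ 3 \<Rightarrow> real ^ 3 \<Rightarrow> real ^ 3 \<Rightarrow> bool" where
  "lorentz_frame e1 e2 n \<longleftrightarrow> lorentz e1 e1 = 1 \<and> lorentz e2 e2 = - 1 \<and> lorentz n n = 1 \<and>
     lorentz e1 e2 = 0 \<and> lorentz e1 n = 0 \<and> lorentz e2 n = 0"

text \<open>Both sides say that the same two matrices are inverse to each other.\<close>

lemma lorentz_frame_iff_complete:
  "lorentz_frame e1 e2 n \<longleftrightarrow>
    (\<forall>i j. e1 $ i * e1 $ j - e2 $ i * e2 $ j + n $ i * n $ j =
      (if i = j then if i = 3 then - 1 else 1 else 0))"
proof -
  let ?\<eta> = "\<lambda>x. vector [x $ 1, x $ 2, - x $ 3] :: real ^ 3"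
  let ?A = "vector [?\<eta> e1, - ?\<eta> e2, ?\<eta> n] :: real ^ 3 ^ 3"
  let ?B = "transpose (vector [e1, e2, n] :: real ^ 3 ^ 3)"
  have "lorentz_frame e1 e2 n \<longleftrightarrow> ?A ** ?B = mat 1"
    unfolding lorentz_frame_def lorentz_def
    by (simp add: vec_eq_iff forall_3 matrix_matrix_mult_def sum_3 transpose_def mat_def; argo)
  also have "\<dots> \<longleftrightarrow> ?B ** ?A = mat 1"
    by (rule matrix_left_right_inverse)
  also have "\<dots> \<longleftrightarrow> (\<forall>i j. e1 $ i * e1 $ j - e2 $ i * e2 $ j + n $ i * n $ j =
      (if i = j then if i = 3 then - 1 else 1 else 0))"
    by (simp add: vec_eq_iff forall_3 matrix_matrix_mult_def sum_3 transpose_def mat_def; argo)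
  finally show ?thesis .
qed

text \<open>The completeness relation contracted with \<open>w\<close>; the sign of the e2 term
  reflects that e2 has square -1.\<close>

lemma lorentz_frame_expansion:
  assumes "lorentz_frame e1 e2 n"
  shows "w = lorentz w e1 *\<^sub>R e1 - lorentz w e2 *\<^sub>R e2 + lorentz w n *\<^sub>R n"
proof -
  have c: "e1 $ i * e1 $ j - e2 $ i * e2 $ j + n $ i * n $ j =
      (if i = j then if i = 3 then - 1 else 1 else 0)" for i j
    using assms lorentz_frame_iff_complete by blast
  have "(lorentz w e1 *\<^sub>R e1 - lorentz w e2 *\<^sub>R e2 + lorentz w n *\<^sub>R n) $ i =
      w $ 1 * (e1 $ 1 * e1 $ i - e2 $ 1 * e2 $ i + n $ 1 * n $ i) +
      w $ 2 * (e1 $ 2 * e1 $ i - e2 $ 2 * e2 $ i + n $ 2 * n $ i) -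
      w $ 3 * (e1 $ 3 * e1 $ i - e2 $ 3 * e2 $ i + n $ 3 * n $ i)" for i
    by (simp add: lorentz_def algebra_simps)
  also have "\<dots> i = w $ i" for i
    unfolding c using exhaust_3[of i] by auto
  finally show ?thesis by (simp add: vec_eq_iff)
qed

section \<open>The frame system and its integrability conditions\<close>

type_synonym moving_frame = "(real ^ 3) \<times> (real ^ 3) \<times> (real ^ 3) \<times> (real ^ 3)"

text \<open>The action of an infinitesimal motion, given by five of its coefficients, on a base point and
  a frame; rotations of the frame must be skew with respect to the signature of
  \<open>lorentz_frame\<close>.\<close>

definition frame_action :: "real \<times> real \<times> real \<times> real \<times> real \<Rightarrow> moving_frame \<Rightarrow> moving_frame" where
  "frame_action c X = (case c of (x1, x2, x3, x4, x5) \<Rightarrow> case X of (z, e1, e2, n) \<Rightarrow>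
     (x1 *\<^sub>R e1 + x2 *\<^sub>R e2, x3 *\<^sub>R e2 + x4 *\<^sub>R n, x3 *\<^sub>R e1 + x5 *\<^sub>R n, x5 *\<^sub>R e2 - x4 *\<^sub>R e1))"

text \<open>Bilinearity is what the existence theorem asks of the system, so the action is used
  directly instead of a matrix of size twelve.\<close>

lemma bounded_bilinear_frame_action: "bounded_bilinear frame_action"
proof -
  have "bilinear frame_action"
    unfolding bilinear_def frame_action_def
    by (auto intro!: linearI simp: algebra_simps split_beta')
  then show ?thesis by (simp add: bilinear_conv_bounded_bilinear)
qed

text \<open>In the completeness relation the derivatives cancel in pairs by skewness of the
  coefficients, before anything is known about scalar products. The determinant is constant because
  the coefficient matrix of the system, written in the frame itself, has zero diagonal.\<close>

lemma lorentz_frame_transport: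
  fixes e1 e2 n :: "real \<times> real \<Rightarrow> real ^ 3"
  assumes U: "convex U" "p0 \<in> U"
    and e1: "\<And>p. p \<in> U \<Longrightarrow> has_partials e1 (x3 p *\<^sub>R e2 p + x4 p *\<^sub>R n p) (y3 p *\<^sub>R e2 p + y4 p *\<^sub>R n p) p"
    and e2: "\<And>p. p \<in> U \<Longrightarrow> has_partials e2 (x3 p *\<^sub>R e1 p + x5 p *\<^sub>R n p) (y3 p *\<^sub>R e1 p + y5 p *\<^sub>R n p) p"
    and n: "\<And>p. p \<in> U \<Longrightarrow> has_partials n (x5 p *\<^sub>R e2 p - x4 p *\<^sub>R e1 p) (y5 p *\<^sub>R e2 p - y4 p *\<^sub>R e1 p) p"
    and init: "lorentz_frame (e1 p0) (e2 p0) (n p0)" and p: "p \<in> U"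
  shows "lorentz_frame (e1 p) (e2 p) (n p)"
    and "det (vector [e1 p, e2 p, n p] :: real ^ 3 ^ 3) = det (vector [e1 p0, e2 p0, n p0] :: real ^ 3 ^ 3)"
proof -
  note component = bounded_linear.has_partials[OF bounded_linear_vec_nth]
  have "e1 p $ i * e1 p $ j - e2 p $ i * e2 p $ j + n p $ i * n p $ j =
      e1 p0 $ i * e1 p0 $ j - e2 p0 $ i * e2 p0 $ j + n p0 $ i * n p0 $ j" for i j
  proof (rule partials_zero_imp_constant[OF U(1) _ p U(2)])
    fix p assume p: "p \<in> U"
    note c = component[OF e1[OF p]] component[OF e2[OF p]] component[OF n[OF p]]
    show "has_partials (\<lambda>p. e1 p $ i * e1 p $ j - e2 p $ i * e2 p $ j + n p $ i * n p $ j) 0 0 p"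
      using has_partials_add[OF has_partials_diff[OF has_partials_mult[OF c(1) c(1), of i j]
          has_partials_mult[OF c(2) c(2), of i j]] has_partials_mult[OF c(3) c(3), of i j]]
      by (simp add: algebra_simps)
  qed
  then show "lorentz_frame (e1 p) (e2 p) (n p)"
    using init unfolding lorentz_frame_iff_complete by simp
  show "det (vector [e1 p, e2 p, n p] :: real ^ 3 ^ 3) = det (vector [e1 p0, e2 p0, n p0] :: real ^ 3 ^ 3)"
  proof (rule partials_zero_imp_constant[OF U(1) _ p U(2)])
    fix p assume p: "p \<in> U"
    note c = component[OF e1[OF p]] component[OF e2[OF p]] component[OF n[OF p]]
    \<comment> \<open>The determinant is a signed sum of six triple products, each an instance of
      this rule.\<close>
    note t = has_partials_mult[OF has_partials_mult[OF c(1) c(2)] c(3)]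
    show "has_partials (\<lambda>p. det (vector [e1 p, e2 p, n p] :: real ^ 3 ^ 3)) 0 0 p"
      using has_partials_diff[OF has_partials_diff[OF has_partials_diff[OF
          has_partials_add[OF has_partials_add[OF t[of 1 2 3] t[of 2 3 1]] t[of 3 1 2]]
          t[of 1 3 2]] t[of 2 1 3]] t[of 3 2 1]]
      by (simp add: det_3 algebra_simps)
  qed
qed

text \<open>The six conditions under which the system below is completely integrable: the first three for
  the position vector, then the Gauss equation and the two Codazzi equations.\<close>

lemma frame_action_compatible:
  assumes "\<Phi>v = aPu + sP * p" "\<Phi> * q = sPu + aP * p" "\<Phi> * l = sP * k"
    and "pv = qu + k * l" "lu = - p * m - q * k" "kv + mu = - p * l"
  shows "frame_action (\<Phi>v, 0, pv, 0, kv) X + frame_action (\<Phi>, 0, p, 0, k) (frame_action (aP, sP, q, l, - m) X)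
       = frame_action (aPu, sPu, qu, lu, - mu) X + frame_action (aP, sP, q, l, - m) (frame_action (\<Phi>, 0, p, 0, k) X)"
proof -
  obtain z e1 e2 n where X: "X = (z, e1, e2, n)" by (cases X)
  have kv: "kv = - p * l - mu" using assms(6) by simp
  have 3: "(\<Phi> * l) *\<^sub>R n = (sP * k) *\<^sub>R n" by (simp add: assms(3))
  have 2: "(\<Phi> * q) *\<^sub>R e2 = sPu *\<^sub>R e2 + (aP * p) *\<^sub>R e2" by (simp add: assms(2) scaleR_add_left)
  show ?thesis
    unfolding X frame_action_def assms(1,4,5) kv
    using 2 3 by (simp add: algebra_simps)
qed

text \<open>Values of functions and derivatives at one point are replaced by independent reals, so
  that the six conditions become field identities. \<open>R\<close> and \<open>S\<close> stand for
  the quotients f_u / \<Phi> and f_v / \<Psi>, whose derivatives \<open>Ru\<close> and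
  \<open>Sv\<close> occur in the Gauss equation. The coefficients \<open>p\<close> and
  \<open>q\<close> solve the first two conditions after the system for \<Phi> and \<Psi> is
  inserted; \<open>k\<close> and \<open>l\<close> come from M = \<alpha> \<Phi> \<Psi>, and
  \<open>m\<close> is chosen so that N = 0.\<close>

lemma gauss_codazzi_algebra:
  fixes a au av auv s al alu alv fu fv P Q Pv Qu R S Ru Sv :: real
  assumes s: "s > 0" "s\<^sup>2 = 1 + a\<^sup>2" and pos: "P > 0" "Q > 0"
    and al: "alu = al * (a * au / s\<^sup>2 - 2 * fu)" "alv = al * (a * av / s\<^sup>2 - 2 * fv)"
    and Pv: "Pv = fv * P + a * fu * Q" and Qu: "Qu = - a * fv * P + fu * Q"
    and R: "R = fu / P" and S: "S = fv / Q"
    and gauss: "1 / (P * Q) * (auv / s\<^sup>2 - a * au * av / (s\<^sup>2)\<^sup>2 - 2 * a * fu * fv)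
      + a * au * fu / (s\<^sup>2 * P\<^sup>2) - a * av * fv / (s\<^sup>2 * Q\<^sup>2) + fu\<^sup>2 / P\<^sup>2 - fv\<^sup>2 / Q\<^sup>2
      + 1 / P * Ru - 1 / Q * Sv + al\<^sup>2 / s\<^sup>2 = 0"
  defines "su \<equiv> a * au / s" and "sv \<equiv> a * av / s"
  defines "p \<equiv> s * P * S - au / s" and "q \<equiv> s * Q * R" and "k \<equiv> al * P / s" and "l \<equiv> al * Q"
    and "m \<equiv> a * al * Q / s"
  shows "Pv = (au * Q + a * Qu) + s * Q * p"
    and "P * q = (su * Q + s * Qu) + a * Q * p"
    and "P * l = s * Q * k"
    and "(sv * P + s * Pv) * S + s * P * Sv - (auv * s - au * sv) / s\<^sup>2
      = ((su * Q + s * Qu) * R + s * Q * Ru) + k * l"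
    and "alu * Q + al * Qu = - p * m - q * k"
    and "((alv * P + al * Pv) * s - al * P * sv) / s\<^sup>2 +
       (((au * al + a * alu) * Q + a * al * Qu) * s - a * al * Q * su) / s\<^sup>2 = - p * l"
proof -
  have ne: "s \<noteq> 0" "P \<noteq> 0" "Q \<noteq> 0" using s pos by auto
  have s2: "s * s = 1 + a * a" using s(2) by (simp add: power2_eq_square)
  have q: "q = s * Q * fu / P" by (simp add: q_def R)
  have p: "p = s * P * fv / Q - au / s" by (simp add: p_def S)
  show "Pv = (au * Q + a * Qu) + s * Q * p"
  proof -
    have "s * Q * p = (s * s) * P * fv - au * Q" using ne by (simp add: p field_simps)
    then show ?thesis by (simp add: s2 Pv Qu algebra_simps)
  qed
  show "P * q = (su * Q + s * Qu) + a * Q * p"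
    using ne by (simp add: q p su_def Qu field_simps)
  show "P * l = s * Q * k" using ne by (simp add: l_def k_def)
  show "alu * Q + al * Qu = - p * m - q * k"
    using ne by (simp add: al(1) Qu p q m_def k_def power2_eq_square field_simps)
  show "(sv * P + s * Pv) * S + s * P * Sv - (auv * s - au * sv) / s\<^sup>2
      = ((su * Q + s * Qu) * R + s * Q * Ru) + k * l"
  \<comment> \<open>The defect of the Gauss condition is - s P Q times the left-hand side of the
    displayed equation.\<close>
  proof -
    have "(sv * P + s * Pv) * S + s * P * Sv - (auv * s - au * sv) / s\<^sup>2
      - (((su * Q + s * Qu) * R + s * Q * Ru) + k * l) =
      - (s * P * Q) * (1 / (P * Q) * (auv / s\<^sup>2 - a * au * av / (s\<^sup>2)\<^sup>2 - 2 * a * fu * fv)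
      + a * au * fu / (s\<^sup>2 * P\<^sup>2) - a * av * fv / (s\<^sup>2 * Q\<^sup>2) + fu\<^sup>2 / P\<^sup>2 - fv\<^sup>2 / Q\<^sup>2
      + 1 / P * Ru - 1 / Q * Sv + al\<^sup>2 / s\<^sup>2)"
      unfolding R S sv_def su_def Pv Qu k_def l_def using ne
      by (simp add: field_simps power2_eq_square)
    then show ?thesis unfolding gauss by simp
  qed
  show "((alv * P + al * Pv) * s - al * P * sv) / s\<^sup>2 +
       (((au * al + a * alu) * Q + a * al * Qu) * s - a * al * Q * su) / s\<^sup>2 = - p * l"
  proof -
    have a1: "((alv * P + al * Pv) * s - al * P * sv) / s\<^sup>2 = al * (a * fu * Q - fv * P) / s"
      using ne by (simp add: al(2) Pv sv_def power2_eq_square field_simps)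
    have a2: "(((au * al + a * alu) * Q + a * al * Qu) * s - a * al * Q * su) / s\<^sup>2
        = al * (au * Q - a * fu * Q - (a * a) * fv * P) / s"
      using ne by (simp add: al(1) Qu su_def power2_eq_square field_simps)
    \<comment> \<open>The terms with \<open>fu\<close> cancel, and the terms with \<open>fv\<close>
      combine to the factor 1 + a^2, which is s^2; what remains is a multiple of
      \<open>p\<close>.\<close>
    have "al * (a * fu * Q - fv * P) / s + al * (au * Q - a * fu * Q - (a * a) * fv * P) / s
        = al * (au * Q - (1 + a * a) * fv * P) / s"
      by (simp add: add_divide_distrib[symmetric] algebra_simps)
    also have "\<dots> = - p * (al * Q)"
      unfolding s2[symmetric] p using ne by (simp add: field_simps)
    finally show ?thesis unfolding a1 a2 l_def .
  qed
qed

section \<open>Existence of the surface\<close>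

lemma open_rectangle_open: "open_rectangle U \<Longrightarrow> open U"
  and open_rectangle_convex: "open_rectangle U \<Longrightarrow> convex U"
  unfolding open_rectangle_def by (auto intro!: open_Times convex_Times)

section \<open>The given functions and the coefficients of the frame system\<close>

text \<open>These are the hypotheses that determine the frame equations and their integrability. The
  initial values enter where the parameters are shown to be canonical, and are assumptions of
  \<open>axis_eq\<close> and \<open>canonical_surface_exists\<close>.\<close>

locale canonical_data =
  fixes u0 v0 :: real and R :: "(real \<times> real) set"
    and a \<alpha> f \<Phi> \<Psi> :: "real \<times> real \<Rightarrow> real"
  assumes R: "open_rectangle R" "(u0, v0) \<in> R"
    and smooth: "smooth_on R a" "smooth_on R \<alpha>" "smooth_on R \<Phi>" "smooth_on R \<Psi>"
    and alpha_pos: "\<And>p. p \<in> R \<Longrightarrow> \<alpha> p > 0"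
    and f: "f = (\<lambda>p. (ln (sqrt (1 + (a p)\<^sup>2)) - ln (\<alpha> p)) / 2)"
    and pos: "\<And>p. p \<in> R \<Longrightarrow> \<Phi> p > 0" "\<And>p. p \<in> R \<Longrightarrow> \<Psi> p > 0"
    and pde_Phi: "\<And>p. p \<in> R \<Longrightarrow> \<partial>\<^sub>v \<Phi> p = \<partial>\<^sub>v f p * \<Phi> p + a p * \<partial>\<^sub>u f p * \<Psi> p"
    and pde_Psi: "\<And>p. p \<in> R \<Longrightarrow> \<partial>\<^sub>u \<Psi> p = - a p * \<partial>\<^sub>v f p * \<Phi> p + \<partial>\<^sub>u f p * \<Psi> p"
    and equation: "\<And>p. p \<in> R \<Longrightarrow>
      1 / (\<Phi> p * \<Psi> p) *
          (\<partial>\<^sub>v (\<partial>\<^sub>u a) p / (1 + (a p)\<^sup>2)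
           - a p * \<partial>\<^sub>u a p * \<partial>\<^sub>v a p / (1 + (a p)\<^sup>2)\<^sup>2
           - 2 * a p * \<partial>\<^sub>u f p * \<partial>\<^sub>v f p)
      + a p * \<partial>\<^sub>u a p * \<partial>\<^sub>u f p / ((1 + (a p)\<^sup>2) * (\<Phi> p)\<^sup>2)
      - a p * \<partial>\<^sub>v a p * \<partial>\<^sub>v f p / ((1 + (a p)\<^sup>2) * (\<Psi> p)\<^sup>2)
      + (\<partial>\<^sub>u f p)\<^sup>2 / (\<Phi> p)\<^sup>2
      - (\<partial>\<^sub>v f p)\<^sup>2 / (\<Psi> p)\<^sup>2
      + 1 / \<Phi> p * \<partial>\<^sub>u (\<lambda>q. \<partial>\<^sub>u f q / \<Phi> q) p
      - 1 / \<Psi> p * \<partial>\<^sub>v (\<lambda>q. \<partial>\<^sub>v f q / \<Psi> q) p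
      + (\<alpha> p)\<^sup>2 / (1 + (a p)\<^sup>2) = 0"
begin

definition \<sigma> where "\<sigma> p = sqrt (1 + (a p)\<^sup>2)"
text \<open>\<open>cp\<close> and \<open>cq\<close> are the rotation coefficients between e1 and e2
  in the directions u and v. The other three measure the turning of the normal: e1_v has n-component
  \<open>cl\<close>, while e2_u and e2_v have n-components \<open>ck\<close> and -
  \<open>cm\<close>. The n-component of e1_u is zero, which makes the u-lines asymptotic.\<close>

definition cp where "cp p = \<sigma> p * \<Phi> p * (\<partial>\<^sub>v f p / \<Psi> p) - \<partial>\<^sub>u a p / \<sigma> p"
definition cq where "cq p = \<sigma> p * \<Psi> p * (\<partial>\<^sub>u f p / \<Phi> p)"
definition ck where "ck p = \<alpha> p * \<Phi> p / \<sigma> p"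
definition cl where "cl p = \<alpha> p * \<Psi> p"
definition cm where "cm p = a p * \<alpha> p * \<Psi> p / \<sigma> p"

lemma open_R: "open R" and convex_R: "convex R"
  using R(1) by (simp_all add: open_rectangle_open open_rectangle_convex)

lemma sigma_pos: "\<sigma> p > 0"
  unfolding \<sigma>_def by (simp add: add_pos_nonneg)

lemma sigma_square: "(\<sigma> p)\<^sup>2 = 1 + (a p)\<^sup>2"
  unfolding \<sigma>_def by simp

lemma sigma_nonzero [simp]: "\<sigma> p \<noteq> 0"
  using sigma_pos[of p] by simp

lemma smooth_sigma: "smooth_on R \<sigma>"
proof -
  have "smooth_on R (\<lambda>p. sqrt (1 + (a p)\<^sup>2))"
    by (intro smooth_on_sqrt smooth_on_add smooth_on_const smooth_on_power open_R smooth(1))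
       (simp add: add_pos_nonneg)
  then show ?thesis by (simp add: \<sigma>_def[abs_def])
qed

lemma smooth_f: "smooth_on R f"
proof -
  have "smooth_on R (\<lambda>p. (ln (\<sigma> p) - ln (\<alpha> p)) / 2)"
    by (intro smooth_on_divide smooth_on_diff smooth_on_ln smooth_on_const open_R smooth smooth_sigma)
       (simp_all add: sigma_pos alpha_pos)
  then show ?thesis by (simp add: f \<sigma>_def)
qed

lemma smooth_quotients:
  "smooth_on R (\<lambda>q. \<partial>\<^sub>u f q / \<Phi> q)" "smooth_on R (\<lambda>q. \<partial>\<^sub>v f q / \<Psi> q)"
proof -
  have "\<Phi> p \<noteq> 0" "\<Psi> p \<noteq> 0" if "p \<in> R" for p using pos[OF that] by simp_all
  then show "smooth_on R (\<lambda>q. \<partial>\<^sub>u f q / \<Phi> q)" "smooth_on R (\<lambda>q. \<partial>\<^sub>v f q / \<Psi> q)"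
    by (intro smooth_on_divide open_R smooth smooth_on_partial_u smooth_on_partial_v smooth_f; simp)+
qed

lemma smooth_coefficients:
  "smooth_on R cp" "smooth_on R cq" "smooth_on R ck" "smooth_on R cl" "smooth_on R cm"
  unfolding cp_def[abs_def] cq_def[abs_def] ck_def[abs_def] cl_def[abs_def] cm_def[abs_def]
  by (intro smooth_on_diff smooth_on_mult[OF _ smooth_on_mult] smooth_on_mult smooth_quotients open_R
        smooth smooth_sigma smooth_on_partial_u smooth_on_divide sigma_nonzero)+

lemma sigma_partials:
  assumes "p \<in> R"
  shows "has_partials \<sigma> (a p * \<partial>\<^sub>u a p / \<sigma> p) (a p * \<partial>\<^sub>v a p / \<sigma> p) p"
proof -
  note a = smooth_on_has_partials[OF open_R smooth(1) assms]
  have "has_partials (\<lambda>p. 1 + a p * a p) (2 * a p * \<partial>\<^sub>u a p) (2 * a p * \<partial>\<^sub>v a p) p"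
    using has_partials_add[OF has_partials_const has_partials_mult[OF a a], of 1] by (simp add: algebra_simps)
  moreover have "1 + a p * a p > 0" by (simp add: add_pos_nonneg)
  ultimately have "has_partials (\<lambda>p. sqrt (1 + a p * a p)) (2 * a p * \<partial>\<^sub>u a p / (2 * sqrt (1 + a p * a p)))
     (2 * a p * \<partial>\<^sub>v a p / (2 * sqrt (1 + a p * a p))) p"
    by (rule has_partials_sqrt)
  then show ?thesis by (simp add: \<sigma>_def[abs_def] power2_eq_square)
qed

text \<open>Logarithmic differentiation of the definition of \<open>f\<close>, solved for the
  derivatives of \<alpha>. This expresses the Codazzi conditions through \<open>a\<close>, \<alpha>
  and the first derivatives of \<open>a\<close> and \<open>f\<close>.\<close>

lemma alpha_partials:
  assumes p: "p \<in> R"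
  shows "\<partial>\<^sub>u \<alpha> p = \<alpha> p * (a p * \<partial>\<^sub>u a p / (\<sigma> p)\<^sup>2 - 2 * \<partial>\<^sub>u f p)"
    and "\<partial>\<^sub>v \<alpha> p = \<alpha> p * (a p * \<partial>\<^sub>v a p / (\<sigma> p)\<^sup>2 - 2 * \<partial>\<^sub>v f p)"
proof -
  let ?fu = "(a p * \<partial>\<^sub>u a p / \<sigma> p / \<sigma> p - \<partial>\<^sub>u \<alpha> p / \<alpha> p) * (1 / 2)"
  let ?fv = "(a p * \<partial>\<^sub>v a p / \<sigma> p / \<sigma> p - \<partial>\<^sub>v \<alpha> p / \<alpha> p) * (1 / 2)"
  note al = smooth_on_has_partials[OF open_R smooth(2) p]
  have "has_partials (\<lambda>p. (ln (\<sigma> p) - ln (\<alpha> p)) * (1 / 2)) ?fu ?fv p"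
    using has_partials_mult[OF has_partials_diff[OF has_partials_ln[OF sigma_partials[OF p] sigma_pos]
          has_partials_ln[OF al alpha_pos[OF p]]] has_partials_const, of "1 / 2"] by simp
  moreover have "f = (\<lambda>p. (ln (\<sigma> p) - ln (\<alpha> p)) * (1 / 2))" by (simp add: f \<sigma>_def)
  ultimately have "has_partials f ?fu ?fv p" by simp
  then have "\<partial>\<^sub>u f p = ?fu" "\<partial>\<^sub>v f p = ?fv" by (rule partial_u_eq, rule partial_v_eq)
  then show "\<partial>\<^sub>u \<alpha> p = \<alpha> p * (a p * \<partial>\<^sub>u a p / (\<sigma> p)\<^sup>2 - 2 * \<partial>\<^sub>u f p)"
    "\<partial>\<^sub>v \<alpha> p = \<alpha> p * (a p * \<partial>\<^sub>v a p / (\<sigma> p)\<^sup>2 - 2 * \<partial>\<^sub>v f p)"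
    using alpha_pos[OF p] by (simp_all add: field_simps power2_eq_square)
qed

text \<open>Product and quotient rules give the derivatives of the five coefficients; the statement
  then becomes an instance of the pointwise algebra.\<close>

lemma frame_action_integrable:
  assumes p: "p \<in> R"
  shows "frame_action (\<partial>\<^sub>v \<Phi> p, 0, \<partial>\<^sub>v cp p, 0, \<partial>\<^sub>v ck p) X +
      frame_action (\<Phi> p, 0, cp p, 0, ck p) (frame_action (a p * \<Psi> p, \<sigma> p * \<Psi> p, cq p, cl p, - cm p) X) =
    frame_action (\<partial>\<^sub>u (\<lambda>p. a p * \<Psi> p) p, \<partial>\<^sub>u (\<lambda>p. \<sigma> p * \<Psi> p) p, \<partial>\<^sub>u cq p, \<partial>\<^sub>u cl p, - \<partial>\<^sub>u cm p) X +
      frame_action (a p * \<Psi> p, \<sigma> p * \<Psi> p, cq p, cl p, - cm p) (frame_action (\<Phi> p, 0, cp p, 0, ck p) X)"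
proof -
  note h = smooth_on_has_partials[OF open_R _ p]
  note a = h[OF smooth(1)] and al = h[OF smooth(2)] and Ph = h[OF smooth(3)] and Ps = h[OF smooth(4)]
    and au = h[OF smooth_on_partial_u[OF smooth(1)]] and r = h[OF smooth_quotients(1)]
    and t = h[OF smooth_quotients(2)] and s = sigma_partials[OF p]
  note alg = gauss_codazzi_algebra[OF sigma_pos sigma_square pos[OF p] alpha_partials[OF p]
      pde_Phi[OF p] pde_Psi[OF p] refl refl equation[OF p, folded sigma_square]]
  show ?thesis
  proof (rule frame_action_compatible)
    have "\<partial>\<^sub>u (\<lambda>p. a p * \<Psi> p) p = \<partial>\<^sub>u a p * \<Psi> p + a p * \<partial>\<^sub>u \<Psi> p"
      by (rule partial_u_eq[OF has_partials_mult[OF a Ps]])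
    then show "\<partial>\<^sub>v \<Phi> p = \<partial>\<^sub>u (\<lambda>p. a p * \<Psi> p) p + \<sigma> p * \<Psi> p * cp p"
      using alg(1) by (simp add: cp_def)
    have "\<partial>\<^sub>u (\<lambda>p. \<sigma> p * \<Psi> p) p = a p * \<partial>\<^sub>u a p / \<sigma> p * \<Psi> p + \<sigma> p * \<partial>\<^sub>u \<Psi> p"
      by (rule partial_u_eq[OF has_partials_mult[OF s Ps]])
    then show "\<Phi> p * cq p = \<partial>\<^sub>u (\<lambda>p. \<sigma> p * \<Psi> p) p + a p * \<Psi> p * cp p"
      using alg(2) by (simp add: cp_def cq_def)
    show "\<Phi> p * cl p = \<sigma> p * \<Psi> p * ck p" using alg(3) by (simp add: cl_def ck_def)
    have "\<partial>\<^sub>v cp p = (a p * \<partial>\<^sub>v a p / \<sigma> p * \<Phi> p + \<sigma> p * \<partial>\<^sub>v \<Phi> p) * (\<partial>\<^sub>v f p / \<Psi> p)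
        + \<sigma> p * \<Phi> p * \<partial>\<^sub>v (\<lambda>q. \<partial>\<^sub>v f q / \<Psi> q) p
        - (\<partial>\<^sub>v (\<partial>\<^sub>u a) p * \<sigma> p - \<partial>\<^sub>u a p * (a p * \<partial>\<^sub>v a p / \<sigma> p)) / (\<sigma> p)\<^sup>2"
      unfolding cp_def[abs_def]
      by (rule partial_v_eq[OF has_partials_diff[OF has_partials_mult[OF has_partials_mult[OF s Ph] t]
            has_partials_divide[OF au s sigma_nonzero]]])
    moreover have "\<partial>\<^sub>u cq p = (a p * \<partial>\<^sub>u a p / \<sigma> p * \<Psi> p + \<sigma> p * \<partial>\<^sub>u \<Psi> p) * (\<partial>\<^sub>u f p / \<Phi> p)
        + \<sigma> p * \<Psi> p * \<partial>\<^sub>u (\<lambda>q. \<partial>\<^sub>u f q / \<Phi> q) p"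
      unfolding cq_def[abs_def]
      by (rule partial_u_eq[OF has_partials_mult[OF has_partials_mult[OF s Ps] r]])
    ultimately show "\<partial>\<^sub>v cp p = \<partial>\<^sub>u cq p + ck p * cl p"
      using alg(4) by (simp add: ck_def cl_def)
    have "\<partial>\<^sub>u cl p = \<partial>\<^sub>u \<alpha> p * \<Psi> p + \<alpha> p * \<partial>\<^sub>u \<Psi> p"
      unfolding cl_def[abs_def] by (rule partial_u_eq[OF has_partials_mult[OF al Ps]])
    then show "\<partial>\<^sub>u cl p = - cp p * cm p - cq p * ck p"
      using alg(5) by (simp add: cp_def cm_def cq_def ck_def)
    have "\<partial>\<^sub>v ck p = ((\<partial>\<^sub>v \<alpha> p * \<Phi> p + \<alpha> p * \<partial>\<^sub>v \<Phi> p) * \<sigma> p - \<alpha> p * \<Phi> p * (a p * \<partial>\<^sub>v a p / \<sigma> p)) / (\<sigma> p)\<^sup>2"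
      unfolding ck_def[abs_def]
      by (rule partial_v_eq[OF has_partials_divide[OF has_partials_mult[OF al Ph] s sigma_nonzero]])
    moreover have "\<partial>\<^sub>u cm p = (((\<partial>\<^sub>u a p * \<alpha> p + a p * \<partial>\<^sub>u \<alpha> p) * \<Psi> p + a p * \<alpha> p * \<partial>\<^sub>u \<Psi> p) * \<sigma> p
        - a p * \<alpha> p * \<Psi> p * (a p * \<partial>\<^sub>u a p / \<sigma> p)) / (\<sigma> p)\<^sup>2"
      unfolding cm_def[abs_def]
      by (rule partial_u_eq[OF has_partials_divide[OF has_partials_mult[OF has_partials_mult[OF a al] Ps] s sigma_nonzero]])
    ultimately show "\<partial>\<^sub>v ck p + \<partial>\<^sub>u cm p = - cp p * cl p"
      using alg(6) by (simp add: cp_def cl_def)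
  qed
qed

lemma frame_exists:
  obtains U z e1 e2 n where "open_rectangle U" "(u0, v0) \<in> U" "U \<subseteq> R"
    "\<And>p. p \<in> U \<Longrightarrow> has_partials z (\<Phi> p *\<^sub>R e1 p) ((a p * \<Psi> p) *\<^sub>R e1 p + (\<sigma> p * \<Psi> p) *\<^sub>R e2 p) p"
    "\<And>p. p \<in> U \<Longrightarrow> has_partials e1 (cp p *\<^sub>R e2 p) (cq p *\<^sub>R e2 p + cl p *\<^sub>R n p) p"
    "\<And>p. p \<in> U \<Longrightarrow> has_partials e2 (cp p *\<^sub>R e1 p + ck p *\<^sub>R n p) (cq p *\<^sub>R e1 p - cm p *\<^sub>R n p) p"
    "\<And>p. p \<in> U \<Longrightarrow> has_partials n (ck p *\<^sub>R e2 p) (- cm p *\<^sub>R e2 p - cl p *\<^sub>R e1 p) p"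
    "\<And>p. p \<in> U \<Longrightarrow> lorentz_frame (e1 p) (e2 p) (n p)"
    "\<And>p. p \<in> U \<Longrightarrow> det (vector [e1 p, e2 p, n p] :: real ^ 3 ^ 3) = 1"
proof -
  let ?A = "\<lambda>p. (\<Phi> p, 0 :: real, cp p, 0 :: real, ck p)"
  let ?B = "\<lambda>p. (a p * \<Psi> p, \<sigma> p * \<Psi> p, cq p, cl p, - cm p)"
  let ?Av = "\<lambda>p. (\<partial>\<^sub>v \<Phi> p, 0 :: real, \<partial>\<^sub>v cp p, 0 :: real, \<partial>\<^sub>v ck p)"
  let ?Bu = "\<lambda>p. (\<partial>\<^sub>u (\<lambda>p. a p * \<Psi> p) p, \<partial>\<^sub>u (\<lambda>p. \<sigma> p * \<Psi> p) p, \<partial>\<^sub>u cq p, \<partial>\<^sub>u cl p, - \<partial>\<^sub>u cm p)"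
  \<comment> \<open>The second frame vector is the time axis. The sign in the third one makes the
    determinant equal to 1, as the orientation of the unit normal requires.\<close>
  let ?init = "(0, vector [1, 0, 0], vector [0, 0, 1], vector [0, - 1, 0]) :: moving_frame"
  note sm = smooth smooth_coefficients smooth_on_mult[OF open_R smooth(1,4)] smooth_on_mult[OF open_R smooth_sigma smooth(4)]
  note pu = has_partials_u[OF smooth_on_has_partials[OF open_R]]
  note pv = has_partials_v[OF smooth_on_has_partials[OF open_R]]
  obtain U X where U: "open_rectangle U" "(u0, v0) \<in> U" "U \<subseteq> R" and init: "X (u0, v0) = ?init"
    and X: "\<And>p. p \<in> U \<Longrightarrow> has_partials X (frame_action (?A p) (X p)) (frame_action (?B p) (X p)) p"
  proof (rule integrable_linear_system_exists[OF bounded_bilinear_frame_action open_R R(2),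
        where A = ?A and B = ?B and Av = ?Av and Bu = ?Bu and ?x0.0 = ?init])
    show "continuous_on R ?A" "continuous_on R ?B"
      by (intro continuous_on_Pair continuous_on_const continuous_on_minus smooth_on_continuous sm)+
    show "continuous_on R ?Av" "continuous_on R ?Bu"
      by (intro continuous_on_Pair continuous_on_const continuous_on_minus smooth_on_continuous
          smooth_on_partial_u smooth_on_partial_v sm)+
    show "((\<lambda>s. ?A (u, s)) has_vector_derivative ?Av (u, v)) (at v)" if "(u, v) \<in> R" for u v
      using pv[OF _ that] sm by (intro has_vector_derivative_Pair has_vector_derivative_const) auto
    show "((\<lambda>t. ?B (t, v)) has_vector_derivative ?Bu (u, v)) (at u)" if "(u, v) \<in> R" for u v
      using pu[OF _ that] sm
      by (intro has_vector_derivative_Pair has_vector_derivative_minus) auto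
  qed (use frame_action_integrable in blast)+
  define z e1 e2 n where "z p = fst (X p)" and "e1 p = fst (snd (X p))" and "e2 p = fst (snd (snd (X p)))"
    and "n p = snd (snd (snd (X p)))" for p
  note d = z_def[abs_def] e1_def[abs_def] e2_def[abs_def] n_def[abs_def]
  note fst = bounded_linear.has_partials[OF bounded_linear_fst]
    and snd = bounded_linear.has_partials[OF bounded_linear_snd]
  have z: "has_partials z (\<Phi> p *\<^sub>R e1 p) ((a p * \<Psi> p) *\<^sub>R e1 p + (\<sigma> p * \<Psi> p) *\<^sub>R e2 p) p"
    and e1: "has_partials e1 (cp p *\<^sub>R e2 p) (cq p *\<^sub>R e2 p + cl p *\<^sub>R n p) p"
    and e2: "has_partials e2 (cp p *\<^sub>R e1 p + ck p *\<^sub>R n p) (cq p *\<^sub>R e1 p - cm p *\<^sub>R n p) p"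
    and n: "has_partials n (ck p *\<^sub>R e2 p) (- cm p *\<^sub>R e2 p - cl p *\<^sub>R e1 p) p" if "p \<in> U" for p
    using fst[OF X[OF that]] fst[OF snd[OF X[OF that]]] fst[OF snd[OF snd[OF X[OF that]]]]
      snd[OF snd[OF snd[OF X[OF that]]]]
    by (simp_all add: d frame_action_def split_beta')
  have "e1 (u0, v0) = vector [1, 0, 0]" "e2 (u0, v0) = vector [0, 0, 1]" "n (u0, v0) = vector [0, - 1, 0]"
    by (simp_all add: d init)
  then have fr0: "lorentz_frame (e1 (u0, v0)) (e2 (u0, v0)) (n (u0, v0))"
    and det0: "det (vector [e1 (u0, v0), e2 (u0, v0), n (u0, v0)] :: real ^ 3 ^ 3) = 1"
    by (simp_all add: lorentz_frame_def lorentz_def det_3)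
  have fr: "lorentz_frame (e1 p) (e2 p) (n p)" "det (vector [e1 p, e2 p, n p] :: real ^ 3 ^ 3) = 1" if "p \<in> U" for p
    using lorentz_frame_transport[where ?x4.0 = "\<lambda>_. 0" and ?x5.0 = ck and ?y5.0 = "\<lambda>p. - cm p"
        and ?x3.0 = cp and ?y3.0 = cq and ?y4.0 = cl and ?e1.0 = e1 and ?e2.0 = e2 and n = n,
        OF open_rectangle_convex[OF U(1)] U(2) _ _ _ fr0 that] e1 e2 n det0 by simp_all
  show thesis by (rule that[OF U z e1 e2 n fr])
qed

end

section \<open>Normals read off from a frame\<close>

lemma det_lorentz_frame_combination:
  "det (vector [x *\<^sub>R e1, y *\<^sub>R e1 + w *\<^sub>R e2, c *\<^sub>R n] :: real ^ 3 ^ 3) =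
    x * w * c * det (vector [e1, e2, n] :: real ^ 3 ^ 3)"
  by (simp add: det_3 algebra_simps)

text \<open>Since z_u and z_v span the same plane as e1 and e2, orthogonality to them leaves only
  the n-component in the frame expansion.\<close>

lemma normal_vector_frame:
  assumes fr: "lorentz_frame e1 e2 n"
    and z: "\<partial>\<^sub>u z p = x *\<^sub>R e1" "\<partial>\<^sub>v z p = y *\<^sub>R e1 + w *\<^sub>R e2" "x \<noteq> 0" "w \<noteq> 0"
  shows "normal_vector z p m \<longleftrightarrow> m \<noteq> 0 \<and> m = lorentz m n *\<^sub>R n"
proof
  assume m: "normal_vector z p m"
  then have m0: "m \<noteq> 0" "lorentz m (x *\<^sub>R e1) = 0" "lorentz m (y *\<^sub>R e1 + w *\<^sub>R e2) = 0"
    unfolding normal_vector_def z by blast+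
  have m1: "lorentz m e1 = 0" using m0(2) z(3) by (simp add: lorentz_simps)
  then have m2: "lorentz m e2 = 0" using m0(3) z(4) by (simp add: lorentz_simps)
  show "m \<noteq> 0 \<and> m = lorentz m n *\<^sub>R n"
    using m0(1) m1 m2 lorentz_frame_expansion[OF fr, of m] by simp
next
  assume m: "m \<noteq> 0 \<and> m = lorentz m n *\<^sub>R n"
  have "lorentz (c *\<^sub>R n) e1 = 0" "lorentz (c *\<^sub>R n) e2 = 0" for c
    using fr by (simp_all add: lorentz_frame_def lorentz_simps lorentz_commute)
  with m have "lorentz m e1 = 0" "lorentz m e2 = 0" by metis+
  then show "normal_vector z p m"
    using m by (simp add: normal_vector_def z lorentz_simps)
qed

text \<open>A normal is c n; unit length gives c^2 = 1, and the orientation determinant has the sign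
  of c because x and w are positive. This evaluates the definite description.\<close>

lemma unit_normal_eq:
  assumes fr: "lorentz_frame e1 e2 n"
    and z: "\<partial>\<^sub>u z p = x *\<^sub>R e1" "\<partial>\<^sub>v z p = y *\<^sub>R e1 + w *\<^sub>R e2" "x > 0" "w > 0"
    and det: "det (vector [e1, e2, n] :: real ^ 3 ^ 3) > 0"
  shows "unit_normal z p = n"
  unfolding unit_normal_def
proof (rule the_equality)
  have nn: "lorentz n n = 1" using fr by (simp add: lorentz_frame_def)
  have ne: "x \<noteq> 0" "w \<noteq> 0" using z by simp_all
  note normal = normal_vector_frame[OF fr z(1,2) ne]
  have "n \<noteq> 0" using nn by (auto simp: lorentz_simps)
  then show "normal_vector z p n \<and> lorentz n n = 1 \<and> det (vector [\<partial>\<^sub>u z p, \<partial>\<^sub>v z p, n] :: real ^ 3 ^ 3) > 0"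
    using det_lorentz_frame_combination[of x e1 y w e2 1 n] z det nn by (simp add: normal)
  fix m
  assume m: "normal_vector z p m \<and> lorentz m m = 1 \<and> det (vector [\<partial>\<^sub>u z p, \<partial>\<^sub>v z p, m] :: real ^ 3 ^ 3) > 0"
  define c where "c = lorentz m n"
  have mc: "m = c *\<^sub>R n" using m normal[of m] by (simp add: c_def)
  have cc: "c * c = 1" using m nn by (simp add: mc lorentz_simps)
  have "x * w * c * det (vector [e1, e2, n] :: real ^ 3 ^ 3) > 0"
    using m det_lorentz_frame_combination[of x e1 y w e2 c n] by (simp add: mc z)
  then have "c * (x * w * det (vector [e1, e2, n] :: real ^ 3 ^ 3)) > 0" by (simp add: mult_ac)
  moreover have "x * w * det (vector [e1, e2, n] :: real ^ 3 ^ 3) > 0" using z det by simp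
  ultimately have "c > 0" by (rule zero_less_mult_pos2)
  with cc have "c = 1" by (simp add: square_eq_1_iff)
  then show "m = n" by (simp add: mc)
qed

section \<open>Oriented integrals and the values on the axes\<close>

lemma real_interval_integral_FTC:
  fixes F g :: "real \<Rightarrow> real"
  assumes "continuous_on {min a b..max a b} g"
    and "\<And>x. x \<in> {min a b..max a b} \<Longrightarrow> (F has_real_derivative g x) (at x)"
  shows "(LBINT x=a..b. g x) = F b - F a"
proof (rule interval_integral_FTC_finite[OF assms(1)])
  fix x assume "min a b \<le> x" "x \<le> max a b"
  then have "(F has_real_derivative g x) (at x)" by (intro assms(2)) simp
  then show "(F has_vector_derivative g x) (at x within {min a b..max a b})"
    by (simp add: has_real_derivative_iff_has_vector_derivative[symmetric] has_field_derivative_at_within)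
qed

text \<open>On the axes both unknowns of the Goursat problem agree: their difference \<open>d\<close> satisfies
  \<open>d' = f' d\<close>, so that \<open>exp (- f) d\<close> is constant.\<close>

lemma goursat_axis_eq:
  fixes f f' w P Q :: "real \<Rightarrow> real"
  assumes t: "t \<in> {c..d}" "t0 \<in> {c..d}"
    and cont: "continuous_on {c..d} g"
    and P: "\<And>t. t \<in> {c..d} \<Longrightarrow> P t = exp ((LBINT r=t0..t. g r) + f t0)"
    and Q: "\<And>t. t \<in> {c..d} \<Longrightarrow> (Q has_real_derivative (g t - f' t) * P t + f' t * Q t) (at t)"
    and f: "\<And>t. t \<in> {c..d} \<Longrightarrow> (f has_real_derivative f' t) (at t)"
    and init: "Q t0 = P t0"
  shows "Q t = P t"
proof -
  have dP: "(P has_real_derivative g t * P t) (at t within {c..d})" if t: "t \<in> {c..d}" for t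
  proof -
    have "((\<lambda>t. LBINT r=t0..t. g r) has_real_derivative g t) (at t within {c..d})"
      using interval_integral_FTC2[of c t0 d g t] cont assms(2) t
      by (simp add: has_real_derivative_iff_has_vector_derivative)
    then have "((\<lambda>t. exp ((LBINT r=t0..t. g r) + f t0)) has_real_derivative
        g t * exp ((LBINT r=t0..t. g r) + f t0)) (at t within {c..d})"
      by (auto intro!: derivative_eq_intros)
    then have "((\<lambda>t. exp ((LBINT r=t0..t. g r) + f t0)) has_real_derivative g t * P t) (at t within {c..d})"
      using P[OF t] by simp
    then show ?thesis
      unfolding has_field_derivative_def
      by (rule has_derivative_transform[OF t, rotated]) (rule P)
  qed
  have "\<exists>k. \<forall>t\<in>{c..d}. exp (- f t) * (Q t - P t) = k"
  proof (rule has_derivative_zero_constant)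
    fix t assume t: "t \<in> {c..d}"
    have "((\<lambda>t. exp (- f t) * (Q t - P t)) has_real_derivative
        exp (- f t) * ((g t - f' t) * P t + f' t * Q t - g t * P t) + exp (- f t) * (- f' t) * (Q t - P t))
        (at t within {c..d})"
      using dP[OF t] Q[OF t, THEN has_field_derivative_at_within] f[OF t, THEN has_field_derivative_at_within]
      by (auto intro!: derivative_eq_intros)
    then have "((\<lambda>t. exp (- f t) * (Q t - P t)) has_real_derivative 0) (at t within {c..d})"
      by (simp add: algebra_simps)
    then show "((\<lambda>t. exp (- f t) * (Q t - P t)) has_derivative (\<lambda>h. 0)) (at t within {c..d})"
      by (simp add: has_field_derivative_def lambda_zero)
  qed simp
  then obtain k where k: "\<And>t. t \<in> {c..d} \<Longrightarrow> exp (- f t) * (Q t - P t) = k" by blast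
  have "k = 0" using k[OF t(2)] init by simp
  then show ?thesis using k[OF t(1)] by simp
qed

lemma rectangle_box_subset:
  fixes u v u' v' :: real
  assumes "open_rectangle U" "(u, v) \<in> U" "(u', v') \<in> U"
  shows "{min u u'..max u u'} \<times> {min v v'..max v v'} \<subseteq> U"
  using assms unfolding open_rectangle_def by auto

lemma has_partials_real_u:
  "has_partials g gu gv (u, v) \<Longrightarrow> ((\<lambda>t. g (t, v)) has_real_derivative gu) (at u)"
  using has_partials_u[of g gu gv "(u, v)"] by (simp add: has_real_derivative_iff_has_vector_derivative)

lemma has_partials_real_v:
  "has_partials g gu gv (u, v) \<Longrightarrow> ((\<lambda>s. g (u, s)) has_real_derivative gv) (at v)"
  using has_partials_v[of g gu gv "(u, v)"] by (simp add: has_real_derivative_iff_has_vector_derivative)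

lemma continuous_on_slice_u:
  "continuous_on U h \<Longrightarrow> (\<And>t. t \<in> I \<Longrightarrow> (t, v) \<in> U) \<Longrightarrow> continuous_on I (\<lambda>t. h (t, v))"
  by (rule continuous_on_compose2[of U h]) (auto intro!: continuous_intros)

lemma continuous_on_slice_v:
  "continuous_on U h \<Longrightarrow> (\<And>s. s \<in> I \<Longrightarrow> (u, s) \<in> U) \<Longrightarrow> continuous_on I (\<lambda>s. h (u, s))"
  by (rule continuous_on_compose2[of U h]) (auto intro!: continuous_intros)

context canonical_data
begin

text \<open>On v = v0 the explicit formula for \<Phi> solves a scalar linear equation, and the
  second equation of the system is a linear equation for \<Psi> with the same start value exp (f
  (u0, v0)). On u = u0 the roles are exchanged. The result removes the ratio of \<Phi> and \<Psi>
  from the canonical integrals along the axes.\<close>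

lemma axis_eq:
  assumes init_Phi: "\<And>u. (u, v0) \<in> R \<Longrightarrow>
      \<Phi> (u, v0) =
        exp ((LBINT t=u0..u. - a (t, v0) * \<partial>\<^sub>v f (t, v0) + \<partial>\<^sub>u f (t, v0)) + f (u0, v0))"
    and init_Psi: "\<And>v. (u0, v) \<in> R \<Longrightarrow>
      \<Psi> (u0, v) =
        exp ((LBINT s=v0..v. \<partial>\<^sub>v f (u0, s) + a (u0, s) * \<partial>\<^sub>u f (u0, s)) + f (u0, v0))"
  shows "(u, v0) \<in> R \<Longrightarrow> \<Psi> (u, v0) = \<Phi> (u, v0)" and "(u0, v) \<in> R \<Longrightarrow> \<Phi> (u0, v) = \<Psi> (u0, v)"
proof -
  note cont = smooth_on_continuous[OF smooth(1)] smooth_on_continuous[OF smooth_on_partial_u[OF smooth_f]]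
    smooth_on_continuous[OF smooth_on_partial_v[OF smooth_f]]
  have at0: "\<Psi> (u0, v0) = \<Phi> (u0, v0)" using init_Phi[OF R(2)] init_Psi[OF R(2)] by simp
  show "\<Psi> (u, v0) = \<Phi> (u, v0)" if u: "(u, v0) \<in> R"
  proof -
    let ?I = "{min u0 u..max u0 u}"
    have R': "(t, v0) \<in> R" if "t \<in> ?I" for t
      using rectangle_box_subset[OF R u] that by (force simp: min.commute max.commute)
    show ?thesis
    proof (rule goursat_axis_eq[where c = "min u0 u" and d = "max u0 u" and ?t0.0 = u0
          and Q = "\<lambda>t. \<Psi> (t, v0)" and P = "\<lambda>t. \<Phi> (t, v0)" and f = "\<lambda>t. f (t, v0)"
          and f' = "\<lambda>t. \<partial>\<^sub>u f (t, v0)" and g = "\<lambda>t. - a (t, v0) * \<partial>\<^sub>v f (t, v0) + \<partial>\<^sub>u f (t, v0)"])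
      show "continuous_on ?I (\<lambda>t. - a (t, v0) * \<partial>\<^sub>v f (t, v0) + \<partial>\<^sub>u f (t, v0))"
        using R' by (intro continuous_on_add continuous_on_mult continuous_on_minus
            continuous_on_slice_u[OF cont(1)] continuous_on_slice_u[OF cont(2)] continuous_on_slice_u[OF cont(3)])
      fix t assume t: "t \<in> ?I"
      show "\<Phi> (t, v0) = exp ((LBINT t=u0..t. - a (t, v0) * \<partial>\<^sub>v f (t, v0) + \<partial>\<^sub>u f (t, v0)) + f (u0, v0))"
        by (rule init_Phi[OF R'[OF t]])
      show "((\<lambda>t. \<Psi> (t, v0)) has_real_derivative (- a (t, v0) * \<partial>\<^sub>v f (t, v0) + \<partial>\<^sub>u f (t, v0) - \<partial>\<^sub>u f (t, v0)) * \<Phi> (t, v0)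
          + \<partial>\<^sub>u f (t, v0) * \<Psi> (t, v0)) (at t)"
        using has_partials_real_u[OF smooth_on_has_partials[OF open_R smooth(4) R'[OF t]]] pde_Psi[OF R'[OF t]] by simp
      show "((\<lambda>t. f (t, v0)) has_real_derivative \<partial>\<^sub>u f (t, v0)) (at t)"
        by (rule has_partials_real_u[OF smooth_on_has_partials[OF open_R smooth_f R'[OF t]]])
    qed (use at0 in auto)
  qed
  show "\<Phi> (u0, v) = \<Psi> (u0, v)" if v: "(u0, v) \<in> R"
  proof -
    let ?I = "{min v0 v..max v0 v}"
    have R': "(u0, s) \<in> R" if "s \<in> ?I" for s
      using rectangle_box_subset[OF R v] that by (force simp: min.commute max.commute)
    show ?thesis
    proof (rule goursat_axis_eq[where c = "min v0 v" and d = "max v0 v" and ?t0.0 = v0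
          and Q = "\<lambda>s. \<Phi> (u0, s)" and P = "\<lambda>s. \<Psi> (u0, s)" and f = "\<lambda>s. f (u0, s)"
          and f' = "\<lambda>s. \<partial>\<^sub>v f (u0, s)" and g = "\<lambda>s. \<partial>\<^sub>v f (u0, s) + a (u0, s) * \<partial>\<^sub>u f (u0, s)"])
      show "continuous_on ?I (\<lambda>s. \<partial>\<^sub>v f (u0, s) + a (u0, s) * \<partial>\<^sub>u f (u0, s))"
        using R' by (intro continuous_on_add continuous_on_mult
            continuous_on_slice_v[OF cont(1)] continuous_on_slice_v[OF cont(2)] continuous_on_slice_v[OF cont(3)])
      fix s assume s: "s \<in> ?I"
      show "\<Psi> (u0, s) = exp ((LBINT s=v0..s. \<partial>\<^sub>v f (u0, s) + a (u0, s) * \<partial>\<^sub>u f (u0, s)) + f (u0, v0))"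
        by (rule init_Psi[OF R'[OF s]])
      show "((\<lambda>s. \<Phi> (u0, s)) has_real_derivative (\<partial>\<^sub>v f (u0, s) + a (u0, s) * \<partial>\<^sub>u f (u0, s) - \<partial>\<^sub>v f (u0, s)) * \<Psi> (u0, s)
          + \<partial>\<^sub>v f (u0, s) * \<Phi> (u0, s)) (at s)"
        using has_partials_real_v[OF smooth_on_has_partials[OF open_R smooth(3) R'[OF s]]] pde_Phi[OF R'[OF s]]
        by (simp add: algebra_simps)
      show "((\<lambda>s. f (u0, s)) has_real_derivative \<partial>\<^sub>v f (u0, s)) (at s)"
        by (rule has_partials_real_v[OF smooth_on_has_partials[OF open_R smooth_f R'[OF s]]])
    qed (use at0 in auto)
  qed
qed

text \<open>Divided by \<Phi>, the first equation of the system says that the integrand is the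
  v-derivative of ln \<Phi>. In the same way \<open>integral_u\<close> integrates the u-derivative
  of ln \<Psi>.\<close>

lemma integral_v:
  assumes "(u, v) \<in> R" "(u, v') \<in> R"
  shows "(LBINT s=v..v'. \<partial>\<^sub>v f (u, s) + a (u, s) * \<partial>\<^sub>u f (u, s) * (\<Psi> (u, s) / \<Phi> (u, s)))
    = ln (\<Phi> (u, v')) - ln (\<Phi> (u, v))"
proof -
  have R': "(u, s) \<in> R" if "s \<in> {min v v'..max v v'}" for s
    using rectangle_box_subset[OF R(1) assms] that by auto
  note cont = smooth_on_continuous[OF smooth(1)] smooth_on_continuous[OF smooth_on_partial_u[OF smooth_f]]
    smooth_on_continuous[OF smooth_on_partial_v[OF smooth_f]] smooth_on_continuous[OF smooth(3)]
    smooth_on_continuous[OF smooth(4)]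
  show ?thesis
  proof (rule real_interval_integral_FTC)
    show "continuous_on {min v v'..max v v'} (\<lambda>s. \<partial>\<^sub>v f (u, s) + a (u, s) * \<partial>\<^sub>u f (u, s) * (\<Psi> (u, s) / \<Phi> (u, s)))"
      using R' by (intro continuous_on_add continuous_on_mult continuous_on_divide cont[THEN continuous_on_slice_v])
        (use pos(1) in force)+
    fix s assume "s \<in> {min v v'..max v v'}"
    note s = R'[OF this]
    from DERIV_ln_divide[OF pos(1)[OF s]] has_partials_real_v[OF smooth_on_has_partials[OF open_R smooth(3) s]]
    have "((\<lambda>s. ln (\<Phi> (u, s))) has_real_derivative 1 / \<Phi> (u, s) * \<partial>\<^sub>v \<Phi> (u, s)) (at s)"
      by (rule DERIV_chain2)
    then show "((\<lambda>s. ln (\<Phi> (u, s))) has_real_derivative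
        \<partial>\<^sub>v f (u, s) + a (u, s) * \<partial>\<^sub>u f (u, s) * (\<Psi> (u, s) / \<Phi> (u, s))) (at s)"
      using pde_Phi[OF s] pos(1)[OF s] by (simp add: add_divide_distrib)
  qed
qed

lemma integral_u:
  assumes "(u, v) \<in> R" "(u', v) \<in> R"
  shows "(LBINT t=u..u'. - a (t, v) * \<partial>\<^sub>v f (t, v) * (\<Phi> (t, v) / \<Psi> (t, v)) + \<partial>\<^sub>u f (t, v))
    = ln (\<Psi> (u', v)) - ln (\<Psi> (u, v))"
proof -
  have R': "(t, v) \<in> R" if "t \<in> {min u u'..max u u'}" for t
    using rectangle_box_subset[OF R(1) assms] that by auto
  note cont = smooth_on_continuous[OF smooth(1)] smooth_on_continuous[OF smooth_on_partial_u[OF smooth_f]]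
    smooth_on_continuous[OF smooth_on_partial_v[OF smooth_f]] smooth_on_continuous[OF smooth(3)]
    smooth_on_continuous[OF smooth(4)]
  show ?thesis
  proof (rule real_interval_integral_FTC)
    show "continuous_on {min u u'..max u u'} (\<lambda>t. - a (t, v) * \<partial>\<^sub>v f (t, v) * (\<Phi> (t, v) / \<Psi> (t, v)) + \<partial>\<^sub>u f (t, v))"
      using R' by (intro continuous_on_add continuous_on_mult continuous_on_minus continuous_on_divide
          cont[THEN continuous_on_slice_u]) (use pos(2) in force)+
    fix t assume "t \<in> {min u u'..max u u'}"
    note t = R'[OF this]
    from DERIV_ln_divide[OF pos(2)[OF t]] has_partials_real_u[OF smooth_on_has_partials[OF open_R smooth(4) t]]
    have "((\<lambda>t. ln (\<Psi> (t, v))) has_real_derivative 1 / \<Psi> (t, v) * \<partial>\<^sub>u \<Psi> (t, v)) (at t)"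
      by (rule DERIV_chain2)
    then show "((\<lambda>t. ln (\<Psi> (t, v))) has_real_derivative
        - a (t, v) * \<partial>\<^sub>v f (t, v) * (\<Phi> (t, v) / \<Psi> (t, v)) + \<partial>\<^sub>u f (t, v)) (at t)"
      using pde_Psi[OF t] pos(2)[OF t] by (simp add: add_divide_distrib diff_divide_distrib)
  qed
qed

lemma canonical_surface_exists:
  assumes init_Phi: "\<And>u. (u, v0) \<in> R \<Longrightarrow>
      \<Phi> (u, v0) =
        exp ((LBINT t=u0..u. - a (t, v0) * \<partial>\<^sub>v f (t, v0) + \<partial>\<^sub>u f (t, v0)) + f (u0, v0))"
    and init_Psi: "\<And>v. (u0, v) \<in> R \<Longrightarrow>
      \<Psi> (u0, v) =
        exp ((LBINT s=v0..v. \<partial>\<^sub>v f (u0, s) + a (u0, s) * \<partial>\<^sub>u f (u0, s)) + f (u0, v0))"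
  shows "\<exists>U z. U \<subseteq> R \<and> canonical_surface_with_invariants u0 v0 a \<alpha> U z"
proof -
  obtain U z e1 e2 n where U: "open_rectangle U" "(u0, v0) \<in> U" "U \<subseteq> R"
    and z: "\<And>p. p \<in> U \<Longrightarrow> has_partials z (\<Phi> p *\<^sub>R e1 p) ((a p * \<Psi> p) *\<^sub>R e1 p + (\<sigma> p * \<Psi> p) *\<^sub>R e2 p) p"
    and e1: "\<And>p. p \<in> U \<Longrightarrow> has_partials e1 (cp p *\<^sub>R e2 p) (cq p *\<^sub>R e2 p + cl p *\<^sub>R n p) p"
    and e2: "\<And>p. p \<in> U \<Longrightarrow> has_partials e2 (cp p *\<^sub>R e1 p + ck p *\<^sub>R n p) (cq p *\<^sub>R e1 p - cm p *\<^sub>R n p) p"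
    and n: "\<And>p. p \<in> U \<Longrightarrow> has_partials n (ck p *\<^sub>R e2 p) (- cm p *\<^sub>R e2 p - cl p *\<^sub>R e1 p) p"
    and fr: "\<And>p. p \<in> U \<Longrightarrow> lorentz_frame (e1 p) (e2 p) (n p)"
    and det: "\<And>p. p \<in> U \<Longrightarrow> det (vector [e1 p, e2 p, n p] :: real ^ 3 ^ 3) = 1"
    by (rule frame_exists) blast
  have oU: "open U" by (rule open_rectangle_open[OF U(1)])
  have R': "p \<in> R" if "p \<in> U" for p using U(3) that by blast
  note on_U = smooth_on_subset[OF _ U(3)]
  \<comment> \<open>A joint induction, since the derivative of each frame vector involves the
    others. Order zero is continuity of a differentiable function; each further order comes from the
    frame equations.\<close>
  have "Ck_on k U e1 \<and> Ck_on k U e2 \<and> Ck_on k U n" for k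
  proof (induction k)
    case 0
    have "continuous_on U h" if "\<And>p. p \<in> U \<Longrightarrow> has_partials h (hu p) (hv p) p"
      for h hu hv :: "real \<times> real \<Rightarrow> real ^ 3"
      using that has_partials_differentiable differentiable_imp_continuous_within
      by (metis continuous_at_imp_continuous_on)
    from this[OF e1] this[OF e2] this[OF n] show ?case by simp
  next
    case (Suc k)
    have c: "Ck_on k U cp" "Ck_on k U cq" "Ck_on k U ck" "Ck_on k U cl" "Ck_on k U cm"
      using smooth_coefficients[THEN on_U] by (simp_all add: smooth_on_def)
    have D: "Ck_on k U (\<lambda>p. g p - h p)" if "Ck_on k U g" "Ck_on k U h"
      for g h :: "real \<times> real \<Rightarrow> real ^ 3"
      using Ck_on_add[OF oU that(1) Ck_on_minus[OF oU that(2)]] by simp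
    have t: "Ck_on k U (\<lambda>p. g p *\<^sub>R h p)" if "Ck_on k U g" "Ck_on k U h"
      for g and h :: "real \<times> real \<Rightarrow> real ^ 3"
      using oU that by (rule Ck_on_scaleR)
    from Suc.IH have IH: "Ck_on k U e1" "Ck_on k U e2" "Ck_on k U n" by blast+
    have "Ck_on (Suc k) U e1"
      by (rule Ck_on_SucI[OF oU e1]) (intro Ck_on_add oU t c IH | assumption)+
    moreover have "Ck_on (Suc k) U e2"
      by (rule Ck_on_SucI[OF oU e2]) (intro Ck_on_add D oU t c IH | assumption)+
    moreover have "Ck_on (Suc k) U n"
      by (rule Ck_on_SucI[OF oU n]) (intro D oU t c Ck_on_minus IH | assumption)+
    ultimately show ?case by blast
  qed
  then have sm: "smooth_on U e1" "smooth_on U e2" by (simp_all add: smooth_on_def)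
  have "Ck_on (Suc k) U z" for k
  proof (rule Ck_on_SucI[OF oU z])
    show "Ck_on k U (\<lambda>p. \<Phi> p *\<^sub>R e1 p)" 
      using smooth_on_scaleR[OF oU on_U[OF smooth(3)] sm(1)] by (simp add: smooth_on_def)
    show "Ck_on k U (\<lambda>p. (a p * \<Psi> p) *\<^sub>R e1 p + (\<sigma> p * \<Psi> p) *\<^sub>R e2 p)"
      using smooth_on_add[OF oU smooth_on_scaleR[OF oU smooth_on_mult[OF oU on_U[OF smooth(1)] on_U[OF smooth(4)]] sm(1)]
          smooth_on_scaleR[OF oU smooth_on_mult[OF oU on_U[OF smooth_sigma] on_U[OF smooth(4)]] sm(2)]]
      by (simp add: smooth_on_def)
  qed
  then have sz: "smooth_on U z" unfolding smooth_on_def using Ck_on_Suc_imp by blast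
  have zu: "\<partial>\<^sub>u z p = \<Phi> p *\<^sub>R e1 p" and zv: "\<partial>\<^sub>v z p = (a p * \<Psi> p) *\<^sub>R e1 p + (\<sigma> p * \<Psi> p) *\<^sub>R e2 p"
    if "p \<in> U" for p
    using partial_u_eq[OF z[OF that]] partial_v_eq[OF z[OF that]] .
  have pos': "\<Phi> p > 0" "\<sigma> p * \<Psi> p > 0" "\<Psi> p > 0" "\<alpha> p > 0" if "p \<in> U" for p
    using pos[OF R'[OF that]] alpha_pos[OF R'[OF that]] sigma_pos by simp_all
  have un: "unit_normal z p = n p" if "p \<in> U" for p
    by (rule unit_normal_eq[OF fr[OF that] zu[OF that] zv[OF that] pos'(1,2)[OF that]])
       (simp add: det[OF that])
  have zuu: "\<partial>\<^sub>u (\<partial>\<^sub>u z) p = \<partial>\<^sub>u \<Phi> p *\<^sub>R e1 p + \<Phi> p *\<^sub>R (cp p *\<^sub>R e2 p)"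
    and zuv: "\<partial>\<^sub>v (\<partial>\<^sub>u z) p = \<partial>\<^sub>v \<Phi> p *\<^sub>R e1 p + \<Phi> p *\<^sub>R (cq p *\<^sub>R e2 p + cl p *\<^sub>R n p)" if "p \<in> U" for p
  proof -
    note h = has_partials_scaleR[OF smooth_on_has_partials[OF open_R smooth(3) R'[OF that]] e1[OF that]]
    show "\<partial>\<^sub>u (\<partial>\<^sub>u z) p = \<partial>\<^sub>u \<Phi> p *\<^sub>R e1 p + \<Phi> p *\<^sub>R (cp p *\<^sub>R e2 p)"
      using partial_cong(1)[OF oU that, of "\<partial>\<^sub>u z" "\<lambda>p. \<Phi> p *\<^sub>R e1 p"] zu partial_u_eq[OF h] by simp
    show "\<partial>\<^sub>v (\<partial>\<^sub>u z) p = \<partial>\<^sub>v \<Phi> p *\<^sub>R e1 p + \<Phi> p *\<^sub>R (cq p *\<^sub>R e2 p + cl p *\<^sub>R n p)"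
      using partial_cong(2)[OF oU that, of "\<partial>\<^sub>u z" "\<lambda>p. \<Phi> p *\<^sub>R e1 p"] zu partial_v_eq[OF h] by simp
  qed
  have zvv: "\<partial>\<^sub>v (\<partial>\<^sub>v z) p =
      (\<partial>\<^sub>v (\<lambda>p. a p * \<Psi> p) p *\<^sub>R e1 p + (a p * \<Psi> p) *\<^sub>R (cq p *\<^sub>R e2 p + cl p *\<^sub>R n p)) +
      (\<partial>\<^sub>v (\<lambda>p. \<sigma> p * \<Psi> p) p *\<^sub>R e2 p + (\<sigma> p * \<Psi> p) *\<^sub>R (cq p *\<^sub>R e1 p - cm p *\<^sub>R n p))" if "p \<in> U" for p
  proof -
    have "\<partial>\<^sub>v (\<partial>\<^sub>v z) p = \<partial>\<^sub>v (\<lambda>p. (a p * \<Psi> p) *\<^sub>R e1 p + (\<sigma> p * \<Psi> p) *\<^sub>R e2 p) p"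
      by (rule partial_cong(2)[OF oU that]) (rule zv)
    also note partial_v_eq[OF has_partials_add[OF
          has_partials_scaleR[OF smooth_on_has_partials[OF open_R smooth_on_mult[OF open_R smooth(1,4)] R'[OF that]] e1[OF that]]
          has_partials_scaleR[OF smooth_on_has_partials[OF open_R smooth_on_mult[OF open_R smooth_sigma smooth(4)] R'[OF that]] e2[OF that]]]]
    finally show ?thesis .
  qed
  have lor: "lorentz (e1 p) (e1 p) = 1" "lorentz (e2 p) (e2 p) = - 1" "lorentz (n p) (n p) = 1"
    "lorentz (e1 p) (e2 p) = 0" "lorentz (e1 p) (n p) = 0" "lorentz (e2 p) (n p) = 0"
    "lorentz (e2 p) (e1 p) = 0" "lorentz (n p) (e1 p) = 0" "lorentz (n p) (e2 p) = 0" if "p \<in> U" for p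
    using fr[OF that] by (simp_all add: lorentz_frame_def lorentz_commute)
  have E: "coeff_E z p = (\<Phi> p)\<^sup>2" and F: "coeff_F z p = a p * \<Phi> p * \<Psi> p"
    and G: "coeff_G z p = - (\<Psi> p)\<^sup>2" and L: "coeff_L z p = 0"
    and M: "coeff_M z p = \<alpha> p * \<Phi> p * \<Psi> p" and N: "coeff_N z p = 0" if p: "p \<in> U" for p
  proof -
    show "coeff_E z p = (\<Phi> p)\<^sup>2" "coeff_F z p = a p * \<Phi> p * \<Psi> p"
      by (simp_all add: coeff_E_def coeff_F_def zu[OF p] zv[OF p] lorentz_simps lor[OF p] power2_eq_square)
    have "coeff_G z p = (a p)\<^sup>2 * (\<Psi> p)\<^sup>2 - (\<sigma> p)\<^sup>2 * (\<Psi> p)\<^sup>2"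
      by (simp add: coeff_G_def zv[OF p] lorentz_simps lor[OF p] power2_eq_square algebra_simps)
    then show "coeff_G z p = - (\<Psi> p)\<^sup>2" by (simp add: sigma_square algebra_simps)
    show "coeff_L z p = 0" by (simp add: coeff_L_def un[OF p] zuu[OF p] lorentz_simps lor[OF p])
    show "coeff_M z p = \<alpha> p * \<Phi> p * \<Psi> p"
      by (simp add: coeff_M_def un[OF p] zuv[OF p] lorentz_simps lor[OF p] cl_def)
    show "coeff_N z p = 0"
      by (simp add: coeff_N_def un[OF p] zvv[OF p] lorentz_simps lor[OF p] cl_def cm_def)
  qed
  have EG: "coeff_E z p > 0" "coeff_G z p < 0" if p: "p \<in> U" for p
    using pos'(1,3)[OF p] unfolding E[OF p] G[OF p] by simp_all
  \<comment> \<open>Pairing with e2 isolates \<open>s\<close>, because z_u has no e2 component;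
    afterwards pairing with e1 isolates \<open>r\<close>.\<close>
  have reg: "r = 0 \<and> s = 0" if p: "p \<in> U" and eq: "r *\<^sub>R \<partial>\<^sub>u z p + s *\<^sub>R \<partial>\<^sub>v z p = 0" for p r s
  proof -
    have "lorentz (r *\<^sub>R \<partial>\<^sub>u z p + s *\<^sub>R \<partial>\<^sub>v z p) (e2 p) = - (s * (\<sigma> p * \<Psi> p))"
      by (simp add: zu[OF p] zv[OF p] lorentz_simps lor[OF p])
    with eq pos'(3)[OF p] have s: "s = 0" by (simp add: lorentz_simps)
    have "lorentz (r *\<^sub>R \<partial>\<^sub>u z p) (e1 p) = r * \<Phi> p" by (simp add: zu[OF p] lorentz_simps lor[OF p])
    moreover have "r *\<^sub>R \<partial>\<^sub>u z p = 0" using eq s by simp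
    ultimately have "r * \<Phi> p = 0" by (metis lorentz.zero_left)
    with s pos'(1)[OF p] show ?thesis by simp
  qed
  have "timelike_surface U z"
    unfolding timelike_surface_def regular_surface_def
  proof (intro conjI ballI allI impI)
    fix p m assume p: "p \<in> U" and m: "normal_vector z p m"
    have ne: "\<Phi> p \<noteq> 0" "\<sigma> p * \<Psi> p \<noteq> 0" using pos'[OF p] by auto
    define c where "c = lorentz m (n p)"
    have "m \<noteq> 0" "m = c *\<^sub>R n p"
      using normal_vector_frame[OF fr[OF p] zu[OF p] zv[OF p] ne] m by (simp_all add: c_def)
    then show "lorentz m m > 0" by (auto simp: lorentz_simps lor[OF p] zero_less_mult_iff)
  qed (use oU sz reg in auto)
  \<comment> \<open>Here EG - F^2 = - \<sigma>^2 \<Phi>^2 \<Psi>^2, which gives K = \<alpha>^2 /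
    \<sigma>^2 and H = a \<alpha> / \<sigma>^2. With \<sigma>^2 = 1 + a^2 the difference K - H^2 is
    \<alpha>^2 / \<sigma>^4.\<close>
  moreover have "gauss_curvature z p - (mean_curvature z p)\<^sup>2 > 0" if p: "p \<in> U" for p
  proof -
    have EGF: "coeff_E z p * coeff_G z p - (coeff_F z p)\<^sup>2 = - ((\<sigma> p)\<^sup>2 * (\<Phi> p)\<^sup>2 * (\<Psi> p)\<^sup>2)"
      by (simp add: E[OF p] F[OF p] G[OF p] sigma_square power_mult_distrib algebra_simps)
    have "gauss_curvature z p = (\<alpha> p)\<^sup>2 / (\<sigma> p)\<^sup>2"
      unfolding gauss_curvature_def EGF using pos'[OF p]
      by (simp add: L[OF p] M[OF p] N[OF p] power_mult_distrib)
    moreover have "mean_curvature z p = a p * \<alpha> p / (\<sigma> p)\<^sup>2"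
      unfolding mean_curvature_def EGF using pos'[OF p]
      by (simp add: L[OF p] M[OF p] N[OF p] F[OF p] power2_eq_square)
    moreover have "A / S - (a p * \<alpha> p / S)\<^sup>2 = (A * S - (a p)\<^sup>2 * (\<alpha> p)\<^sup>2) / S\<^sup>2" if "S \<noteq> 0" for A S
      using that by (simp add: field_simps power2_eq_square)
    ultimately have "gauss_curvature z p - (mean_curvature z p)\<^sup>2
        = ((\<alpha> p)\<^sup>2 * (\<sigma> p)\<^sup>2 - (a p)\<^sup>2 * (\<alpha> p)\<^sup>2) / ((\<sigma> p)\<^sup>2)\<^sup>2"
      by simp
    also have "\<dots> = (\<alpha> p)\<^sup>2 / ((\<sigma> p)\<^sup>2)\<^sup>2"
      by (simp add: sigma_square algebra_simps)
    finally have "gauss_curvature z p - (mean_curvature z p)\<^sup>2 = (\<alpha> p)\<^sup>2 / ((\<sigma> p)\<^sup>2)\<^sup>2" .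
    then show ?thesis using pos'(4)[OF p] by simp
  qed
  moreover have inv: "inv_a z p = a p" "inv_alpha z p = \<alpha> p" and inv_f: "inv_f z p = f p"
    and sq: "sqrt (coeff_E z p) = \<Phi> p" "sqrt (- coeff_G z p) = \<Psi> p" if p: "p \<in> U" for p
  proof -
    show sq: "sqrt (coeff_E z p) = \<Phi> p" "sqrt (- coeff_G z p) = \<Psi> p"
      using pos'[OF p] by (simp_all add: E[OF p] G[OF p])
    show "inv_a z p = a p" "inv_alpha z p = \<alpha> p"
      using pos'[OF p] by (simp_all add: inv_a_def inv_alpha_def sq F[OF p] M[OF p])
    then show "inv_f z p = f p" using pos'(4)[OF p] by (simp add: inv_f_def f)
  qed
  moreover have "canonical_asymptotic_parameters u0 v0 U z"
    unfolding canonical_asymptotic_parameters_def asymptotic_parameters_def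
  proof (intro conjI allI impI ballI)
    have int_v: "integrand_v z p = \<partial>\<^sub>v f p + a p * \<partial>\<^sub>u f p * (\<Psi> p / \<Phi> p)"
      and int_u: "integrand_u z p = - a p * \<partial>\<^sub>v f p * (\<Phi> p / \<Psi> p) + \<partial>\<^sub>u f p" if p: "p \<in> U" for p
      using partial_cong[OF oU p inv_f] by (simp_all add: integrand_v_def integrand_u_def inv[OF p] sq[OF p])
    have cong_v: "(LBINT s=v..v'. integrand_v z (u, s)) = ln (\<Phi> (u, v')) - ln (\<Phi> (u, v))"
      if "(u, v) \<in> U" "(u, v') \<in> U" for u v v'
    proof -
      have "(LBINT s=v..v'. integrand_v z (u, s)) =
          (LBINT s=v..v'. \<partial>\<^sub>v f (u, s) + a (u, s) * \<partial>\<^sub>u f (u, s) * (\<Psi> (u, s) / \<Phi> (u, s)))"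
      proof (rule interval_integral_cong)
        fix s assume "s \<in> einterval (min (ereal v) (ereal v')) (max (ereal v) (ereal v'))"
        then have "s \<in> {min v v'..max v v'}" by (auto simp: einterval_def min_def max_def split: if_splits)
        then have "(u, s) \<in> U" using rectangle_box_subset[OF U(1) that] by auto
        then show "integrand_v z (u, s) = \<partial>\<^sub>v f (u, s) + a (u, s) * \<partial>\<^sub>u f (u, s) * (\<Psi> (u, s) / \<Phi> (u, s))"
          by (rule int_v)
      qed
      then show ?thesis using integral_v[OF R' R'] that by simp
    qed
    have cong_u: "(LBINT t=u..u'. integrand_u z (t, v)) = ln (\<Psi> (u', v)) - ln (\<Psi> (u, v))"
      if "(u, v) \<in> U" "(u', v) \<in> U" for u u' v
    proof -
      have "(LBINT t=u..u'. integrand_u z (t, v)) =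
          (LBINT t=u..u'. - a (t, v) * \<partial>\<^sub>v f (t, v) * (\<Phi> (t, v) / \<Psi> (t, v)) + \<partial>\<^sub>u f (t, v))"
      proof (rule interval_integral_cong)
        fix t assume "t \<in> einterval (min (ereal u) (ereal u')) (max (ereal u) (ereal u'))"
        then have "t \<in> {min u u'..max u u'}" by (auto simp: einterval_def min_def max_def split: if_splits)
        then have "(t, v) \<in> U" using rectangle_box_subset[OF U(1) that] by auto
        then show "integrand_u z (t, v) = - a (t, v) * \<partial>\<^sub>v f (t, v) * (\<Phi> (t, v) / \<Psi> (t, v)) + \<partial>\<^sub>u f (t, v)"
          by (rule int_u)
      qed
      then show ?thesis using integral_u[OF R' R'] that by simp
    qed
    have P0: "\<Phi> (u0, v0) = exp (f (u0, v0))" using init_Phi[OF R(2)] by simp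
    have ax1: "\<Psi> (u, v0) = \<Phi> (u, v0)" if "(u, v0) \<in> R" for u
      using axis_eq(1) init_Phi init_Psi that by blast
    have ax2: "\<Phi> (u0, v) = \<Psi> (u0, v)" if "(u0, v) \<in> R" for v
      using axis_eq(2) init_Phi init_Psi that by blast
    fix u v assume uv: "(u, v) \<in> U"
    then have corners: "(u, v0) \<in> U" "(u0, v) \<in> U" using U(1,2) by (auto simp: open_rectangle_def)
    \<comment> \<open>The exponent telescopes to ln \<Phi>(u,v) - ln \<Phi>(u,v0) + ln \<Psi>(u,v0)
      - ln \<Psi>(u0,v0) + f(u0,v0). Equality of \<Phi> and \<Psi> on v = v0 and their value at the
      base point leave only the first term.\<close>
    show "sqrt (coeff_E z (u, v)) = exp ((LBINT s=v0..v. integrand_v z (u, s)) +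
        (LBINT t=u0..u. integrand_u z (t, v0)) + inv_f z (u0, v0))"
      unfolding cong_v[OF corners(1) uv] cong_u[OF U(2) corners(1)] sq(1)[OF uv] inv_f[OF U(2)]
      using ax1[OF R'[OF corners(1)]] ax1[OF R(2)] P0 pos'(1)[OF uv] by simp
    show "sqrt (- coeff_G z (u, v)) = exp ((LBINT t=u0..u. integrand_u z (t, v)) +
        (LBINT s=v0..v. integrand_v z (u0, s)) + inv_f z (u0, v0))"
      unfolding cong_u[OF corners(2) uv] cong_v[OF U(2) corners(2)] sq(2)[OF uv] inv_f[OF U(2)]
      using ax2[OF R'[OF corners(2)]] P0 pos'(3)[OF uv] by simp
  qed (use U EG L N in auto)
  ultimately have "canonical_surface_with_invariants u0 v0 a \<alpha> U z"
    unfolding canonical_surface_with_invariants_def by blast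
  then show ?thesis using U(3) by blast
qed

end

section \<open>Uniqueness of the surface\<close>

text \<open>For both signs \<epsilon>, the function c exp (\<kappa> r) - \<epsilon> g r is
  nondecreasing and starts at c, which is nonnegative. Integration of the weighted derivative bound
  thus gains the factor 1 / \<kappa>.\<close>

lemma exp_growth_bound:
  fixes g :: "real \<Rightarrow> real"
  assumes c: "c \<ge> 0" and t: "t \<ge> 0" and g0: "g 0 = 0"
    and g: "\<And>r. 0 \<le> r \<Longrightarrow> r \<le> t \<Longrightarrow> (g has_real_derivative g' r) (at r)"
    and g': "\<And>r. 0 \<le> r \<Longrightarrow> r \<le> t \<Longrightarrow> \<bar>g' r\<bar> \<le> c * \<kappa> * exp (\<kappa> * r)"
  shows "\<bar>g t\<bar> \<le> c * exp (\<kappa> * t)"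
proof -
  have "c * exp (\<kappa> * 0) - \<epsilon> * g 0 \<le> c * exp (\<kappa> * t) - \<epsilon> * g t" if \<epsilon>: "\<epsilon> = 1 \<or> \<epsilon> = - 1" for \<epsilon> :: real
  proof (rule DERIV_nonneg_imp_nondecreasing[OF t])
    fix r assume r: "0 \<le> r" "r \<le> t"
    have "((\<lambda>r. c * exp (\<kappa> * r) - \<epsilon> * g r) has_real_derivative c * \<kappa> * exp (\<kappa> * r) - \<epsilon> * g' r) (at r)"
      using g[OF r] by (auto intro!: derivative_eq_intros)
    moreover have "0 \<le> c * \<kappa> * exp (\<kappa> * r) - \<epsilon> * g' r"
      using g'[OF r] \<epsilon> by auto
    ultimately show "\<exists>y. ((\<lambda>r. c * exp (\<kappa> * r) - \<epsilon> * g r) has_real_derivative y) (at r) \<and> 0 \<le> y"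
      by blast
  qed
  from this[of 1] this[of "- 1"] show ?thesis using c g0 by simp
qed

text \<open>A weighted supremum bound: with \<open>N = sup (\<bar>X\<bar> + \<bar>Y\<bar>) exp (- \<kappa> (s + t))\<close> on the unit
  square, integration gives \<open>N \<le> N / 2\<close> as soon as \<open>\<kappa>\<close> is large.\<close>

lemma goursat_unique:
  fixes X Y :: "real \<times> real \<Rightarrow> real"
  assumes U: "open_rectangle U" "(u0, v0) \<in> U"
    and cont: "continuous_on U X" "continuous_on U Y"
      "continuous_on U c1" "continuous_on U c2" "continuous_on U c3" "continuous_on U c4"
    and X: "\<And>u v. (u, v) \<in> U \<Longrightarrow>
      ((\<lambda>s. X (u, s)) has_real_derivative c1 (u, v) * X (u, v) + c2 (u, v) * Y (u, v)) (at v)"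
    and Y: "\<And>u v. (u, v) \<in> U \<Longrightarrow>
      ((\<lambda>t. Y (t, v)) has_real_derivative c3 (u, v) * X (u, v) + c4 (u, v) * Y (u, v)) (at u)"
    and X0: "\<And>u. (u, v0) \<in> U \<Longrightarrow> X (u, v0) = 0" and Y0: "\<And>v. (u0, v) \<in> U \<Longrightarrow> Y (u0, v) = 0"
    and p: "(u, v) \<in> U"
  shows "X (u, v) = 0 \<and> Y (u, v) = 0"
proof -
  \<comment> \<open>The affine map of the unit square onto the box between (u0, v0) and (u, v). It
    makes the four possible positions of (u, v) relative to the base point one case, with the side
    lengths and signs moved into the coefficients.\<close>
  define \<gamma> where "\<gamma> q = (u0 + fst q * (u - u0), v0 + snd q * (v - v0))" for q :: "real \<times> real"
  define Q where "Q = {0..1::real} \<times> {0..1::real}"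
  have \<gamma>_U: "\<gamma> q \<in> U" if "q \<in> Q" for q
  proof -
    have "u0 + fst q * (u - u0) \<in> {min u0 u..max u0 u}" "v0 + snd q * (v - v0) \<in> {min v0 v..max v0 v}"
      using that segment_point_mem[of u0 "min u0 u" "max u0 u" u "fst q"]
        segment_point_mem[of v0 "min v0 v" "max v0 v" v "snd q"]
      by (auto simp: Q_def)
    then show ?thesis using rectangle_box_subset[OF U p] by (auto simp: \<gamma>_def)
  qed
  have cont_\<gamma>: "continuous_on Q (\<lambda>q. h (\<gamma> q))" if "continuous_on U h" for h :: "real \<times> real \<Rightarrow> real"
    by (rule continuous_on_compose2[OF that])
       (use \<gamma>_U in \<open>auto simp: \<gamma>_def intro!: continuous_intros\<close>)
  have Q: "compact Q" "Q \<noteq> {}" by (auto simp: Q_def intro: compact_Times)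
  let ?m = "\<lambda>q. \<bar>v - v0\<bar> * (\<bar>c1 (\<gamma> q)\<bar> + \<bar>c2 (\<gamma> q)\<bar>) + \<bar>u - u0\<bar> * (\<bar>c3 (\<gamma> q)\<bar> + \<bar>c4 (\<gamma> q)\<bar>)"
  have "continuous_on Q ?m"
    using cont(3-6)[THEN cont_\<gamma>] by (intro continuous_intros)
  from continuous_attains_sup[OF Q this] obtain C0 where C0: "\<And>q. q \<in> Q \<Longrightarrow> ?m q \<le> C0" by blast
  define C where "C = max C0 1"
  have C: "C > 0" by (simp add: C_def)
  \<comment> \<open>The derivatives of both unknowns are at most C N times the weight, so this rate
    yields N / 4 for each of them and N / 2 for their sum.\<close>
  define \<kappa> where "\<kappa> = 4 * C"
  have lam: "\<kappa> > 0" using C by (simp add: \<kappa>_def)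
  let ?S = "\<lambda>q. \<bar>X (\<gamma> q)\<bar> + \<bar>Y (\<gamma> q)\<bar>"
  have bound: "\<bar>v - v0\<bar> * \<bar>c1 (\<gamma> q) * X (\<gamma> q) + c2 (\<gamma> q) * Y (\<gamma> q)\<bar> \<le> C * ?S q"
    "\<bar>u - u0\<bar> * \<bar>c3 (\<gamma> q) * X (\<gamma> q) + c4 (\<gamma> q) * Y (\<gamma> q)\<bar> \<le> C * ?S q" if "q \<in> Q" for q
  proof -
    have lin: "\<bar>d * x + e * y\<bar> \<le> (\<bar>d\<bar> + \<bar>e\<bar>) * (\<bar>x\<bar> + \<bar>y\<bar>)" for d e x y :: real
    proof -
      have "\<bar>d * x + e * y\<bar> \<le> \<bar>d\<bar> * \<bar>x\<bar> + \<bar>e\<bar> * \<bar>y\<bar>"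
        using abs_triangle_ineq[of "d * x" "e * y"] by (simp add: abs_mult)
      also have "\<dots> \<le> (\<bar>d\<bar> + \<bar>e\<bar>) * (\<bar>x\<bar> + \<bar>y\<bar>)" by (simp add: algebra_simps)
      finally show ?thesis .
    qed
    have m: "?m q \<le> C" unfolding C_def by (rule order_trans[OF C0[OF that] max.cobounded1])
    have "0 \<le> \<bar>v - v0\<bar> * (\<bar>c1 (\<gamma> q)\<bar> + \<bar>c2 (\<gamma> q)\<bar>)" "0 \<le> \<bar>u - u0\<bar> * (\<bar>c3 (\<gamma> q)\<bar> + \<bar>c4 (\<gamma> q)\<bar>)" by simp_all
    with m have le: "\<bar>v - v0\<bar> * (\<bar>c1 (\<gamma> q)\<bar> + \<bar>c2 (\<gamma> q)\<bar>) \<le> C" "\<bar>u - u0\<bar> * (\<bar>c3 (\<gamma> q)\<bar> + \<bar>c4 (\<gamma> q)\<bar>) \<le> C"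
      by linarith+
    have S: "?S q \<ge> 0" by simp
    have "\<bar>v - v0\<bar> * \<bar>c1 (\<gamma> q) * X (\<gamma> q) + c2 (\<gamma> q) * Y (\<gamma> q)\<bar> \<le> \<bar>v - v0\<bar> * ((\<bar>c1 (\<gamma> q)\<bar> + \<bar>c2 (\<gamma> q)\<bar>) * ?S q)"
      by (intro mult_left_mono lin) simp
    also have "\<dots> \<le> C * ?S q" using mult_right_mono[OF le(1) S] by (simp add: mult.assoc)
    finally show "\<bar>v - v0\<bar> * \<bar>c1 (\<gamma> q) * X (\<gamma> q) + c2 (\<gamma> q) * Y (\<gamma> q)\<bar> \<le> C * ?S q" .
    have "\<bar>u - u0\<bar> * \<bar>c3 (\<gamma> q) * X (\<gamma> q) + c4 (\<gamma> q) * Y (\<gamma> q)\<bar> \<le> \<bar>u - u0\<bar> * ((\<bar>c3 (\<gamma> q)\<bar> + \<bar>c4 (\<gamma> q)\<bar>) * ?S q)"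
      by (intro mult_left_mono lin) simp
    also have "\<dots> \<le> C * ?S q" using mult_right_mono[OF le(2) S] by (simp add: mult.assoc)
    finally show "\<bar>u - u0\<bar> * \<bar>c3 (\<gamma> q) * X (\<gamma> q) + c4 (\<gamma> q) * Y (\<gamma> q)\<bar> \<le> C * ?S q" .
  qed
  have "continuous_on Q (\<lambda>q. ?S q * exp (- \<kappa> * (fst q + snd q)))"
    using cont(1,2)[THEN cont_\<gamma>] by (intro continuous_intros)
  from continuous_attains_sup[OF Q this] obtain q0 where q0: "q0 \<in> Q"
    and max: "\<And>q. q \<in> Q \<Longrightarrow> ?S q * exp (- \<kappa> * (fst q + snd q)) \<le> ?S q0 * exp (- \<kappa> * (fst q0 + snd q0))"
    by blast
  define N where "N = ?S q0 * exp (- \<kappa> * (fst q0 + snd q0))"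
  have N0: "N \<ge> 0" by (simp add: N_def)
  have S_le: "?S q \<le> N * exp (\<kappa> * (fst q + snd q))" if "q \<in> Q" for q
  proof -
    have "?S q = ?S q * exp (- \<kappa> * (fst q + snd q)) * exp (\<kappa> * (fst q + snd q))"
      by (simp add: mult.assoc exp_add[symmetric])
    also have "\<dots> \<le> N * exp (\<kappa> * (fst q + snd q))"
      unfolding N_def by (intro mult_right_mono max that) simp
    finally show ?thesis .
  qed
  have "N \<le> N / 2"
  proof -
    obtain s t where st: "q0 = (s, t)" "0 \<le> s" "s \<le> 1" "0 \<le> t" "t \<le> 1" using q0 by (auto simp: Q_def)
    have "\<bar>X (\<gamma> (s, t))\<bar> \<le> (N / 4 * exp (\<kappa> * s)) * exp (\<kappa> * t)"
    proof (rule exp_growth_bound[where g = "\<lambda>r. X (\<gamma> (s, r))" and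
          g' = "\<lambda>r. (c1 (\<gamma> (s, r)) * X (\<gamma> (s, r)) + c2 (\<gamma> (s, r)) * Y (\<gamma> (s, r))) * (v - v0)"])
      have "\<gamma> (s, 0) \<in> U" using st by (intro \<gamma>_U) (simp add: Q_def)
      then show "X (\<gamma> (s, 0)) = 0" using X0 by (simp add: \<gamma>_def)
      fix r assume r: "0 \<le> r" "r \<le> t"
      then have Qr: "(s, r) \<in> Q" using st by (simp add: Q_def)
      have "((\<lambda>r. v0 + r * (v - v0)) has_real_derivative (v - v0)) (at r)"
        by (auto intro!: derivative_eq_intros)
      from DERIV_chain2[OF X[OF \<gamma>_U[OF Qr, unfolded \<gamma>_def fst_conv snd_conv]] this]
      show "((\<lambda>r. X (\<gamma> (s, r))) has_real_derivative
          (c1 (\<gamma> (s, r)) * X (\<gamma> (s, r)) + c2 (\<gamma> (s, r)) * Y (\<gamma> (s, r))) * (v - v0)) (at r)"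
        by (simp add: \<gamma>_def)
      have "\<bar>(c1 (\<gamma> (s, r)) * X (\<gamma> (s, r)) + c2 (\<gamma> (s, r)) * Y (\<gamma> (s, r))) * (v - v0)\<bar> \<le> C * ?S (s, r)"
        using bound(1)[OF Qr] by (simp add: abs_mult mult.commute)
      also have "\<dots> \<le> C * (N * exp (\<kappa> * (s + r)))"
        using S_le[OF Qr] C by (intro mult_left_mono) simp_all
      also have "\<dots> = N / 4 * exp (\<kappa> * s) * \<kappa> * exp (\<kappa> * r)"
        by (simp add: \<kappa>_def distrib_left exp_add)
      finally show "\<bar>(c1 (\<gamma> (s, r)) * X (\<gamma> (s, r)) + c2 (\<gamma> (s, r)) * Y (\<gamma> (s, r))) * (v - v0)\<bar>
          \<le> N / 4 * exp (\<kappa> * s) * \<kappa> * exp (\<kappa> * r)" .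
    qed (use st N0 in auto)
    moreover have "\<bar>Y (\<gamma> (s, t))\<bar> \<le> (N / 4 * exp (\<kappa> * t)) * exp (\<kappa> * s)"
    proof (rule exp_growth_bound[where g = "\<lambda>r. Y (\<gamma> (r, t))" and
          g' = "\<lambda>r. (c3 (\<gamma> (r, t)) * X (\<gamma> (r, t)) + c4 (\<gamma> (r, t)) * Y (\<gamma> (r, t))) * (u - u0)"])
      have "\<gamma> (0, t) \<in> U" using st by (intro \<gamma>_U) (simp add: Q_def)
      then show "Y (\<gamma> (0, t)) = 0" using Y0 by (simp add: \<gamma>_def)
      fix r assume r: "0 \<le> r" "r \<le> s"
      then have Qr: "(r, t) \<in> Q" using st by (simp add: Q_def)
      have "((\<lambda>r. u0 + r * (u - u0)) has_real_derivative (u - u0)) (at r)"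
        by (auto intro!: derivative_eq_intros)
      from DERIV_chain2[OF Y[OF \<gamma>_U[OF Qr, unfolded \<gamma>_def fst_conv snd_conv]] this]
      show "((\<lambda>r. Y (\<gamma> (r, t))) has_real_derivative
          (c3 (\<gamma> (r, t)) * X (\<gamma> (r, t)) + c4 (\<gamma> (r, t)) * Y (\<gamma> (r, t))) * (u - u0)) (at r)"
        by (simp add: \<gamma>_def)
      have "\<bar>(c3 (\<gamma> (r, t)) * X (\<gamma> (r, t)) + c4 (\<gamma> (r, t)) * Y (\<gamma> (r, t))) * (u - u0)\<bar> \<le> C * ?S (r, t)"
        using bound(2)[OF Qr] by (simp add: abs_mult mult.commute)
      also have "\<dots> \<le> C * (N * exp (\<kappa> * (r + t)))"
        using S_le[OF Qr] C by (intro mult_left_mono) simp_all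
      also have "\<dots> = N / 4 * exp (\<kappa> * t) * \<kappa> * exp (\<kappa> * r)"
        by (simp add: \<kappa>_def distrib_left exp_add)
      finally show "\<bar>(c3 (\<gamma> (r, t)) * X (\<gamma> (r, t)) + c4 (\<gamma> (r, t)) * Y (\<gamma> (r, t))) * (u - u0)\<bar>
          \<le> N / 4 * exp (\<kappa> * t) * \<kappa> * exp (\<kappa> * r)" .
    qed (use st N0 in auto)
    ultimately have "?S q0 \<le> N / 2 * exp (\<kappa> * (s + t))"
      by (simp add: st(1) distrib_left exp_add algebra_simps)
    then have "?S q0 * exp (- \<kappa> * (s + t)) \<le> N / 2 * exp (\<kappa> * (s + t)) * exp (- \<kappa> * (s + t))"
      by (intro mult_right_mono) simp_all
    then show ?thesis by (simp add: N_def st(1) mult.assoc exp_add[symmetric])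
  qed
  with N0 have "N = 0" by linarith
  moreover have "(1, 1) \<in> Q" "\<gamma> (1, 1) = (u, v)" by (simp_all add: Q_def \<gamma>_def)
  ultimately have "\<bar>X (u, v)\<bar> + \<bar>Y (u, v)\<bar> \<le> 0" using S_le[of "(1, 1)"] by simp
  then show ?thesis by linarith
qed

section \<open>The adapted frame of a given surface and its equations\<close>

text \<open>The Euclidean cross product with its third entry negated. This is the Lorentzian vector
  product, whose scalar product with w is the determinant of x, y, w.\<close>

definition lorentz_cross :: "real ^ 3 \<Rightarrow> real ^ 3 \<Rightarrow> real ^ 3" where
  "lorentz_cross x y = vector [x $ 2 * y $ 3 - x $ 3 * y $ 2, x $ 3 * y $ 1 - x $ 1 * y $ 3,
     x $ 2 * y $ 1 - x $ 1 * y $ 2]"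

lemma bounded_bilinear_lorentz_cross: "bounded_bilinear lorentz_cross"
proof -
  have "bilinear lorentz_cross"
    unfolding bilinear_def lorentz_cross_def
    by (auto intro!: linearI simp: vec_eq_iff forall_3 algebra_simps)
  then show ?thesis by (simp add: bilinear_conv_bounded_bilinear)
qed

text \<open>The Lorentzian Lagrange identity gives the length of the cross product. The determinant
  is its scalar product with itself.\<close>

lemma lorentz_frame_cross:
  assumes "lorentz e1 e1 = 1" "lorentz e2 e2 = - 1" "lorentz e1 e2 = 0"
  shows "lorentz_frame e1 e2 (lorentz_cross e1 e2)"
    and "det (vector [e1, e2, lorentz_cross e1 e2] :: real ^ 3 ^ 3) = 1"
proof -
  let ?n = "lorentz_cross e1 e2"
  have "lorentz ?n ?n = (lorentz e1 e2)\<^sup>2 - lorentz e1 e1 * lorentz e2 e2"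
    by (simp add: lorentz_def lorentz_cross_def power2_eq_square algebra_simps)
  then have nn: "lorentz ?n ?n = 1" by (simp add: assms)
  have "lorentz e1 ?n = 0" "lorentz e2 ?n = 0"
    by (simp_all add: lorentz_def lorentz_cross_def algebra_simps)
  then show "lorentz_frame e1 e2 ?n" using nn assms by (simp add: lorentz_frame_def)
  have "det (vector [e1, e2, ?n] :: real ^ 3 ^ 3) = lorentz ?n ?n"
    by (simp add: det_3 lorentz_def lorentz_cross_def algebra_simps)
  then show "det (vector [e1, e2, ?n] :: real ^ 3 ^ 3) = 1" using nn by simp
qed

text \<open>Turns a relation that holds throughout \<open>U\<close> into its differentiated form:
  partials computed by the product rule must vanish.\<close>

lemma has_partials_constant_on:
  assumes "has_partials g gu gv p" "open U" "p \<in> U" "\<And>q. q \<in> U \<Longrightarrow> g q = c"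
  shows "gu = 0" "gv = 0"
proof -
  have h: "has_partials (\<lambda>_. c) gu gv p" by (rule has_partials_transform[OF assms])
  show "gu = 0" "gv = 0"
    using partial_u_eq[OF h] partial_v_eq[OF h] partial_u_eq[OF has_partials_const, of c p]
      partial_v_eq[OF has_partials_const, of c p] by simp_all
qed

text \<open>The hypotheses \<open>d\<close> are the frame relations differentiated in one direction,
  so three of the nine components of the derivatives determine the rest. The minus sign at
  \<open>x3\<close> arises because the e2 component of a vector is minus its product with
  e2.\<close>

lemma lorentz_frame_derivative:
  assumes fr: "lorentz_frame e1 e2 n"
    and d: "lorentz d1 e1 = 0" "lorentz d2 e2 = 0" "lorentz d3 n = 0"
      "lorentz d1 e2 + lorentz e1 d2 = 0" "lorentz d1 n + lorentz e1 d3 = 0" "lorentz d2 n + lorentz e2 d3 = 0"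
    and x: "lorentz d1 e2 = - x3" "lorentz d1 n = x4" "lorentz d2 n = x5"
  shows "d1 = x3 *\<^sub>R e2 + x4 *\<^sub>R n" "d2 = x3 *\<^sub>R e1 + x5 *\<^sub>R n" "d3 = x5 *\<^sub>R e2 - x4 *\<^sub>R e1"
proof -
  have c: "lorentz d2 e1 = x3" "lorentz d3 e1 = - x4" "lorentz d3 e2 = - x5"
    using d(4-6) x by (simp_all add: lorentz_commute)
  show "d1 = x3 *\<^sub>R e2 + x4 *\<^sub>R n"
    using lorentz_frame_expansion[OF fr, of d1] by (simp add: d x)
  show "d2 = x3 *\<^sub>R e1 + x5 *\<^sub>R n"
    using lorentz_frame_expansion[OF fr, of d2] by (simp add: d x c)
  show "d3 = x5 *\<^sub>R e2 - x4 *\<^sub>R e1"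
    using lorentz_frame_expansion[OF fr, of d3] by (simp add: d x c)
qed

text \<open>On a given surface all coefficients of the frame equations are forced: the normal parts
  by L, M and N, the tangential parts by comparing two expressions for z_uv. The zero coefficient
  expresses L = 0 and is kept to match the general form of the system.\<close>

lemma surface_frame_system:
  fixes z :: "real \<times> real \<Rightarrow> real ^ 3" and \<phi> g h M :: "real \<times> real \<Rightarrow> real"
  assumes U: "open U" "smooth_on U z" "smooth_on U \<phi>" "smooth_on U g" "smooth_on U h"
    and frame_smooth: "smooth_on U e1" "smooth_on U e2" "smooth_on U n"
    and fr: "\<And>p. p \<in> U \<Longrightarrow> lorentz_frame (e1 p) (e2 p) (n p)"
    and pos: "\<And>p. p \<in> U \<Longrightarrow> \<phi> p \<noteq> 0" "\<And>p. p \<in> U \<Longrightarrow> h p \<noteq> 0"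
    and zu: "\<And>p. p \<in> U \<Longrightarrow> \<partial>\<^sub>u z p = \<phi> p *\<^sub>R e1 p"
    and zv: "\<And>p. p \<in> U \<Longrightarrow> \<partial>\<^sub>v z p = g p *\<^sub>R e1 p + h p *\<^sub>R e2 p"
    and LMN: "\<And>p. p \<in> U \<Longrightarrow> lorentz (n p) (\<partial>\<^sub>u (\<partial>\<^sub>u z) p) = 0"
      "\<And>p. p \<in> U \<Longrightarrow> lorentz (n p) (\<partial>\<^sub>v (\<partial>\<^sub>u z) p) = M p"
      "\<And>p. p \<in> U \<Longrightarrow> lorentz (n p) (\<partial>\<^sub>v (\<partial>\<^sub>v z) p) = 0"
    and p: "p \<in> U"
  defines "x3 \<equiv> \<lambda>p. (\<partial>\<^sub>v \<phi> p - \<partial>\<^sub>u g p) / h p"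
  defines "y3 \<equiv> \<lambda>p. (\<partial>\<^sub>u h p + g p * x3 p) / \<phi> p" and "y4 \<equiv> \<lambda>p. M p / \<phi> p" and "x5 \<equiv> \<lambda>p. M p / h p"
  defines "y5 \<equiv> \<lambda>p. - g p * y4 p / h p"
  shows "has_partials e1 (x3 p *\<^sub>R e2 p + 0 *\<^sub>R n p) (y3 p *\<^sub>R e2 p + y4 p *\<^sub>R n p) p"
    and "has_partials e2 (x3 p *\<^sub>R e1 p + x5 p *\<^sub>R n p) (y3 p *\<^sub>R e1 p + y5 p *\<^sub>R n p) p"
    and "has_partials n (x5 p *\<^sub>R e2 p - 0 *\<^sub>R e1 p) (y5 p *\<^sub>R e2 p - y4 p *\<^sub>R e1 p) p"
proof -
  note H = smooth_on_has_partials[OF U(1) _ p]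
  note e1 = H[OF frame_smooth(1)] and e2 = H[OF frame_smooth(2)] and n = H[OF frame_smooth(3)]
  note \<phi> = H[OF U(3)] and g = H[OF U(4)] and h = H[OF U(5)]
  have lor: "lorentz (e1 p) (e1 p) = 1" "lorentz (e2 p) (e2 p) = - 1" "lorentz (n p) (n p) = 1"
    "lorentz (e1 p) (e2 p) = 0" "lorentz (e1 p) (n p) = 0" "lorentz (e2 p) (n p) = 0"
    "lorentz (e2 p) (e1 p) = 0" "lorentz (n p) (e1 p) = 0" "lorentz (n p) (e2 p) = 0"
    using fr[OF p] by (simp_all add: lorentz_frame_def lorentz_commute)
  have c: "lorentz (e1 q) (e1 q) = 1" "lorentz (e2 q) (e2 q) = - 1" "lorentz (n q) (n q) = 1"
    "lorentz (e1 q) (e2 q) = 0" "lorentz (e1 q) (n q) = 0" "lorentz (e2 q) (n q) = 0" if "q \<in> U" for q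
    using fr[OF that] by (simp_all add: lorentz_frame_def)
  note d11 = has_partials_constant_on[OF lorentz.has_partials[OF e1 e1] U(1) p c(1)]
    and d22 = has_partials_constant_on[OF lorentz.has_partials[OF e2 e2] U(1) p c(2)]
    and d33 = has_partials_constant_on[OF lorentz.has_partials[OF n n] U(1) p c(3)]
    and d12 = has_partials_constant_on[OF lorentz.has_partials[OF e1 e2] U(1) p c(4)]
    and d13 = has_partials_constant_on[OF lorentz.has_partials[OF e1 n] U(1) p c(5)]
    and d23 = has_partials_constant_on[OF lorentz.has_partials[OF e2 n] U(1) p c(6)]
  have self: "lorentz (\<partial>\<^sub>u e1 p) (e1 p) = 0" "lorentz (\<partial>\<^sub>v e1 p) (e1 p) = 0"
    "lorentz (\<partial>\<^sub>u e2 p) (e2 p) = 0" "lorentz (\<partial>\<^sub>v e2 p) (e2 p) = 0"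
    "lorentz (\<partial>\<^sub>u n p) (n p) = 0" "lorentz (\<partial>\<^sub>v n p) (n p) = 0"
    using d11 d22 d33 lorentz_commute[of "e1 p"] lorentz_commute[of "e2 p"] lorentz_commute[of "n p"] by simp_all
  have zuu: "\<partial>\<^sub>u (\<partial>\<^sub>u z) p = \<partial>\<^sub>u \<phi> p *\<^sub>R e1 p + \<phi> p *\<^sub>R \<partial>\<^sub>u e1 p"
    and zuv: "\<partial>\<^sub>v (\<partial>\<^sub>u z) p = \<partial>\<^sub>v \<phi> p *\<^sub>R e1 p + \<phi> p *\<^sub>R \<partial>\<^sub>v e1 p"
  proof -
    note k = has_partials_scaleR[OF \<phi> e1]
    have "\<partial>\<^sub>u (\<partial>\<^sub>u z) p = \<partial>\<^sub>u (\<lambda>p. \<phi> p *\<^sub>R e1 p) p" "\<partial>\<^sub>v (\<partial>\<^sub>u z) p = \<partial>\<^sub>v (\<lambda>p. \<phi> p *\<^sub>R e1 p) p"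
      by (rule partial_cong[OF U(1) p], rule zu, assumption)+
    then show "\<partial>\<^sub>u (\<partial>\<^sub>u z) p = \<partial>\<^sub>u \<phi> p *\<^sub>R e1 p + \<phi> p *\<^sub>R \<partial>\<^sub>u e1 p"
      "\<partial>\<^sub>v (\<partial>\<^sub>u z) p = \<partial>\<^sub>v \<phi> p *\<^sub>R e1 p + \<phi> p *\<^sub>R \<partial>\<^sub>v e1 p"
      using partial_u_eq[OF k] partial_v_eq[OF k] by simp_all
  qed
  \<comment> \<open>Computed from z_v and rewritten by symmetry of the mixed partials; together with
    \<open>zuv\<close> this gives the two expressions for z_uv.\<close>
  have zvu: "\<partial>\<^sub>v (\<partial>\<^sub>u z) p = (\<partial>\<^sub>u g p *\<^sub>R e1 p + g p *\<^sub>R \<partial>\<^sub>u e1 p) + (\<partial>\<^sub>u h p *\<^sub>R e2 p + h p *\<^sub>R \<partial>\<^sub>u e2 p)"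
    and zvv: "\<partial>\<^sub>v (\<partial>\<^sub>v z) p = (\<partial>\<^sub>v g p *\<^sub>R e1 p + g p *\<^sub>R \<partial>\<^sub>v e1 p) + (\<partial>\<^sub>v h p *\<^sub>R e2 p + h p *\<^sub>R \<partial>\<^sub>v e2 p)"
  proof -
    note k = has_partials_add[OF has_partials_scaleR[OF g e1] has_partials_scaleR[OF h e2]]
    have "\<partial>\<^sub>u (\<partial>\<^sub>v z) p = \<partial>\<^sub>u (\<lambda>p. g p *\<^sub>R e1 p + h p *\<^sub>R e2 p) p"
      "\<partial>\<^sub>v (\<partial>\<^sub>v z) p = \<partial>\<^sub>v (\<lambda>p. g p *\<^sub>R e1 p + h p *\<^sub>R e2 p) p"
      by (rule partial_cong[OF U(1) p], rule zv, assumption)+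
    then show "\<partial>\<^sub>v (\<partial>\<^sub>u z) p = (\<partial>\<^sub>u g p *\<^sub>R e1 p + g p *\<^sub>R \<partial>\<^sub>u e1 p) + (\<partial>\<^sub>u h p *\<^sub>R e2 p + h p *\<^sub>R \<partial>\<^sub>u e2 p)"
      "\<partial>\<^sub>v (\<partial>\<^sub>v z) p = (\<partial>\<^sub>v g p *\<^sub>R e1 p + g p *\<^sub>R \<partial>\<^sub>v e1 p) + (\<partial>\<^sub>v h p *\<^sub>R e2 p + h p *\<^sub>R \<partial>\<^sub>v e2 p)"
      using partial_u_eq[OF k] partial_v_eq[OF k] mixed_partials_commute[OF U(1) p U(2)] by simp_all
  qed
  have \<phi>0: "\<phi> p \<noteq> 0" and h0: "h p \<noteq> 0" using pos p by blast+
  have c4u: "lorentz (\<partial>\<^sub>u e1 p) (n p) = 0"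
    using LMN(1)[OF p] \<phi>0 by (simp add: zuu lorentz_simps lor lorentz_commute[of "n p"])
  have c4v: "lorentz (\<partial>\<^sub>v e1 p) (n p) = y4 p"
    using LMN(2)[OF p] \<phi>0 by (simp add: zuv lorentz_simps lor lorentz_commute[of "n p"] y4_def field_simps)
  have c5u: "lorentz (\<partial>\<^sub>u e2 p) (n p) = x5 p"
    using LMN(2)[OF p] h0 c4u by (simp add: zvu lorentz_simps lor lorentz_commute[of "n p"] x5_def field_simps)
  have "g p * y4 p + h p * lorentz (\<partial>\<^sub>v e2 p) (n p) = 0"
    using LMN(3)[OF p] c4v by (simp add: zvv lorentz_simps lor lorentz_commute[of "n p"])
  then have c5v: "lorentz (\<partial>\<^sub>v e2 p) (n p) = y5 p"
    using h0 by (simp add: y5_def field_simps)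
  have mixed: "\<partial>\<^sub>v \<phi> p *\<^sub>R e1 p + \<phi> p *\<^sub>R \<partial>\<^sub>v e1 p =
      (\<partial>\<^sub>u g p *\<^sub>R e1 p + g p *\<^sub>R \<partial>\<^sub>u e1 p) + (\<partial>\<^sub>u h p *\<^sub>R e2 p + h p *\<^sub>R \<partial>\<^sub>u e2 p)"
    using zuv zvu by simp
  \<comment> \<open>Pairing the two expressions for z_uv with e1 determines the rotation of the
    frame in u; pairing with e2 below determines it in v.\<close>
  have "\<partial>\<^sub>v \<phi> p = \<partial>\<^sub>u g p + h p * lorentz (\<partial>\<^sub>u e2 p) (e1 p)"
    using arg_cong[OF mixed, of "\<lambda>w. lorentz w (e1 p)"] by (simp add: lorentz_simps lor self)
  then have "lorentz (\<partial>\<^sub>u e2 p) (e1 p) = x3 p" using h0 by (simp add: x3_def)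
  then have c3u: "lorentz (\<partial>\<^sub>u e1 p) (e2 p) = - x3 p"
    using d12(1) lorentz_commute[of "e1 p"] by simp
  have "\<phi> p * lorentz (\<partial>\<^sub>v e1 p) (e2 p) = - (\<partial>\<^sub>u h p + g p * x3 p)"
    using arg_cong[OF mixed, of "\<lambda>w. lorentz w (e2 p)"] by (simp add: lorentz_simps lor self c3u)
  then have c3v: "lorentz (\<partial>\<^sub>v e1 p) (e2 p) = - y3 p"
    using \<phi>0 by (simp add: y3_def field_simps)
  note du = lorentz_frame_derivative[OF fr[OF p] self(1,3,5) d12(1) d13(1) d23(1) c3u c4u c5u]
  note dv = lorentz_frame_derivative[OF fr[OF p] self(2,4,6) d12(2) d13(2) d23(2) c3v c4v c5v]
  show "has_partials e1 (x3 p *\<^sub>R e2 p + 0 *\<^sub>R n p) (y3 p *\<^sub>R e2 p + y4 p *\<^sub>R n p) p"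
    using e1 du(1) dv(1) by simp
  show "has_partials e2 (x3 p *\<^sub>R e1 p + x5 p *\<^sub>R n p) (y3 p *\<^sub>R e1 p + y5 p *\<^sub>R n p) p"
    using e2 du(2) dv(2) by simp
  show "has_partials n (x5 p *\<^sub>R e2 p - 0 *\<^sub>R e1 p) (y5 p *\<^sub>R e2 p - y4 p *\<^sub>R e1 p) p"
    using n du(3) dv(3) by simp
qed

text \<open>In the derivative of \<open>T p q\<close> the terms cancel in pairs, because both frames
  have the same skew coefficients. The constant map then sends z_u and z_v to w_u and w_v, so only a
  translation remains.\<close>

lemma congruent_frames_motion:
  fixes z w e1 e2 n e1' e2' n' :: "real \<times> real \<Rightarrow> real ^ 3"
  assumes U: "convex U" "p0 \<in> U"
    and frame: "\<And>p. p \<in> U \<Longrightarrow> lorentz_frame (e1 p) (e2 p) (n p)"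
      "\<And>p. p \<in> U \<Longrightarrow> lorentz_frame (e1' p) (e2' p) (n' p)"
    and det: "det (vector [e1 p0, e2 p0, n p0] :: real ^ 3 ^ 3) = 1"
      "det (vector [e1' p0, e2' p0, n' p0] :: real ^ 3 ^ 3) = 1"
    and e1: "\<And>p. p \<in> U \<Longrightarrow> has_partials e1 (x3 p *\<^sub>R e2 p + x4 p *\<^sub>R n p) (y3 p *\<^sub>R e2 p + y4 p *\<^sub>R n p) p"
    and e2: "\<And>p. p \<in> U \<Longrightarrow> has_partials e2 (x3 p *\<^sub>R e1 p + x5 p *\<^sub>R n p) (y3 p *\<^sub>R e1 p + y5 p *\<^sub>R n p) p"
    and n: "\<And>p. p \<in> U \<Longrightarrow> has_partials n (x5 p *\<^sub>R e2 p - x4 p *\<^sub>R e1 p) (y5 p *\<^sub>R e2 p - y4 p *\<^sub>R e1 p) p"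
    and e1': "\<And>p. p \<in> U \<Longrightarrow> has_partials e1' (x3 p *\<^sub>R e2' p + x4 p *\<^sub>R n' p) (y3 p *\<^sub>R e2' p + y4 p *\<^sub>R n' p) p"
    and e2': "\<And>p. p \<in> U \<Longrightarrow> has_partials e2' (x3 p *\<^sub>R e1' p + x5 p *\<^sub>R n' p) (y3 p *\<^sub>R e1' p + y5 p *\<^sub>R n' p) p"
    and n': "\<And>p. p \<in> U \<Longrightarrow> has_partials n' (x5 p *\<^sub>R e2' p - x4 p *\<^sub>R e1' p) (y5 p *\<^sub>R e2' p - y4 p *\<^sub>R e1' p) p"
    and z: "\<And>p. p \<in> U \<Longrightarrow> has_partials z (\<phi> p *\<^sub>R e1 p) (g p *\<^sub>R e1 p + h p *\<^sub>R e2 p) p"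
    and w: "\<And>p. p \<in> U \<Longrightarrow> has_partials w (\<phi> p *\<^sub>R e1' p) (g p *\<^sub>R e1' p + h p *\<^sub>R e2' p) p"
  shows "\<exists>T. motion T \<and> (\<forall>p\<in>U. w p = T (z p))"
proof -
  define T where "T p q = lorentz q (e1 p) *\<^sub>R e1' p - lorentz q (e2 p) *\<^sub>R e2' p + lorentz q (n p) *\<^sub>R n' p" for p q
  define A where "A = T p0"
  have T_const: "T p q = A q" if p: "p \<in> U" for p q
    unfolding A_def
  proof (rule partials_zero_imp_constant[OF U(1) _ p U(2)])
    fix p assume p: "p \<in> U"
    note l = bounded_linear.has_partials[OF lorentz.bounded_linear_right, of _ _ _ _ q]
    show "has_partials (\<lambda>p. T p q) 0 0 p"
      unfolding T_def
      using has_partials_add[OF has_partials_diff[OF has_partials_scaleR[OF l[OF e1[OF p]] e1'[OF p]]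
            has_partials_scaleR[OF l[OF e2[OF p]] e2'[OF p]]] has_partials_scaleR[OF l[OF n[OF p]] n'[OF p]]]
      by (simp add: lorentz_simps algebra_simps)
  qed
  have A_frame: "A (e1 p) = e1' p" "A (e2 p) = e2' p" "A (n p) = n' p" if p: "p \<in> U" for p
    using frame(1)[OF p] unfolding T_const[OF p, symmetric]
    by (simp_all add: T_def lorentz_frame_def lorentz_commute[of "e2 p" "e1 p"] lorentz_commute[of "n p" "e1 p"]
        lorentz_commute[of "n p" "e2 p"])
  have linear_A: "linear A"
    unfolding A_def T_def by (intro linearI) (simp_all add: lorentz_simps algebra_simps)
  \<comment> \<open>Orthonormality of the target frame reduces the left-hand side to products of
    coordinates in the source frame, which the frame expansion reassembles.\<close>
  have iso: "lorentz (A x) (A y) = lorentz x y" for x y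
  proof -
    have "lorentz (A x) (A y) = lorentz x (e1 p0) * lorentz y (e1 p0) - lorentz x (e2 p0) * lorentz y (e2 p0)
        + lorentz x (n p0) * lorentz y (n p0)"
      using frame(2)[OF U(2)] unfolding A_def T_def lorentz_frame_def
      by (simp add: lorentz_simps lorentz_commute[of "e2' p0" "e1' p0"] lorentz_commute[of "n' p0" "e1' p0"]
          lorentz_commute[of "n' p0" "e2' p0"])
    also have "\<dots> = lorentz x (lorentz y (e1 p0) *\<^sub>R e1 p0 - lorentz y (e2 p0) *\<^sub>R e2 p0 + lorentz y (n p0) *\<^sub>R n p0)"
      by (simp add: lorentz_simps)
    also have "\<dots> = lorentz x y" using lorentz_frame_expansion[OF frame(1)[OF U(2)], of y] by simp
    finally show ?thesis .
  qed
  have "det (matrix A) = 1"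
  proof -
    have Ax: "A x $ i = matrix A $ i $ 1 * x $ 1 + matrix A $ i $ 2 * x $ 2 + matrix A $ i $ 3 * x $ 3" for x i
    proof -
      have "A x $ i = (matrix A *v x) $ i" by (simp add: matrix_works linear_A)
      also have "\<dots> = matrix A $ i $ 1 * x $ 1 + matrix A $ i $ 2 * x $ 2 + matrix A $ i $ 3 * x $ 3"
        by (simp only: matrix_vector_mult_def sum_3 vec_lambda_beta)
      finally show ?thesis .
    qed
    \<comment> \<open>As a matrix identity, the map sends the columns of one frame to those of the
      other. Both frames have determinant 1, hence so does the map.\<close>
    have col: "matrix A ** transpose (vector [x, y, v] :: real ^ 3 ^ 3) = transpose (vector [A x, A y, A v])"
      for x y v :: "real ^ 3"
      by (simp add: vec_eq_iff forall_3 matrix_matrix_mult_def transpose_def sum_3 Ax)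
    have "det (matrix A) * det (vector [e1 p0, e2 p0, n p0] :: real ^ 3 ^ 3) = det (vector [e1' p0, e2' p0, n' p0] :: real ^ 3 ^ 3)"
      using arg_cong[OF col[of "e1 p0" "e2 p0" "n p0"], of det]
      by (simp add: det_mul A_frame[OF U(2)])
    then show ?thesis by (simp add: det)
  qed
  moreover have "w p - A (z p) = w p0 - A (z p0)" if p: "p \<in> U" for p
  proof (rule partials_zero_imp_constant[OF U(1) _ p U(2)])
    fix p assume p: "p \<in> U"
    have "bounded_linear A" using linear_A by (simp add: linear_conv_bounded_linear)
    from has_partials_diff[OF w[OF p] bounded_linear.has_partials[OF this z[OF p]]]
    show "has_partials (\<lambda>p. w p - A (z p)) 0 0 p"
      by (simp add: linear_add[OF linear_A] linear_scale[OF linear_A] A_frame[OF p])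
  qed
  then have "w p = A (z p) + (w p0 - A (z p0))" if "p \<in> U" for p
    using that by (simp add: algebra_simps)
  ultimately show ?thesis
    using linear_A iso unfolding motion_def by blast
qed

section \<open>Consequences of canonical parameters\<close>

text \<open>The closed interval [l, r] is taken halfway towards \<open>a\<close> and
  \<open>b\<close>, so that it lies in the domain of continuity and has \<open>x\<close> in its
  interior. The one-sided fundamental theorem then gives a two-sided derivative.\<close>

lemma interval_integral_has_real_derivative:
  fixes g :: "real \<Rightarrow> real"
  assumes g: "continuous_on {a<..<b} g" and c: "c \<in> {a<..<b}" and x: "x \<in> {a<..<b}"
  shows "((\<lambda>x. LBINT y=c..x. g y) has_real_derivative g x) (at x)"
proof -
  define l r where "l = (a + min c x) / 2" and "r = (b + max c x) / 2"
  have lr: "a < l" "l < c" "l < x" "c < r" "x < r" "r < b"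
    using c x by (auto simp: l_def r_def min_def max_def)
  have "continuous_on {l..r} g"
    by (rule continuous_on_subset[OF g]) (use lr in auto)
  then have "((\<lambda>x. LBINT y=c..x. g y) has_vector_derivative g x) (at x within {l..r})"
    using lr by (intro interval_integral_FTC2) auto
  moreover have "at x within {l..r} = at x"
    using lr by (intro at_within_interior) auto
  ultimately show ?thesis by (simp add: has_real_derivative_iff_has_vector_derivative)
qed

text \<open>F and M are recovered from the invariants and the metric roots. With L = N = 0, both
  fundamental forms are thus expressed by \<open>a\<close>, \<alpha>, E and G.\<close>

lemma canonical_surface_metric:
  assumes S: "canonical_surface_with_invariants u0 v0 a \<alpha> U z"
  shows "open_rectangle U" "(u0, v0) \<in> U" "smooth_on U z"
    and "smooth_on U (\<lambda>p. sqrt (coeff_E z p))" "smooth_on U (\<lambda>p. sqrt (- coeff_G z p))"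
    and "\<And>p. p \<in> U \<Longrightarrow> coeff_E z p > 0" "\<And>p. p \<in> U \<Longrightarrow> coeff_G z p < 0"
    and "\<And>p. p \<in> U \<Longrightarrow> coeff_F z p = a p * (sqrt (coeff_E z p) * sqrt (- coeff_G z p))"
    and "\<And>p. p \<in> U \<Longrightarrow> coeff_M z p = \<alpha> p * (sqrt (coeff_E z p) * sqrt (- coeff_G z p))"
    and "\<And>p. p \<in> U \<Longrightarrow> coeff_L z p = 0" "\<And>p. p \<in> U \<Longrightarrow> coeff_N z p = 0"
proof -
  note defs = canonical_surface_with_invariants_def timelike_surface_def regular_surface_def
    canonical_asymptotic_parameters_def asymptotic_parameters_def
  show rect: "open_rectangle U" "(u0, v0) \<in> U" and z: "smooth_on U z"
    and EG: "\<And>p. p \<in> U \<Longrightarrow> coeff_E z p > 0" "\<And>p. p \<in> U \<Longrightarrow> coeff_G z p < 0"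
    and "\<And>p. p \<in> U \<Longrightarrow> coeff_L z p = 0" "\<And>p. p \<in> U \<Longrightarrow> coeff_N z p = 0"
    using S unfolding defs by blast+
  have inv: "inv_a z p = a p" "inv_alpha z p = \<alpha> p" if "p \<in> U" for p
    using S that unfolding defs by blast+
  have "sqrt (coeff_E z p) * sqrt (- coeff_G z p) \<noteq> 0" if "p \<in> U" for p
    using EG[OF that] by simp
  then show "coeff_F z p = a p * (sqrt (coeff_E z p) * sqrt (- coeff_G z p))"
    "coeff_M z p = \<alpha> p * (sqrt (coeff_E z p) * sqrt (- coeff_G z p))" if "p \<in> U" for p
    using inv[OF that, symmetric] that by (simp_all add: inv_a_def inv_alpha_def)
  note oU = open_rectangle_open[OF rect(1)]
  have "smooth_on U (\<lambda>p. lorentz (\<partial>\<^sub>u z p) (\<partial>\<^sub>u z p))" "smooth_on U (\<lambda>p. - lorentz (\<partial>\<^sub>v z p) (\<partial>\<^sub>v z p))"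
    by (intro smooth_on_minus lorentz.smooth_on oU smooth_on_partial_u smooth_on_partial_v z)+
  then have "smooth_on U (coeff_E z)" "smooth_on U (\<lambda>p. - coeff_G z p)"
    by (simp_all add: coeff_E_def[abs_def] coeff_G_def)
  then show "smooth_on U (\<lambda>p. sqrt (coeff_E z p))" "smooth_on U (\<lambda>p. sqrt (- coeff_G z p))"
    using EG by (auto intro: smooth_on_sqrt[OF oU])
qed

text \<open>Gram-Schmidt applied to z_u and z_v, completed by the cross product. The explicit
  formula makes the normal smooth, which cannot be read off from the definite description in
  \<open>unit_normal\<close>.\<close>

lemma canonical_surface_frame:
  fixes a \<alpha> \<phi> \<psi> \<sigma> :: "real \<times> real \<Rightarrow> real"
  assumes S: "canonical_surface_with_invariants u0 v0 a \<alpha> U z"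
    and a: "smooth_on U a" and \<sigma>: "smooth_on U \<sigma>" "\<And>p. \<sigma> p > 0" "\<And>p. (\<sigma> p)\<^sup>2 = 1 + (a p)\<^sup>2"
    and smooth: "smooth_on U \<phi>" "smooth_on U \<psi>"
    and EG: "\<And>p. p \<in> U \<Longrightarrow> sqrt (coeff_E z p) = \<phi> p" "\<And>p. p \<in> U \<Longrightarrow> sqrt (- coeff_G z p) = \<psi> p"
  obtains e1 e2 n where "smooth_on U e1" "smooth_on U e2" "smooth_on U n"
    "\<And>p. p \<in> U \<Longrightarrow> lorentz_frame (e1 p) (e2 p) (n p)"
    "\<And>p. p \<in> U \<Longrightarrow> det (vector [e1 p, e2 p, n p] :: real ^ 3 ^ 3) = 1"
    "\<And>p. p \<in> U \<Longrightarrow> \<partial>\<^sub>u z p = \<phi> p *\<^sub>R e1 p"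
    "\<And>p. p \<in> U \<Longrightarrow> \<partial>\<^sub>v z p = (a p * \<psi> p) *\<^sub>R e1 p + (\<sigma> p * \<psi> p) *\<^sub>R e2 p"
    "\<And>p. p \<in> U \<Longrightarrow> lorentz (n p) (\<partial>\<^sub>u (\<partial>\<^sub>u z) p) = 0"
    "\<And>p. p \<in> U \<Longrightarrow> lorentz (n p) (\<partial>\<^sub>v (\<partial>\<^sub>u z) p) = \<alpha> p * (\<phi> p * \<psi> p)"
    "\<And>p. p \<in> U \<Longrightarrow> lorentz (n p) (\<partial>\<^sub>v (\<partial>\<^sub>v z) p) = 0"
proof -
  note m = canonical_surface_metric[OF S]
  note oU = open_rectangle_open[OF m(1)]
  have pos: "\<phi> p > 0" "\<psi> p > 0" "\<sigma> p * \<psi> p > 0" if "p \<in> U" for p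
    using m(6,7)[OF that] \<sigma>(2)[of p] EG[OF that, symmetric] by simp_all
  define e1 where "e1 p = (1 / \<phi> p) *\<^sub>R \<partial>\<^sub>u z p" for p
  define e2 where "e2 p = (1 / (\<sigma> p * \<psi> p)) *\<^sub>R (\<partial>\<^sub>v z p - (a p * \<psi> p) *\<^sub>R e1 p)" for p
  define n where "n p = lorentz_cross (e1 p) (e2 p)" for p
  have ne: "\<phi> p \<noteq> 0" "\<sigma> p * \<psi> p \<noteq> 0" if "p \<in> U" for p
    using pos[OF that] less_imp_neq[OF \<sigma>(2)[of p]] by auto
  have sm1: "smooth_on U e1"
    unfolding e1_def[abs_def]
    by (intro smooth_on_scaleR smooth_on_divide smooth_on_const smooth_on_partial_u oU m(3) smooth ne)
  have sm2: "smooth_on U e2"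
    unfolding e2_def[abs_def]
    by (intro smooth_on_scaleR smooth_on_divide smooth_on_const smooth_on_partial_v smooth_on_diff
        smooth_on_mult oU m(3) smooth ne sm1 a \<sigma>)
  have sm3: "smooth_on U n"
    unfolding n_def[abs_def]
    by (rule bounded_bilinear.smooth_on[OF bounded_bilinear_lorentz_cross oU sm1 sm2])
  have zu: "\<partial>\<^sub>u z p = \<phi> p *\<^sub>R e1 p" if "p \<in> U" for p using ne[OF that] by (simp add: e1_def)
  have zv: "\<partial>\<^sub>v z p = (a p * \<psi> p) *\<^sub>R e1 p + (\<sigma> p * \<psi> p) *\<^sub>R e2 p" if "p \<in> U" for p
    using ne[OF that] by (simp add: e2_def)
  have fr: "lorentz_frame (e1 p) (e2 p) (n p)" "det (vector [e1 p, e2 p, n p] :: real ^ 3 ^ 3) = 1"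
    if p: "p \<in> U" for p
  proof -
    have E: "lorentz (\<partial>\<^sub>u z p) (\<partial>\<^sub>u z p) = (\<phi> p)\<^sup>2" and G: "lorentz (\<partial>\<^sub>v z p) (\<partial>\<^sub>v z p) = - (\<psi> p)\<^sup>2"
      using m(6,7)[OF p] EG[OF p, symmetric] by (simp_all add: coeff_E_def coeff_G_def)
    have F: "lorentz (\<partial>\<^sub>u z p) (\<partial>\<^sub>v z p) = a p * (\<phi> p * \<psi> p)"
      using m(8)[OF p] EG[OF p] by (simp add: coeff_F_def)
    have 1: "lorentz (e1 p) (e1 p) = 1"
      using E ne[OF p] by (simp add: e1_def lorentz_simps power2_eq_square)
    have F1: "lorentz (e1 p) (\<partial>\<^sub>v z p) = a p * \<psi> p"
      using F ne[OF p] by (simp add: e1_def lorentz_simps)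
    define w where "w = \<partial>\<^sub>v z p - (a p * \<psi> p) *\<^sub>R e1 p"
    have e2w: "e2 p = (1 / (\<sigma> p * \<psi> p)) *\<^sub>R w" by (simp add: e2_def w_def)
    have "lorentz (e1 p) w = 0" using F1 1 by (simp add: w_def lorentz_simps)
    then have 2: "lorentz (e1 p) (e2 p) = 0" by (simp add: e2w lorentz_simps)
    \<comment> \<open>Removing the e1 component adds - (a \<psi>)^2 to the square - \<psi>^2 of z_v.
      This is why \<sigma> \<psi> is the normalizing factor of e2.\<close>
    have "lorentz w w = - (\<psi> p)\<^sup>2 - (a p)\<^sup>2 * (\<psi> p)\<^sup>2"
      using F1 1 G by (simp add: w_def lorentz_simps lorentz_commute[of "\<partial>\<^sub>v z p" "e1 p"] power2_eq_square algebra_simps)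
    also have "\<dots> = - ((\<sigma> p * \<psi> p) * (\<sigma> p * \<psi> p))"
      using \<sigma>(3)[of p] by (simp add: power2_eq_square algebra_simps)
    finally have "lorentz (e2 p) (e2 p) = - 1"
      using ne[OF p] by (simp add: e2w lorentz_simps)
    from lorentz_frame_cross[OF 1 this 2]
    show "lorentz_frame (e1 p) (e2 p) (n p)" "det (vector [e1 p, e2 p, n p] :: real ^ 3 ^ 3) = 1"
      by (simp_all add: n_def)
  qed
  have un: "unit_normal z p = n p" if "p \<in> U" for p
    by (rule unit_normal_eq[OF fr(1)[OF that] zu[OF that] zv[OF that] pos(1,3)[OF that]])
       (simp add: fr(2)[OF that])
  show thesis
  proof (rule that[OF sm1 sm2 sm3 fr zu zv])
    fix p assume p: "p \<in> U"
    show "lorentz (n p) (\<partial>\<^sub>u (\<partial>\<^sub>u z) p) = 0" "lorentz (n p) (\<partial>\<^sub>v (\<partial>\<^sub>v z) p) = 0"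
      "lorentz (n p) (\<partial>\<^sub>v (\<partial>\<^sub>u z) p) = \<alpha> p * (\<phi> p * \<psi> p)"
      using m(9-11)[OF p] EG[OF p] by (simp_all add: coeff_L_def coeff_M_def coeff_N_def un[OF p])
  qed
qed

text \<open>In the formula for \<phi> only the first integral depends on v, and in the formula for
  \<psi> only the first depends on u. Differentiating these gives a linear system whose coefficients
  come from \<open>a\<close> and \<open>f\<close> alone; on the axes the ratio disappears and the
  data are explicit.\<close>

lemma canonical_surface_goursat:
  fixes a \<alpha> f :: "real \<times> real \<Rightarrow> real"
  assumes S: "canonical_surface_with_invariants u0 v0 a \<alpha> U z"
    and smooth: "smooth_on U a" "smooth_on U f"
    and alpha_pos: "\<forall>p\<in>U. \<alpha> p > 0"
    and f: "f = (\<lambda>p. (ln (sqrt (1 + (a p)\<^sup>2)) - ln (\<alpha> p)) / 2)"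
  defines "\<phi> \<equiv> \<lambda>p. sqrt (coeff_E z p)" and "\<psi> \<equiv> \<lambda>p. sqrt (- coeff_G z p)"
  shows "(u, v) \<in> U \<Longrightarrow> ((\<lambda>s. \<phi> (u, s)) has_real_derivative
      \<partial>\<^sub>v f (u, v) * \<phi> (u, v) + (a (u, v) * \<partial>\<^sub>u f (u, v)) * \<psi> (u, v)) (at v)"
    and "(u, v) \<in> U \<Longrightarrow> ((\<lambda>t. \<psi> (t, v)) has_real_derivative
      (- a (u, v) * \<partial>\<^sub>v f (u, v)) * \<phi> (u, v) + \<partial>\<^sub>u f (u, v) * \<psi> (u, v)) (at u)"
    and "(u, v0) \<in> U \<Longrightarrow> \<phi> (u, v0) =
      exp ((LBINT t=u0..u. - a (t, v0) * \<partial>\<^sub>v f (t, v0) + \<partial>\<^sub>u f (t, v0)) + f (u0, v0))"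
    and "(u0, v) \<in> U \<Longrightarrow> \<psi> (u0, v) =
      exp ((LBINT s=v0..v. \<partial>\<^sub>v f (u0, s) + a (u0, s) * \<partial>\<^sub>u f (u0, s)) + f (u0, v0))"
proof -
  note m = canonical_surface_metric[OF S]
  note oU = open_rectangle_open[OF m(1)]
  obtain u1 u2 v1 v2 where U: "U = {u1<..<u2} \<times> {v1<..<v2}"
    using m(1) unfolding open_rectangle_def by blast
  have uv0: "u0 \<in> {u1<..<u2}" "v0 \<in> {v1<..<v2}" using m(2) U by auto
  have pos: "\<phi> p > 0" "\<psi> p > 0" if "p \<in> U" for p
    using m(6,7)[OF that] by (simp_all add: \<phi>_def \<psi>_def)
  have inv: "inv_a z p = a p" "inv_alpha z p = \<alpha> p" if "p \<in> U" for p
    using S that unfolding canonical_surface_with_invariants_def by blast+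
  have inv_f: "inv_f z p = f p" if "p \<in> U" for p
    using bspec[OF alpha_pos that] by (simp add: inv_f_def inv[OF that] f)
  have int_v: "integrand_v z p = \<partial>\<^sub>v f p + a p * \<partial>\<^sub>u f p * (\<psi> p / \<phi> p)"
    and int_u: "integrand_u z p = - a p * \<partial>\<^sub>v f p * (\<phi> p / \<psi> p) + \<partial>\<^sub>u f p" if p: "p \<in> U" for p
    using partial_cong[OF oU p inv_f]
    by (simp_all add: integrand_v_def integrand_u_def inv[OF p] \<phi>_def \<psi>_def)
  have cont: "continuous_on U a" "continuous_on U (\<partial>\<^sub>u f)" "continuous_on U (\<partial>\<^sub>v f)"
    "continuous_on U \<phi>" "continuous_on U \<psi>"
    unfolding \<phi>_def \<psi>_def by (intro smooth_on_continuous smooth_on_partial_u smooth_on_partial_v smooth m)+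
  have ne: "\<forall>p\<in>U. \<phi> p \<noteq> 0" "\<forall>p\<in>U. \<psi> p \<noteq> 0" using pos by force+
  have "continuous_on U (\<lambda>p. \<partial>\<^sub>v f p + a p * \<partial>\<^sub>u f p * (\<psi> p / \<phi> p))"
    "continuous_on U (\<lambda>p. - a p * \<partial>\<^sub>v f p * (\<phi> p / \<psi> p) + \<partial>\<^sub>u f p)"
    by (intro continuous_on_add continuous_on_mult continuous_on_minus continuous_on_divide cont ne)+
  then have cont_int: "continuous_on U (integrand_v z)" "continuous_on U (integrand_u z)"
    using int_v int_u by (simp_all cong: continuous_on_cong)
  have can: "\<phi> (u, v) = exp ((LBINT s=v0..v. integrand_v z (u, s)) + (LBINT t=u0..u. integrand_u z (t, v0)) + f (u0, v0))"
    "\<psi> (u, v) = exp ((LBINT t=u0..u. integrand_u z (t, v)) + (LBINT s=v0..v. integrand_v z (u0, s)) + f (u0, v0))"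
    if "(u, v) \<in> U" for u v
    using S that inv_f[OF m(2)]
    unfolding canonical_surface_with_invariants_def canonical_asymptotic_parameters_def \<phi>_def \<psi>_def by auto
  show "((\<lambda>s. \<phi> (u, s)) has_real_derivative
      \<partial>\<^sub>v f (u, v) * \<phi> (u, v) + (a (u, v) * \<partial>\<^sub>u f (u, v)) * \<psi> (u, v)) (at v)" if uv: "(u, v) \<in> U"
  proof -
    have mem: "v \<in> {v1<..<v2}" "\<And>s. s \<in> {v1<..<v2} \<Longrightarrow> (u, s) \<in> U" using uv U by auto
    let ?I = "\<lambda>v. (LBINT s=v0..v. integrand_v z (u, s)) + (LBINT t=u0..u. integrand_u z (t, v0)) + f (u0, v0)"
    have "((\<lambda>v. LBINT s=v0..v. integrand_v z (u, s)) has_real_derivative integrand_v z (u, v)) (at v)"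
      by (rule interval_integral_has_real_derivative[OF continuous_on_slice_v[OF cont_int(1) mem(2)] uv0(2) mem(1)])
    then have "((\<lambda>v. exp (?I v)) has_real_derivative exp (?I v) * integrand_v z (u, v)) (at v)"
      by (auto intro!: derivative_eq_intros)
    moreover have "exp (?I v) * integrand_v z (u, v) =
        \<partial>\<^sub>v f (u, v) * \<phi> (u, v) + (a (u, v) * \<partial>\<^sub>u f (u, v)) * \<psi> (u, v)"
      using pos(1)[OF uv] unfolding can(1)[OF uv, symmetric] int_v[OF uv] by (simp add: field_simps)
    ultimately have "((\<lambda>v. exp (?I v)) has_real_derivative
        \<partial>\<^sub>v f (u, v) * \<phi> (u, v) + (a (u, v) * \<partial>\<^sub>u f (u, v)) * \<psi> (u, v)) (at v)" by simp
    then show ?thesis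
      by (rule has_field_derivative_transform_within_open[OF _ _ mem(1)]) (use can(1)[OF mem(2)] in auto)
  qed
  show "((\<lambda>t. \<psi> (t, v)) has_real_derivative
      (- a (u, v) * \<partial>\<^sub>v f (u, v)) * \<phi> (u, v) + \<partial>\<^sub>u f (u, v) * \<psi> (u, v)) (at u)" if uv: "(u, v) \<in> U"
  proof -
    have mem: "u \<in> {u1<..<u2}" "\<And>t. t \<in> {u1<..<u2} \<Longrightarrow> (t, v) \<in> U" using uv U by auto
    let ?I = "\<lambda>u. (LBINT t=u0..u. integrand_u z (t, v)) + (LBINT s=v0..v. integrand_v z (u0, s)) + f (u0, v0)"
    have "((\<lambda>u. LBINT t=u0..u. integrand_u z (t, v)) has_real_derivative integrand_u z (u, v)) (at u)"
      by (rule interval_integral_has_real_derivative[OF continuous_on_slice_u[OF cont_int(2) mem(2)] uv0(1) mem(1)])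
    then have "((\<lambda>u. exp (?I u)) has_real_derivative exp (?I u) * integrand_u z (u, v)) (at u)"
      by (auto intro!: derivative_eq_intros)
    moreover have "exp (?I u) * integrand_u z (u, v) =
        (- a (u, v) * \<partial>\<^sub>v f (u, v)) * \<phi> (u, v) + \<partial>\<^sub>u f (u, v) * \<psi> (u, v)"
      using pos(2)[OF uv] unfolding can(2)[OF uv, symmetric] int_u[OF uv] by (simp add: field_simps)
    ultimately have "((\<lambda>u. exp (?I u)) has_real_derivative
        (- a (u, v) * \<partial>\<^sub>v f (u, v)) * \<phi> (u, v) + \<partial>\<^sub>u f (u, v) * \<psi> (u, v)) (at u)" by simp
    then show ?thesis
      by (rule has_field_derivative_transform_within_open[OF _ _ mem(1)]) (use can(2)[OF mem(2)] in auto)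
  qed
  show "\<phi> (u, v0) = exp ((LBINT t=u0..u. - a (t, v0) * \<partial>\<^sub>v f (t, v0) + \<partial>\<^sub>u f (t, v0)) + f (u0, v0))"
    if u: "(u, v0) \<in> U"
  proof -
    have "(LBINT t=u0..u. integrand_u z (t, v0)) = (LBINT t=u0..u. - a (t, v0) * \<partial>\<^sub>v f (t, v0) + \<partial>\<^sub>u f (t, v0))"
    proof (rule interval_integral_cong)
      fix t assume "t \<in> einterval (min (ereal u0) (ereal u)) (max (ereal u0) (ereal u))"
      then have "t \<in> {min u0 u..max u0 u}" by (auto simp: einterval_def min_def max_def split: if_splits)
      then have t: "(t, v0) \<in> U" using rectangle_box_subset[OF m(1) m(2) u] by auto
      \<comment> \<open>For v = v0 the integrals in v are empty and both exponents become the same,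
        so the ratio in the integrand equals 1. The analogous step on u = u0 follows below.\<close>
      have "\<phi> (t, v0) = \<psi> (t, v0)" using can[OF t] by simp
      then show "integrand_u z (t, v0) = - a (t, v0) * \<partial>\<^sub>v f (t, v0) + \<partial>\<^sub>u f (t, v0)"
        using int_u[OF t] pos(2)[OF t] by simp
    qed
    then show ?thesis using can(1)[OF u] by simp
  qed
  show "\<psi> (u0, v) = exp ((LBINT s=v0..v. \<partial>\<^sub>v f (u0, s) + a (u0, s) * \<partial>\<^sub>u f (u0, s)) + f (u0, v0))"
    if v: "(u0, v) \<in> U"
  proof -
    have "(LBINT s=v0..v. integrand_v z (u0, s)) = (LBINT s=v0..v. \<partial>\<^sub>v f (u0, s) + a (u0, s) * \<partial>\<^sub>u f (u0, s))"
    proof (rule interval_integral_cong)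
      fix s assume "s \<in> einterval (min (ereal v0) (ereal v)) (max (ereal v0) (ereal v))"
      then have "s \<in> {min v0 v..max v0 v}" by (auto simp: einterval_def min_def max_def split: if_splits)
      then have s: "(u0, s) \<in> U" using rectangle_box_subset[OF m(1) m(2) v] by auto
      have "\<phi> (u0, s) = \<psi> (u0, s)" using can[OF s] by simp
      then show "integrand_v z (u0, s) = \<partial>\<^sub>v f (u0, s) + a (u0, s) * \<partial>\<^sub>u f (u0, s)"
        using int_v[OF s] pos(1)[OF s] by simp
    qed
    then show ?thesis using can(2)[OF v] by simp
  qed
qed

theorem canonical_surface_unique:
  fixes a \<alpha> :: "real \<times> real \<Rightarrow> real"
  assumes z: "canonical_surface_with_invariants u0 v0 a \<alpha> U z"
    and w: "canonical_surface_with_invariants u0 v0 a \<alpha> U w"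
    and smooth: "smooth_on U a" "smooth_on U \<alpha>" and alpha_pos: "\<And>p. p \<in> U \<Longrightarrow> \<alpha> p > 0"
  shows "\<exists>T. motion T \<and> (\<forall>p\<in>U. w p = T (z p))"
proof -
  note mz = canonical_surface_metric[OF z] and mw = canonical_surface_metric[OF w]
  note oU = open_rectangle_open[OF mz(1)]
  define \<sigma> where "\<sigma> p = sqrt (1 + (a p)\<^sup>2)" for p
  define f where "f = (\<lambda>p. (ln (sqrt (1 + (a p)\<^sup>2)) - ln (\<alpha> p)) / 2)"
  have sigma: "\<sigma> p > 0" "(\<sigma> p)\<^sup>2 = 1 + (a p)\<^sup>2" for p
    unfolding \<sigma>_def by (simp_all add: add_pos_nonneg)
  have smooth_\<sigma>: "smooth_on U \<sigma>"
    unfolding \<sigma>_def[abs_def]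
    by (intro smooth_on_sqrt smooth_on_add smooth_on_const smooth_on_power oU smooth(1)) (simp add: add_pos_nonneg)
  have "smooth_on U (\<lambda>p. (ln (\<sigma> p) - ln (\<alpha> p)) / 2)"
    by (intro smooth_on_divide smooth_on_diff smooth_on_ln smooth_on_const oU smooth smooth_\<sigma>)
       (simp_all add: sigma alpha_pos)
  then have smooth_f: "smooth_on U f" by (simp add: f_def \<sigma>_def)
  define \<phi> where "\<phi> p = sqrt (coeff_E z p)" for p
  define \<psi> where "\<psi> p = sqrt (- coeff_G z p)" for p
  define \<phi>' where "\<phi>' p = sqrt (coeff_E w p)" for p
  define \<psi>' where "\<psi>' p = sqrt (- coeff_G w p)" for p
  have alpha_pos': "\<forall>p\<in>U. \<alpha> p > 0" using alpha_pos by blast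
  note Gz = canonical_surface_goursat[OF z smooth(1) smooth_f alpha_pos' f_def, folded \<phi>_def \<psi>_def]
  note Gw = canonical_surface_goursat[OF w smooth(1) smooth_f alpha_pos' f_def, folded \<phi>'_def \<psi>'_def]
  have smooth_\<phi>\<psi>: "smooth_on U \<phi>" "smooth_on U \<psi>" "smooth_on U \<phi>'" "smooth_on U \<psi>'"
    unfolding \<phi>_def[abs_def] \<psi>_def[abs_def] \<phi>'_def[abs_def] \<psi>'_def[abs_def] by (rule mz mw)+
  \<comment> \<open>By linearity the differences of the metric roots solve the homogeneous problem
    with zero data on the axes.\<close>
  have eq: "\<phi> (u, v) - \<phi>' (u, v) = 0 \<and> \<psi> (u, v) - \<psi>' (u, v) = 0" if uv: "(u, v) \<in> U" for u v
  proof (rule goursat_unique[OF mz(1,2), where ?c1.0 = "\<partial>\<^sub>v f" and ?c2.0 = "\<lambda>p. a p * \<partial>\<^sub>u f p"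
        and ?c3.0 = "\<lambda>p. - a p * \<partial>\<^sub>v f p" and ?c4.0 = "\<partial>\<^sub>u f" and X = "\<lambda>p. \<phi> p - \<phi>' p" and Y = "\<lambda>p. \<psi> p - \<psi>' p"])
    show "continuous_on U (\<lambda>p. \<phi> p - \<phi>' p)" "continuous_on U (\<lambda>p. \<psi> p - \<psi>' p)" "continuous_on U (\<partial>\<^sub>v f)"
      "continuous_on U (\<lambda>p. a p * \<partial>\<^sub>u f p)" "continuous_on U (\<lambda>p. - a p * \<partial>\<^sub>v f p)" "continuous_on U (\<partial>\<^sub>u f)"
      by (intro smooth_on_continuous smooth_on_diff smooth_on_mult smooth_on_minus smooth_on_partial_u
          smooth_on_partial_v oU smooth_\<phi>\<psi> smooth_f smooth)+
    fix u v
    show "((\<lambda>s. \<phi> (u, s) - \<phi>' (u, s)) has_real_derivative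
        \<partial>\<^sub>v f (u, v) * (\<phi> (u, v) - \<phi>' (u, v)) + a (u, v) * \<partial>\<^sub>u f (u, v) * (\<psi> (u, v) - \<psi>' (u, v))) (at v)"
      if "(u, v) \<in> U"
      using DERIV_diff[OF Gz(1)[OF that] Gw(1)[OF that]] by (simp add: algebra_simps)
    show "((\<lambda>t. \<psi> (t, v) - \<psi>' (t, v)) has_real_derivative
        - a (u, v) * \<partial>\<^sub>v f (u, v) * (\<phi> (u, v) - \<phi>' (u, v)) + \<partial>\<^sub>u f (u, v) * (\<psi> (u, v) - \<psi>' (u, v))) (at u)"
      if "(u, v) \<in> U"
      using DERIV_diff[OF Gz(2)[OF that] Gw(2)[OF that]] by (simp add: algebra_simps)
    show "\<phi> (u, v0) - \<phi>' (u, v0) = 0" if "(u, v0) \<in> U" using Gz(3)[OF that] Gw(3)[OF that] by simp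
    show "\<psi> (u0, v) - \<psi>' (u0, v) = 0" if "(u0, v) \<in> U" using Gz(4)[OF that] Gw(4)[OF that] by simp
  qed (rule uv)
  \<comment> \<open>From here on \<phi> and \<psi> serve for both surfaces; the second frame is
    built with them as well.\<close>
  have eq_w: "sqrt (coeff_E w p) = \<phi> p" "sqrt (- coeff_G w p) = \<psi> p" if "p \<in> U" for p
    using eq[of "fst p" "snd p"] that by (simp_all add: \<phi>'_def \<psi>'_def)
  have pos: "\<phi> p \<noteq> 0" "\<sigma> p * \<psi> p \<noteq> 0" if "p \<in> U" for p
    using mz(6,7)[OF that] sigma(1)[of p] by (simp_all add: \<phi>_def \<psi>_def)
  obtain e1 e2 n where e: "smooth_on U e1" "smooth_on U e2" "smooth_on U n"
    and fr: "\<And>p. p \<in> U \<Longrightarrow> lorentz_frame (e1 p) (e2 p) (n p)"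
    and det: "\<And>p. p \<in> U \<Longrightarrow> det (vector [e1 p, e2 p, n p] :: real ^ 3 ^ 3) = 1"
    and zu: "\<And>p. p \<in> U \<Longrightarrow> \<partial>\<^sub>u z p = \<phi> p *\<^sub>R e1 p"
    and zv: "\<And>p. p \<in> U \<Longrightarrow> \<partial>\<^sub>v z p = (a p * \<psi> p) *\<^sub>R e1 p + (\<sigma> p * \<psi> p) *\<^sub>R e2 p"
    and LMN: "\<And>p. p \<in> U \<Longrightarrow> lorentz (n p) (\<partial>\<^sub>u (\<partial>\<^sub>u z) p) = 0"
      "\<And>p. p \<in> U \<Longrightarrow> lorentz (n p) (\<partial>\<^sub>v (\<partial>\<^sub>u z) p) = \<alpha> p * (\<phi> p * \<psi> p)"
      "\<And>p. p \<in> U \<Longrightarrow> lorentz (n p) (\<partial>\<^sub>v (\<partial>\<^sub>v z) p) = 0"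
    by (rule canonical_surface_frame[OF z smooth(1) smooth_\<sigma> sigma smooth_\<phi>\<psi>(1,2)])
       (simp_all add: \<phi>_def \<psi>_def)
  obtain e1' e2' n' where e': "smooth_on U e1'" "smooth_on U e2'" "smooth_on U n'"
    and fr': "\<And>p. p \<in> U \<Longrightarrow> lorentz_frame (e1' p) (e2' p) (n' p)"
    and det': "\<And>p. p \<in> U \<Longrightarrow> det (vector [e1' p, e2' p, n' p] :: real ^ 3 ^ 3) = 1"
    and wu: "\<And>p. p \<in> U \<Longrightarrow> \<partial>\<^sub>u w p = \<phi> p *\<^sub>R e1' p"
    and wv: "\<And>p. p \<in> U \<Longrightarrow> \<partial>\<^sub>v w p = (a p * \<psi> p) *\<^sub>R e1' p + (\<sigma> p * \<psi> p) *\<^sub>R e2' p"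
    and LMN': "\<And>p. p \<in> U \<Longrightarrow> lorentz (n' p) (\<partial>\<^sub>u (\<partial>\<^sub>u w) p) = 0"
      "\<And>p. p \<in> U \<Longrightarrow> lorentz (n' p) (\<partial>\<^sub>v (\<partial>\<^sub>u w) p) = \<alpha> p * (\<phi> p * \<psi> p)"
      "\<And>p. p \<in> U \<Longrightarrow> lorentz (n' p) (\<partial>\<^sub>v (\<partial>\<^sub>v w) p) = 0"
    by (rule canonical_surface_frame[OF w smooth(1) smooth_\<sigma> sigma smooth_\<phi>\<psi>(1,2)]) (simp_all add: eq_w)
  have gh: "smooth_on U (\<lambda>p. a p * \<psi> p)" "smooth_on U (\<lambda>p. \<sigma> p * \<psi> p)"
    by (intro smooth_on_mult oU smooth smooth_\<sigma> smooth_\<phi>\<psi>)+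
  \<comment> \<open>These coefficients contain only \<open>a\<close>, \<alpha>, \<sigma>, \<phi>,
    \<psi> and their partials, hence they are literally the same functions for both frames.\<close>
  define x3 where "x3 p = (\<partial>\<^sub>v \<phi> p - \<partial>\<^sub>u (\<lambda>p. a p * \<psi> p) p) / (\<sigma> p * \<psi> p)" for p
  define y3 where "y3 p = (\<partial>\<^sub>u (\<lambda>p. \<sigma> p * \<psi> p) p + (a p * \<psi> p) * x3 p) / \<phi> p" for p
  define y4 where "y4 p = \<alpha> p * (\<phi> p * \<psi> p) / \<phi> p" for p
  define x5 where "x5 p = \<alpha> p * (\<phi> p * \<psi> p) / (\<sigma> p * \<psi> p)" for p
  define y5 where "y5 p = - (a p * \<psi> p) * y4 p / (\<sigma> p * \<psi> p)" for p
  note coefficients = x3_def y3_def y4_def x5_def y5_def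
  note sys = surface_frame_system[where M = "\<lambda>p. \<alpha> p * (\<phi> p * \<psi> p)", OF oU mz(3) smooth_\<phi>\<psi>(1) gh e]
  note sys' = surface_frame_system[where M = "\<lambda>p. \<alpha> p * (\<phi> p * \<psi> p)", OF oU mw(3) smooth_\<phi>\<psi>(1) gh e']
  have hz: "has_partials z (\<phi> p *\<^sub>R e1 p) ((a p * \<psi> p) *\<^sub>R e1 p + (\<sigma> p * \<psi> p) *\<^sub>R e2 p) p" if "p \<in> U" for p
    using smooth_on_has_partials[OF oU mz(3) that] by (simp add: zu[OF that] zv[OF that])
  have hw: "has_partials w (\<phi> p *\<^sub>R e1' p) ((a p * \<psi> p) *\<^sub>R e1' p + (\<sigma> p * \<psi> p) *\<^sub>R e2' p) p" if "p \<in> U" for p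
    using smooth_on_has_partials[OF oU mw(3) that] by (simp add: wu[OF that] wv[OF that])
  show ?thesis
  proof (rule congruent_frames_motion[where ?x3.0 = x3 and ?x4.0 = "\<lambda>_. 0" and ?x5.0 = x5 and ?y3.0 = y3
        and ?y4.0 = y4 and ?y5.0 = y5 and ?e1.0 = e1 and ?e2.0 = e2 and n = n and e1' = e1' and e2' = e2' and n' = n'
        and \<phi> = \<phi> and g = "\<lambda>p. a p * \<psi> p" and h = "\<lambda>p. \<sigma> p * \<psi> p", OF open_rectangle_convex[OF mz(1)] mz(2) _ _ det[OF mz(2)] det'[OF mz(2)]])
    fix p assume p: "p \<in> U"
    show "lorentz_frame (e1 p) (e2 p) (n p)" "lorentz_frame (e1' p) (e2' p) (n' p)"
      using fr fr' p by blast+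
    show "has_partials e1 (x3 p *\<^sub>R e2 p + 0 *\<^sub>R n p) (y3 p *\<^sub>R e2 p + y4 p *\<^sub>R n p) p"
      unfolding coefficients by (rule sys(1)) (assumption | rule fr pos zu zv LMN p)+
    show "has_partials e2 (x3 p *\<^sub>R e1 p + x5 p *\<^sub>R n p) (y3 p *\<^sub>R e1 p + y5 p *\<^sub>R n p) p"
      unfolding coefficients by (rule sys(2)) (assumption | rule fr pos zu zv LMN p)+
    show "has_partials n (x5 p *\<^sub>R e2 p - 0 *\<^sub>R e1 p) (y5 p *\<^sub>R e2 p - y4 p *\<^sub>R e1 p) p"
      unfolding coefficients by (rule sys(3)) (assumption | rule fr pos zu zv LMN p)+
    show "has_partials e1' (x3 p *\<^sub>R e2' p + 0 *\<^sub>R n' p) (y3 p *\<^sub>R e2' p + y4 p *\<^sub>R n' p) p"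
      unfolding coefficients by (rule sys'(1)) (assumption | rule fr' pos wu wv LMN' p)+
    show "has_partials e2' (x3 p *\<^sub>R e1' p + x5 p *\<^sub>R n' p) (y3 p *\<^sub>R e1' p + y5 p *\<^sub>R n' p) p"
      unfolding coefficients by (rule sys'(2)) (assumption | rule fr' pos wu wv LMN' p)+
    show "has_partials n' (x5 p *\<^sub>R e2' p - 0 *\<^sub>R e1' p) (y5 p *\<^sub>R e2' p - y4 p *\<^sub>R e1' p) p"
      unfolding coefficients by (rule sys'(3)) (assumption | rule fr' pos wu wv LMN' p)+
    show "has_partials z (\<phi> p *\<^sub>R e1 p) ((a p * \<psi> p) *\<^sub>R e1 p + (\<sigma> p * \<psi> p) *\<^sub>R e2 p) p"
      "has_partials w (\<phi> p *\<^sub>R e1' p) ((a p * \<psi> p) *\<^sub>R e1' p + (\<sigma> p * \<psi> p) *\<^sub>R e2' p) p"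
      using hz hw p by blast+
  qed
qed

text \<open>The local form: \<open>R\<close> is a rectangle on which the solution is positive, and
  existence yields a domain inside it. Uniqueness is asserted on every common domain inside
  \<open>D\<close>; such a domain is a rectangle around the base point by the definition of
  canonical parameters.\<close>

theorem theorem4p4:
  fixes u0 v0 :: real
    and D R :: "(real \<times> real) set"
    and a \<alpha> f \<Phi> \<Psi> :: "real \<times> real \<Rightarrow> real"
  assumes D: "open D" "(u0, v0) \<in> D"
    and smooth_data: "smooth_on D a" "smooth_on D \<alpha>"
    and alpha_pos: "\<And>p. p \<in> D \<Longrightarrow> \<alpha> p > 0"
    and f: "f = (\<lambda>p. (ln (sqrt (1 + (a p)\<^sup>2)) - ln (\<alpha> p)) / 2)"
    and R: "open_rectangle R" "(u0, v0) \<in> R" "R \<subseteq> D"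
    and solution_smooth: "smooth_on R \<Phi>" "smooth_on R \<Psi>"
    and solution_pos: "\<And>p. p \<in> R \<Longrightarrow> \<Phi> p > 0" "\<And>p. p \<in> R \<Longrightarrow> \<Psi> p > 0"
    and pde_Phi: "\<And>p. p \<in> R \<Longrightarrow> \<partial>\<^sub>v \<Phi> p = \<partial>\<^sub>v f p * \<Phi> p + a p * \<partial>\<^sub>u f p * \<Psi> p"
    and pde_Psi: "\<And>p. p \<in> R \<Longrightarrow> \<partial>\<^sub>u \<Psi> p = - a p * \<partial>\<^sub>v f p * \<Phi> p + \<partial>\<^sub>u f p * \<Psi> p"
    and init_Phi: "\<And>u. (u, v0) \<in> R \<Longrightarrow>
      \<Phi> (u, v0) =
        exp ((LBINT t=u0..u. - a (t, v0) * \<partial>\<^sub>v f (t, v0) + \<partial>\<^sub>u f (t, v0)) + f (u0, v0))"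
    and init_Psi: "\<And>v. (u0, v) \<in> R \<Longrightarrow>
      \<Psi> (u0, v) =
        exp ((LBINT s=v0..v. \<partial>\<^sub>v f (u0, s) + a (u0, s) * \<partial>\<^sub>u f (u0, s)) + f (u0, v0))"
    and equation: "\<And>p. p \<in> R \<Longrightarrow>
      1 / (\<Phi> p * \<Psi> p) *
          (\<partial>\<^sub>v (\<partial>\<^sub>u a) p / (1 + (a p)\<^sup>2)
           - a p * \<partial>\<^sub>u a p * \<partial>\<^sub>v a p / (1 + (a p)\<^sup>2)\<^sup>2
           - 2 * a p * \<partial>\<^sub>u f p * \<partial>\<^sub>v f p)
      + a p * \<partial>\<^sub>u a p * \<partial>\<^sub>u f p / ((1 + (a p)\<^sup>2) * (\<Phi> p)\<^sup>2)
      - a p * \<partial>\<^sub>v a p * \<partial>\<^sub>v f p / ((1 + (a p)\<^sup>2) * (\<Psi> p)\<^sup>2)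
      + (\<partial>\<^sub>u f p)\<^sup>2 / (\<Phi> p)\<^sup>2
      - (\<partial>\<^sub>v f p)\<^sup>2 / (\<Psi> p)\<^sup>2
      + 1 / \<Phi> p * \<partial>\<^sub>u (\<lambda>q. \<partial>\<^sub>u f q / \<Phi> q) p
      - 1 / \<Psi> p * \<partial>\<^sub>v (\<lambda>q. \<partial>\<^sub>v f q / \<Psi> q) p
      + (\<alpha> p)\<^sup>2 / (1 + (a p)\<^sup>2) = 0"
  shows "(\<exists>U z. U \<subseteq> D \<and> canonical_surface_with_invariants u0 v0 a \<alpha> U z) \<and>
         (\<forall>U z w. U \<subseteq> D \<and> canonical_surface_with_invariants u0 v0 a \<alpha> U z \<and>
            canonical_surface_with_invariants u0 v0 a \<alpha> U w \<longrightarrow>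
            (\<exists>T. motion T \<and> (\<forall>p\<in>U. w p = T (z p))))"
proof (intro conjI allI impI)
  interpret data: canonical_data u0 v0 R a \<alpha> f \<Phi> \<Psi>
  proof
    show "smooth_on R a" "smooth_on R \<alpha>" using smooth_data R(3) by (blast intro: smooth_on_subset)+
    show "\<And>p. p \<in> R \<Longrightarrow> \<alpha> p > 0" using alpha_pos R(3) by blast
  qed (fact R(1,2) solution_smooth f solution_pos pde_Phi pde_Psi equation)+
  obtain U z where "U \<subseteq> R" "canonical_surface_with_invariants u0 v0 a \<alpha> U z"
    using data.canonical_surface_exists[OF init_Phi init_Psi] by blast
  then show "\<exists>U z. U \<subseteq> D \<and> canonical_surface_with_invariants u0 v0 a \<alpha> U z"
    using R(3) by blast
next
  fix U z w
  assume S: "U \<subseteq> D \<and> canonical_surface_with_invariants u0 v0 a \<alpha> U z \<and>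
      canonical_surface_with_invariants u0 v0 a \<alpha> U w"
  then have U: "U \<subseteq> D" by blast
  show "\<exists>T. motion T \<and> (\<forall>p\<in>U. w p = T (z p))"
    by (rule canonical_surface_unique[of u0 v0 a \<alpha> U])
       (use S smooth_on_subset[OF smooth_data(1) U] smooth_on_subset[OF smooth_data(2) U] alpha_pos U in blast)+
qed

end
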